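(* Consider the system $$\dot z=q(z,x,d),\qquad \dot x=f(z,x,d)+u,$$ with $z\in\mathbb{R}^p$, $x\in\mathbb{R}$, $u\in\mathbb{R}$, $d\in\mathbb{D}$, and the sampled controller $$u(t)=\kappa(x(t_k))=-\rho(x(t_k))\,x(t_k),\quad t\in[t_k,t_{k+1}),\ k\in\mathbb{N}.$$ Suppose that the $z$-subsystem has an ISS-Lyapunov function $V(z)\sim\{\underline{\alpha},\bar\alpha,\alpha,\sigma\mid\dot z=q(z,x,d)\}$ with $\limsup_{s\to0^+}s^2/\alpha(s)<\infty$ and $\limsup_{s\to0^+}\sigma(s)/s^2<\infty$. Then there exist sufficiently smooth positive functions $\rho:\mathbb{R}\to\mathbb{R}_{>0}$ and $\gamma:\mathbb{R}_{\ge0}\to\mathbb{R}_{\ge0}$ (positive for positive arguments) such that, when the event-triggered law is designed as $$t_{k+1}=\inf\Big\{t>t_k\ \Big|\ 2(t-t_k)\,\gamma(\|\varpi_{[t_k,t]}\|)\ge\max_{\tau\in[t_k,t]}U(\varpi(\tau)),\ \text{ and }\ \|\varpi_{[t_k,t]}\|\ne0\Big\},$$ where $U(\varpi)=\tfrac12\varpi^2$, the equilibrium point $(z,x)=0$ of the closed-loop system is globally asymptotically stable and Zeno behavior is avoided.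
   Context: The uncertainty $d$ takes values in a compact set $\mathbb{D}\subset\mathbb{R}^l$. The functions $q$ and $f$ are sufficiently smooth with $q(0,0,d)=0$ and $f(0,0,d)=0$ for all $d\in\mathbb{D}$. The state $z$ is not available for feedback; the size of $\mathbb{D}$ is known. The sampling error is $\varpi(t)=\kappa(x(t_k))-\kappa(x(t))$ for $t\in[t_k,t_{k+1})$, with $\kappa(x)=-\rho(x)x$. On an interval $[t_k,t]$ in the sampling law, $\varpi$ denotes the error relative to the sample at $t_k$ (so it starts from $0$ at $t_k$ and evolves continuously); the infimum of the empty set is $+\infty$. $\|\varpi_{[a,b]}\|=\sup_{t\in[a,b]}|\varpi(t)|$, and $\mathbb{N}$ is the set of non-negative integers. $V(z)\sim\{\underline{\alpha},\bar\alpha,\alpha,\sigma\mid\dot z=q(z,x,d)\}$ ("ISS-Lyapunov function") means that $V:\mathbb{R}^p\to\mathbb{R}_{\ge0}$ is continuously differentiable, $\underline{\alpha},\bar\alpha,\alpha,\sigma\in\mathcal{K}_\infty$, and for all $z\in\mathbb{R}^p$, $x\in\mathbb{R}$, $d\in\mathbb{D}$: $\underline{\alpha}(\|z\|)\le V(z)\le\bar\alpha(\|z\|)$ and, along $\dot z=q(z,x,d)$, $\dot V(z)\le-\alpha(\|z\|)+\sigma(|x|)$. Zeno behavior is avoided means that only a finite number of events are triggered in any finite amount of time. *)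

theory Defs
  imports "HOL-Analysis.Analysis"
begin

section \<open>Regularity and comparison functions\<close>

definition C1 :: "('a::real_normed_vector \<Rightarrow> 'b::real_normed_vector) \<Rightarrow> bool" where
  "C1 g \<longleftrightarrow> (\<exists>g'. continuous_on UNIV g' \<and>
     (\<forall>w. (g has_derivative blinfun_apply (g' w)) (at w)))"

definition smooth :: "(real \<Rightarrow> real) \<Rightarrow> bool" where
  "smooth g \<longleftrightarrow> (\<forall>n x. ((deriv ^^ n) g) differentiable (at x))"

definition class_K_infinity :: "(real \<Rightarrow> real) \<Rightarrow> bool" where
  "class_K_infinity a \<longleftrightarrow>
     continuous_on {0..} a \<and> strict_mono_on {0..} a \<and> a 0 = 0 \<and> filterlim a at_top at_top"

definition ISS_Lyapunov ::
  "(real ^ 'l) set \<Rightarrow> (real ^ 'p \<Rightarrow> real \<Rightarrow> real ^ 'l \<Rightarrow> real ^ 'p) \<Rightarrow> (real ^ 'p \<Rightarrow> real) \<Rightarrow>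
   (real \<Rightarrow> real) \<Rightarrow> (real \<Rightarrow> real) \<Rightarrow> (real \<Rightarrow> real) \<Rightarrow> (real \<Rightarrow> real) \<Rightarrow> bool" where
  "ISS_Lyapunov D q V \<alpha>\<^sub>l \<alpha>\<^sub>u \<alpha> \<sigma> \<longleftrightarrow>
     C1 V \<and> (\<forall>z. 0 \<le> V z) \<and>
     class_K_infinity \<alpha>\<^sub>l \<and> class_K_infinity \<alpha>\<^sub>u \<and> class_K_infinity \<alpha> \<and> class_K_infinity \<sigma> \<and>
     (\<forall>z x d. d \<in> D \<longrightarrow>
        \<alpha>\<^sub>l (norm z) \<le> V z \<and> V z \<le> \<alpha>\<^sub>u (norm z) \<and>
        frechet_derivative V (at z) (q z x d) \<le> - \<alpha> (norm z) + \<sigma> \<bar>x\<bar>)"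

section \<open>Uncertainty signals\<close>

text \<open>The uncertainty may vary with time: any signal with values in the given set whose
  discontinuities are locally finite, in particular any constant and any piecewise
  continuous signal.\<close>

definition uncertainty :: "'a::topological_space set \<Rightarrow> (real \<Rightarrow> 'a) \<Rightarrow> bool" where
  "uncertainty D d \<longleftrightarrow>
     (\<forall>t\<ge>0. d t \<in> D) \<and> (\<forall>b. finite {t \<in> {0..b}. \<not> isCont d t})"

section \<open>Event-triggered sampling\<close>

definition feedback :: "(real \<Rightarrow> real) \<Rightarrow> real \<Rightarrow> real" where
  "feedback \<rho> x = - \<rho> x * x"

definition sampling_error :: "(real \<Rightarrow> real) \<Rightarrow> (real \<Rightarrow> real) \<Rightarrow> real \<Rightarrow> real \<Rightarrow> real" where
  "sampling_error \<rho> x a t = feedback \<rho> (x a) - feedback \<rho> (x t)"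

definition sup_norm :: "(real \<Rightarrow> real) \<Rightarrow> real \<Rightarrow> real \<Rightarrow> real" where
  "sup_norm w a b = (SUP t\<in>{a..b}. \<bar>w t\<bar>)"

definition U :: "real \<Rightarrow> real" where
  "U w = w\<^sup>2 / 2"

text \<open>The supremum of \<open>U \<circ> w\<close> is a maximum because \<open>w\<close> is continuous on \<open>{a..t}\<close>
  along trajectories.\<close>

definition event_condition :: "(real \<Rightarrow> real) \<Rightarrow> (real \<Rightarrow> real) \<Rightarrow> real \<Rightarrow> real \<Rightarrow> bool" where
  "event_condition \<gamma> w a t \<longleftrightarrow>
     2 * (t - a) * \<gamma> (sup_norm w a t) \<ge> (SUP \<tau>\<in>{a..t}. U (w \<tau>)) \<and> sup_norm w a t \<noteq> 0"

section \<open>Closed-loop trajectories\<close>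

text \<open>A trajectory \<open>(z, x) = X\<close> on \<open>[0, T)\<close>, \<open>0 < T \<le> \<infinity>\<close>, with sampling instants \<open>ts k\<close>.
  An instant is \<open>\<infinity>\<close> if no further event occurs on \<open>[0, T)\<close> (the infimum of the empty set
  of extended reals is \<open>\<infinity>\<close>). Only \<open>[0, T)\<close> has to be covered by the sampling intervals, so
  accumulation of the instants at a finite \<open>T\<close> (Zeno behavior) is not excluded by definition.
  The differential equations hold off the sampling instants and the discontinuities of \<open>d\<close>;
  there the state is merely continuous.\<close>

definition closed_loop_trajectory ::
  "(real ^ 'p \<Rightarrow> real \<Rightarrow> real ^ 'l \<Rightarrow> real ^ 'p) \<Rightarrow> (real ^ 'p \<Rightarrow> real \<Rightarrow> real ^ 'l \<Rightarrow> real) \<Rightarrow>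
   (real \<Rightarrow> real) \<Rightarrow> (real \<Rightarrow> real) \<Rightarrow> (real \<Rightarrow> real ^ 'l) \<Rightarrow>
   ereal \<Rightarrow> (nat \<Rightarrow> ereal) \<Rightarrow> (real \<Rightarrow> (real ^ 'p) \<times> real) \<Rightarrow> bool" where
  "closed_loop_trajectory q f \<rho> \<gamma> d T ts X \<longleftrightarrow>
     (let z = (\<lambda>t. fst (X t)); x = (\<lambda>t. snd (X t)) in
       0 < T \<and>
       continuous_on {t. 0 \<le> t \<and> ereal t < T} X \<and>
       ts 0 = 0 \<and>
       (\<forall>k. ts (Suc k) = Inf (ereal ` {t. ts k < ereal t \<and> ereal t < T \<and>
          event_condition \<gamma> (sampling_error \<rho> x (real_of_ereal (ts k))) (real_of_ereal (ts k)) t})) \<and>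
       (\<forall>t. 0 \<le> t \<and> ereal t < T \<longrightarrow> (\<exists>k. ts k \<le> ereal t \<and> ereal t < ts (Suc k))) \<and>
       (\<forall>k t. ts k < ereal t \<and> ereal t < ts (Suc k) \<and> ereal t < T \<and> isCont d t \<longrightarrow>
          (z has_vector_derivative q (z t) (x t) (d t)) (at t) \<and>
          (x has_real_derivative
             f (z t) (x t) (d t) + feedback \<rho> (x (real_of_ereal (ts k)))) (at t)))"

text \<open>Global asymptotic stability of the origin for a family of trajectories, where \<open>Tr T X\<close>
  says that \<open>X\<close> is a trajectory on \<open>[0, T)\<close>. The first two clauses are forward completeness:
  a trajectory on \<open>[0, \<infinity>)\<close> exists from every initial state, and every trajectory on a
  bounded interval extends to one. That the origin is an equilibrium is the
  case \<open>X 0 = 0\<close> of the third clause.\<close>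

definition globally_asymptotically_stable ::
  "(ereal \<Rightarrow> (real \<Rightarrow> 'a::real_normed_vector) \<Rightarrow> bool) \<Rightarrow> bool" where
  "globally_asymptotically_stable Tr \<longleftrightarrow>
     (\<forall>\<xi>. \<exists>X. Tr \<infinity> X \<and> X 0 = \<xi>) \<and>
     (\<forall>T X. Tr T X \<longrightarrow> (\<exists>Y. Tr \<infinity> Y \<and> (\<forall>t. 0 \<le> t \<and> ereal t < T \<longrightarrow> Y t = X t))) \<and>
     (\<forall>\<epsilon>>0. \<exists>\<delta>>0. \<forall>X. Tr \<infinity> X \<and> norm (X 0) < \<delta> \<longrightarrow> (\<forall>t\<ge>0. norm (X t) < \<epsilon>)) \<and>
     (\<forall>X. Tr \<infinity> X \<longrightarrow> (X \<longlongrightarrow> 0) at_top)"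

text \<open>Events are counted by their index, so coinciding instants count separately.\<close>

definition Zeno_free :: "(nat \<Rightarrow> ereal) \<Rightarrow> bool" where
  "Zeno_free ts \<longleftrightarrow> (\<forall>b::real. finite {k. ts k \<le> ereal b})"

end

theory Submission
  imports Defs
begin

text \<open>Take \<open>\<gamma> s = s\<^sup>2 * m s\<close>. With \<open>s\<close> the largest error since the last sample at \<open>a\<close>, an event at
  \<open>t\<close> means \<open>1 \<le> 4 * (t - a) * m s\<close> and \<open>s \<noteq> 0\<close>, so events are separated by a dwell time as
  long as the state is bounded.

  Split \<open>\<bar>f z x d\<bar>\<close> into a function of \<open>z\<close> and a function of \<open>x\<close>. Rescaling the storage function to
  \<open>V z * \<psi> (V z)\<close> lets \<open>z\<close> dissipate any prescribed function of \<open>z\<close>, and \<open>\<rho>\<close> is chosen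
  afterwards to absorb the resulting terms in \<open>x\<close>. There remains the product of \<open>x\<close> with the
  error. Either \<open>s\<close> is small relative to the held input, and the product is absorbed by
  \<open>\<rho> x * x\<^sup>2\<close>; or every \<open>x\<close> on the sampling interval is bounded in terms of \<open>s\<close>, and then a large
  \<open>m\<close>, chosen after \<open>\<rho>\<close>, makes the interval so short that \<open>s\<^sup>2\<close> is bounded by the integral of the
  dissipated function of \<open>z\<close>. Since \<open>m\<close> is a function of the error alone, the choice is not circular.
  Hence the Lyapunov function plus the integral of the squared norm of the state never exceeds its
  initial value, which gives boundedness, stability and, by a Barbalat argument, convergence.

  All design functions are even power series with nonnegative coefficients: they are smooth,
  increasing in \<open>\<bar>x\<bar>\<close>, and dominate every locally bounded function.\<close>

section \<open>Even power series as smooth majorants\<close>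

text \<open>Both growth hypotheses concern the origin: there \<open>\<alpha> s\<close> dominates a
  multiple of \<open>s\<^sup>2\<close> and \<open>\<sigma> s\<close> is dominated by one, so
  quadratic terms can be absorbed with locally bounded factors; elsewhere monotonicity gives such
  bounds. The choices form a chain: \<open>\<phi>\<close> comes from \<open>f\<close>,
  \<open>\<psi>\<close> from \<open>\<phi>\<close>, \<open>\<alpha>\<close> and the lower bound of
  \<open>V\<close>, the chain-rule factor \<open>l\<close> from \<open>\<psi>\<close>, then
  \<open>\<rho>\<close> from \<open>l\<close>, \<open>\<phi>\<close> and \<open>\<sigma>\<close>,
  its slope \<open>k\<close> for \<open>x * \<rho> x\<close>, and finally \<open>m\<close> from
  \<open>k\<close> and \<open>\<phi>\<close>. Two features of the sampling law shape the rest. A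
  trajectory may end where its instants accumulate, so the Lyapunov estimate has to hold on every
  \<open>[0, T)\<close> before anything is known about accumulation, which it then excludes.
  Moreover a nonzero error is an open condition, so the infimum of the event times need not itself
  be an event: an error that stays zero for long and then leaves zero triggers immediately, with
  events accumulating from the right. Existence of trajectories has to treat this case
  separately.\<close>

definition even_series :: "(real \<Rightarrow> real) \<Rightarrow> bool" where
  "even_series h \<longleftrightarrow> (\<exists>c. (\<forall>n. 0 \<le> c n) \<and> (\<forall>n. odd n \<longrightarrow> c n = 0) \<and>
     (\<forall>x. (\<lambda>n. c n * x ^ n) sums h x))"

lemma power_series_deriv:
  fixes g :: "real \<Rightarrow> real"
  assumes "\<And>x. (\<lambda>n. c n * x ^ n) sums g x"
  shows "(g has_real_derivative (\<Sum>n. diffs c n * x ^ n)) (at x)"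
    and "(\<lambda>n. diffs c n * x ^ n) sums (\<Sum>n. diffs c n * x ^ n)"
proof -
  have s: "summable (\<lambda>n. c n * x ^ n)" for x
    using assms sums_summable by blast
  have g: "g = (\<lambda>x. \<Sum>n. c n * x ^ n)"
    using assms sums_unique by blast
  show "(g has_real_derivative (\<Sum>n. diffs c n * x ^ n)) (at x)"
    unfolding g by (rule termdiffs_strong_converges_everywhere[OF s])
  show "(\<lambda>n. diffs c n * x ^ n) sums (\<Sum>n. diffs c n * x ^ n)"
    by (rule summable_sums, rule termdiff_converges_all[OF s])
qed

lemma power_series_smooth:
  fixes g :: "real \<Rightarrow> real"
  assumes "\<And>x. (\<lambda>n. c n * x ^ n) sums g x"
  shows "smooth g"
proof -
  have "\<exists>c. \<forall>x. (\<lambda>n. c n * x ^ n) sums ((deriv ^^ k) g) x" for k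
  proof (induction k)
    case 0
    then show ?case using assms by auto
  next
    case (Suc k)
    then obtain c where c: "\<And>x. (\<lambda>n. c n * x ^ n) sums ((deriv ^^ k) g) x" by blast
    have "(deriv ^^ Suc k) g x = (\<Sum>n. diffs c n * x ^ n)" for x
      using DERIV_imp_deriv[OF power_series_deriv(1)[OF c]] by simp
    then show ?case using power_series_deriv(2)[OF c] by metis
  qed
  then show ?thesis
    unfolding smooth_def using power_series_deriv(1) real_differentiable_def by metis
qed

lemma even_series_smooth: "even_series h \<Longrightarrow> smooth h"
  unfolding even_series_def using power_series_smooth by blast

lemma even_series_nonneg: "even_series h \<Longrightarrow> 0 \<le> h x"
proof -
  assume "even_series h"
  then obtain c where c: "\<And>n. 0 \<le> c n" "\<And>n. odd n \<Longrightarrow> c n = 0"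
    "(\<lambda>n. c n * x ^ n) sums h x" unfolding even_series_def by blast
  have "0 \<le> c n * x ^ n" for n
    by (cases "odd n") (auto simp: c zero_le_even_power)
  then show ?thesis by (rule sums_le[OF _ sums_zero c(3)])
qed

lemma even_series_mono:
  assumes "even_series h" "\<bar>x\<bar> \<le> \<bar>y\<bar>"
  shows "h x \<le> h y"
proof -
  obtain c where c: "\<And>n. 0 \<le> c n" "\<And>n. odd n \<Longrightarrow> c n = 0"
    "\<And>x. (\<lambda>n. c n * x ^ n) sums h x" using assms(1) unfolding even_series_def by blast
  have "c n * x ^ n \<le> c n * y ^ n" for n
  proof (cases "odd n")
    case False
    then have "x ^ n = \<bar>x\<bar> ^ n" "y ^ n = \<bar>y\<bar> ^ n" by (auto simp: power_even_abs)
    then show ?thesis using assms(2) by (simp add: c mult_left_mono power_mono)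
  qed (simp add: c)
  then show ?thesis by (rule sums_le[OF _ c(3) c(3)])
qed

lemma even_series_abs: "even_series h \<Longrightarrow> h \<bar>x\<bar> = h x"
  by (simp add: even_series_mono order_antisym)

text \<open>The derivative has the coefficients \<open>(n + 1) * c n\<close>, so it dominates
  \<open>h\<close> term by term. It is applied to \<open>v * \<psi> v\<close>, the rescaling of the
  storage function, and to \<open>x * \<rho> x\<close>, the feedback up to sign.\<close>

lemma even_series_mult_id_deriv:
  assumes "even_series h"
  obtains h' where "even_series h'" "\<And>x. ((\<lambda>x. x * h x) has_real_derivative h' x) (at x)"
    "\<And>x. h x \<le> h' x"
proof -
  obtain c where c: "\<And>n. 0 \<le> c n" "\<And>n. odd n \<Longrightarrow> c n = 0"
    "\<And>x. (\<lambda>n. c n * x ^ n) sums h x" using assms unfolding even_series_def by blast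
  define b where "b n = (case n of 0 \<Rightarrow> 0 | Suc n \<Rightarrow> c n)" for n
  have b: "(\<lambda>n. b n * x ^ n) sums (x * h x)" for x
  proof -
    have "(\<lambda>n. x * (c n * x ^ n)) sums (x * h x)" by (rule sums_mult[OF c(3)])
    then have "(\<lambda>n. b (Suc n) * x ^ Suc n) sums (x * h x)"
      by (simp add: b_def mult_ac)
    then show ?thesis by (subst (asm) sums_Suc_iff) (simp add: b_def)
  qed
  define h' where "h' x = (\<Sum>n. diffs b n * x ^ n)" for x
  have d: "diffs b n = real (Suc n) * c n" for n
    by (simp add: diffs_def b_def)
  note D = power_series_deriv[OF b, folded h'_def]
  show thesis
  proof
    show "even_series h'" unfolding even_series_def
      using D(2) d c by (intro exI[of _ "diffs b"]) auto
    show "((\<lambda>x. x * h x) has_real_derivative h' x) (at x)" for x by (rule D(1))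
    show "h x \<le> h' x" for x
    proof -
      have "c n * x ^ n \<le> diffs b n * x ^ n" for n
      proof (cases "odd n")
        case False
        then have "0 \<le> c n * x ^ n" by (simp add: c zero_le_even_power)
        then have "1 * (c n * x ^ n) \<le> real (Suc n) * (c n * x ^ n)"
          by (intro mult_right_mono) auto
        then show ?thesis by (simp add: d mult_ac)
      qed (simp add: c d)
      then show ?thesis by (rule sums_le[OF _ c(3) D(2)])
    qed
  qed
qed

lemma even_series_power2_mult:
  assumes "even_series h"
  shows "even_series (\<lambda>x. x\<^sup>2 * h x)"
proof -
  obtain c where c: "\<And>n. 0 \<le> c n" "\<And>n. odd n \<Longrightarrow> c n = 0"
    "\<And>x. (\<lambda>n. c n * x ^ n) sums h x" using assms unfolding even_series_def by blast
  define b where "b n = (if n < 2 then 0 else c (n - 2))" for n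
  have "(\<lambda>n. b n * x ^ n) sums (x\<^sup>2 * h x)" for x
  proof -
    have "(\<lambda>n. x\<^sup>2 * (c n * x ^ n)) sums (x\<^sup>2 * h x)" by (rule sums_mult[OF c(3)])
    moreover have "x\<^sup>2 * (c n * x ^ n) = b (n + 2) * x ^ (n + 2)" for n
      by (simp add: b_def power2_eq_square)
    ultimately have "(\<lambda>n. b (n + 2) * x ^ (n + 2)) sums (x\<^sup>2 * h x)" by simp
    then show ?thesis by (subst (asm) sums_iff_shift) (simp add: b_def numeral_2_eq_2)
  qed
  then show ?thesis unfolding even_series_def
    by (intro exI[of _ b]) (auto simp: b_def c)
qed

text \<open>The sum over \<open>n\<close> of \<open>M n * (x / n) ^ e n\<close> dominates \<open>M n\<close> on \<open>[n, n + 1]\<close>; even exponents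
  \<open>e n\<close> growing fast enough make the \<open>n\<close>-th term at most \<open>2 ^ (- n)\<close> once \<open>2 * \<bar>x\<bar> < n\<close>.
  The constant \<open>M 0\<close> is added because the term for \<open>n = 0\<close> vanishes (\<open>x / 0 = 0\<close>).\<close>

lemma even_series_majorant_nat:
  fixes M :: "nat \<Rightarrow> real"
  assumes M: "\<And>n. 0 \<le> M n"
  obtains h where "even_series h" "\<And>n x. real n \<le> x \<Longrightarrow> x \<le> real n + 1 \<Longrightarrow> M n \<le> h x"
proof -
  \<comment> \<open>The exponent is twice \<open>k n\<close>: one factor \<open>(1/2) ^ k n\<close>
    cancels \<open>M n\<close>, since \<open>M n \<le> k n \<le> 2 ^ k n\<close>, and the other
    gives geometric decay. The cumulative sum keeps the exponents distinct.\<close>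
  define k where "k n = Suc n + (\<Sum>i\<le>n. nat \<lceil>M i\<rceil>)" for n
  define e where "e n = 2 * k n" for n
  have "strict_mono e" by (rule strict_monoI_Suc) (simp add: e_def k_def)
  then have inj: "inj e" by (rule strict_mono_imp_inj_on)
  have e_pos: "0 < e n" for n by (simp add: e_def k_def)
  define c where "c j = (if j = 0 then M 0 else if j \<in> range e then M (inv e j) / real (inv e j) ^ j else 0)" for j
  have c_e: "c (e n) * x ^ e n = M n * (x / real n) ^ e n" for n x
    using e_pos[of n] inj by (simp add: c_def power_divide)
  have small: "M n * (1/2) ^ e n \<le> (1/2) ^ n" for n
  proof -
    have "M n \<le> real (nat \<lceil>M n\<rceil>)" by linarith
    also have "nat \<lceil>M n\<rceil> \<le> k n"
    proof -
      have "nat \<lceil>M n\<rceil> \<le> (\<Sum>i\<le>n. nat \<lceil>M i\<rceil>)" by (rule member_le_sum) auto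
      then show ?thesis by (simp add: k_def)
    qed
    also have "real (k n) \<le> 2 ^ k n" by (simp add: less_imp_le of_nat_less_two_power)
    finally have "M n * (1/2) ^ k n \<le> 1" by (simp add: field_simps power_one_over)
    then have "M n * (1/2) ^ k n * (1/2) ^ k n \<le> 1 * (1/2) ^ k n"
      by (intro mult_right_mono) auto
    also have "\<dots> \<le> (1/2) ^ n"
      unfolding mult_1 by (rule power_decreasing) (auto simp: k_def)
    finally show ?thesis by (simp only: e_def mult_2 power_add mult.assoc)
  qed
  have tail: "summable (\<lambda>n. c (e n) * x ^ e n)" for x
  proof (rule summable_comparison_test_ev)
    show "summable (\<lambda>n. (1/2::real) ^ n)" by (rule summable_geometric) simp
    have "norm (c (e n) * x ^ e n) \<le> (1/2) ^ n" if "2 * \<bar>x\<bar> + 1 \<le> real n" for n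
    proof -
      have "norm (c (e n) * x ^ e n) = M n * (\<bar>x\<bar> / real n) ^ e n"
        unfolding c_e using M by (simp add: abs_mult power_abs)
      also have "\<dots> \<le> M n * (1/2) ^ e n"
        using that by (intro mult_left_mono power_mono M) (auto simp: field_simps)
      also note small
      finally show ?thesis .
    qed
    moreover have "eventually (\<lambda>n. 2 * \<bar>x\<bar> + 1 \<le> real n) sequentially"
      using eventually_ge_at_top[of "nat \<lceil>2 * \<bar>x\<bar> + 1\<rceil>"]
      by eventually_elim linarith
    ultimately show "\<forall>\<^sub>F n in sequentially. norm (c (e n) * x ^ e n) \<le> (1/2) ^ n"
      by (auto elim: eventually_mono)
  qed
  have summ: "summable (\<lambda>j. c j * x ^ j)" for x
  proof -
    have "summable (\<lambda>j. (if j = 0 then 0 else c j) * x ^ j)"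
    proof (subst summable_mono_reindex[OF \<open>strict_mono e\<close>, symmetric])
      show "summable (\<lambda>n. (if e n = 0 then 0 else c (e n)) * x ^ e n)"
        using tail[of x] e_pos by (simp add: less_imp_neq[symmetric])
    qed (simp add: c_def)
    then have "summable (\<lambda>j. (if Suc j = 0 then 0 else c (Suc j)) * x ^ Suc j)"
      by (subst summable_Suc_iff)
    then show ?thesis by (subst summable_Suc_iff[symmetric]) simp
  qed
  define h where "h x = (\<Sum>j. c j * x ^ j)" for x
  have sums: "(\<lambda>j. c j * x ^ j) sums h x" for x
    unfolding h_def by (rule summable_sums[OF summ])
  have c0: "0 \<le> c j" for j by (simp add: c_def M)
  have odd: "c j = 0" if "odd j" for j using that by (auto simp: c_def e_def odd_pos)
  have "even_series h" unfolding even_series_def using sums c0 odd by blast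
  moreover have "M n \<le> h x" if "real n \<le> x" "x \<le> real n + 1" for n x
  proof -
    have pos: "0 \<le> c j * x ^ j" for j using c0 that by simp
    have le: "c j * x ^ j \<le> h x" for j
      using sum_le_suminf[OF summ, of "{j}"] pos by (simp add: h_def)
    show ?thesis
    proof (cases n)
      case 0
      then show ?thesis using le[of 0] by (simp add: c_def)
    next
      case (Suc _)
      then have "1 \<le> (x / real n) ^ e n"
        using that by (intro one_le_power) (simp add: field_simps)
      then have "M n * 1 \<le> M n * (x / real n) ^ e n" by (intro mult_left_mono M)
      then show ?thesis using le[of "e n"] by (simp add: c_e)
    qed
  qed
  ultimately show thesis using that by blast
qed

text \<open>The arbitrary index set and size \<open>r\<close> let one lemma serve every design
  function: \<open>r\<close> is the larger of \<open>norm z\<close> and \<open>\<bar>x\<bar>\<close>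
  for the vector field, \<open>V z\<close> for the storage function, and
  \<open>\<bar>x\<bar>\<close> on pairs \<open>(z, x)\<close> where \<open>x\<close> controls
  \<open>z\<close> for the feedback.\<close>

lemma even_series_majorant:
  fixes r g :: "'i \<Rightarrow> real"
  assumes "\<And>N. \<exists>B. \<forall>i\<in>S. r i \<le> N \<longrightarrow> g i \<le> B"
  obtains h where "even_series h" "\<And>i. i \<in> S \<Longrightarrow> 0 \<le> r i \<Longrightarrow> g i \<le> h (r i)"
proof -
  obtain B where B: "\<And>N i. i \<in> S \<Longrightarrow> r i \<le> N \<Longrightarrow> g i \<le> B N"
    using assms by metis
  obtain h where h: "even_series h"
    "\<And>n x. real n \<le> x \<Longrightarrow> x \<le> real n + 1 \<Longrightarrow> max 0 (B (real n + 1)) \<le> h x"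
    using even_series_majorant_nat[of "\<lambda>n. max 0 (B (real n + 1))"] by auto
  have "g i \<le> h (r i)" if "i \<in> S" "0 \<le> r i" for i
  proof -
    have "real (nat \<lfloor>r i\<rfloor>) \<le> r i" "r i \<le> real (nat \<lfloor>r i\<rfloor>) + 1" using that by linarith+
    then show ?thesis using B[of i "real (nat \<lfloor>r i\<rfloor>) + 1"] h(2)[of "nat \<lfloor>r i\<rfloor>" "r i"] that by linarith
  qed
  then show thesis using that h(1) by blast
qed

section \<open>Differential inequalities and initial value problems with exceptional instants\<close>

text \<open>Continuity bridges the finitely many instants without a derivative: the fundamental
  theorem of calculus holds off a finite set, and the integrand may be set to zero there.\<close>

lemma nonincreasing_off_finite:
  fixes g :: "real \<Rightarrow> real"
  assumes "finite S" "a \<le> b" "continuous_on {a..b} g"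
    and "\<And>t. t \<in> {a<..<b} - S \<Longrightarrow> \<exists>v\<le>0. (g has_real_derivative v) (at t)"
  shows "g b \<le> g a"
proof -
  obtain v where v: "\<And>t. t \<in> {a<..<b} - S \<Longrightarrow> v t \<le> 0 \<and> (g has_vector_derivative v t) (at t)"
    using assms(4) unfolding has_real_derivative_iff_has_vector_derivative by metis
  define v' where "v' t = (if t \<in> {a<..<b} - S then v t else 0)" for t
  have "(v' has_integral (g b - g a)) {a..b}"
    using v assms by (intro fundamental_theorem_of_calculus_interior_strong) (auto simp: v'_def)
  moreover have "((\<lambda>t. 0) has_integral (0::real)) {a..b}" by simp
  ultimately have "g b - g a \<le> 0"
    by (rule has_integral_le) (use v in \<open>auto simp: v'_def\<close>)
  then show ?thesis by simp
qed

lemma lipschitz_off_finite: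
  fixes g :: "real \<Rightarrow> 'a::euclidean_space"
  assumes "finite S" "a \<le> b" "continuous_on {a..b} g" "0 \<le> M"
    and "\<And>t. t \<in> {a<..<b} - S \<Longrightarrow> \<exists>v. norm v \<le> M \<and> (g has_vector_derivative v) (at t)"
  shows "norm (g b - g a) \<le> M * (b - a)"
proof -
  obtain v where v: "\<And>t. t \<in> {a<..<b} - S \<Longrightarrow> norm (v t) \<le> M \<and> (g has_vector_derivative v t) (at t)"
    using assms(5) by metis
  define v' where "v' t = (if t \<in> {a<..<b} - S then v t else 0)" for t
  have "(v' has_integral (g b - g a)) (cbox a b)"
    using v assms by (auto intro!: fundamental_theorem_of_calculus_interior_strong simp: v'_def)
  then have "norm (g b - g a) \<le> M * measure lborel (cbox a b)"
    by (rule has_integral_bound[OF \<open>0 \<le> M\<close>]) (use v assms(4) in \<open>auto simp: v'_def\<close>)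
  then show ?thesis using assms(2) by simp
qed

text \<open>The right-hand side of the differential equation jumps with the uncertainty. It is still
  measurable and bounded on an open set that misses only finitely many points, which is what the
  Picard operator needs.\<close>

lemma integrable_on_bounded_cont_off_finite:
  fixes h :: "real \<Rightarrow> 'a::euclidean_space"
  assumes "finite S" and cont: "\<And>t. t \<in> {a<..<b} - S \<Longrightarrow> isCont h t"
    and bound: "\<And>t. t \<in> {a..b} \<Longrightarrow> norm (h t) \<le> M"
  shows "h integrable_on {a..b}"
proof -
  let ?O = "{a<..<b} - S"
  have op: "open ?O" using assms(1) by (auto intro!: open_Diff finite_imp_closed)
  then have leb: "?O \<in> sets lebesgue" by (intro sets_completionI_sets) simp
  have "continuous_on ?O h" using cont by (auto intro: continuous_at_imp_continuous_on)
  then have "h \<in> borel_measurable (lebesgue_on ?O)"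
    by (rule continuous_imp_measurable_on_sets_lebesgue[OF _ leb])
  moreover have "(\<lambda>t. M) integrable_on ?O"
  proof (rule integrable_spike_set[of _ "{a..b}"])
    show "(\<lambda>t. M) integrable_on {a..b}" by (rule integrable_const_ivl)
    show "negligible {x \<in> {a..b} - ?O. M \<noteq> 0}"
      by (rule negligible_subset[of "{a, b} \<union> S"]) (use assms(1) in \<open>auto intro: negligible_finite\<close>)
    show "negligible {x \<in> ?O - {a..b}. M \<noteq> 0}" by (rule negligible_subset[of "{}"]) auto
  qed
  ultimately have "h integrable_on ?O"
    by (rule measurable_bounded_by_integrable_imp_integrable) (use bound leb in auto)
  then show ?thesis
  proof (rule integrable_spike_set)
    show "negligible {x \<in> {a..b} - ?O. h x \<noteq> 0}"
      by (rule negligible_subset[of "{a, b} \<union> S"]) (use assms(1) in \<open>auto intro: negligible_finite\<close>)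
    show "negligible {x \<in> ?O - {a..b}. h x \<noteq> 0}" by (rule negligible_subset[of "{}"]) auto
  qed
qed

text \<open>\<open>g\<close> is the indefinite integral of \<open>g'\<close>, hence differentiable
  wherever \<open>g'\<close> is continuous, even at a point of the exceptional set. This recovers
  the differential equation at the seam between two glued solutions.\<close>

lemma has_vector_derivative_at_continuity_point:
  fixes g :: "real \<Rightarrow> 'a::euclidean_space"
  assumes "finite S" "continuous_on {a..b} g"
    and der: "\<And>t. t \<in> {a<..<b} - S \<Longrightarrow> (g has_vector_derivative g' t) (at t)"
    and t: "t \<in> {a<..<b}" and "isCont g' t"
  shows "(g has_vector_derivative g' t) (at t)"
proof -
  have ftc: "(g' has_integral (g u - g a)) {a..u}" if "u \<in> {a..b}" for u
    using that der by (intro fundamental_theorem_of_calculus_interior_strong[OF assms(1)])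
      (auto intro: continuous_on_subset[OF assms(2)])
  have "((\<lambda>u. integral {a..u} g') has_vector_derivative g' t) (at t within {a..b} - {})"
    using t assms(5) ftc[of b]
    by (intro integral_has_vector_derivative_continuous_at)
      (auto simp: continuous_at_imp_continuous_at_within has_integral_integrable)
  then have "((\<lambda>u. g a + integral {a..u} g') has_vector_derivative g' t) (at t within {a..b})"
    by (auto intro!: derivative_eq_intros)
  then have "(g has_vector_derivative g' t) (at t within {a..b})"
    by (rule has_vector_derivative_transform[rotated 2])
      (use t integral_unique[OF ftc] in auto)
  then show ?thesis using t by (simp add: at_within_Icc_at)
qed

text \<open>Banach's fixed point theorem for the integral operator on curves with values in a ball:
  the first smallness condition keeps the ball invariant, the second gives the contraction. The
  exceptional set affects only where the fixed point is asserted to be differentiable.\<close>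

lemma picard_local_solution:
  fixes G :: "real \<Rightarrow> 'a::euclidean_space \<Rightarrow> 'a"
  assumes "a < b" "finite S" "0 \<le> L" "0 \<le> M" "0 \<le> r"
    and cont: "\<And>g t. t \<in> {a<..<b} - S \<Longrightarrow> isCont g t \<Longrightarrow> (\<And>s. g s \<in> cball p r) \<Longrightarrow> isCont (\<lambda>s. G s (g s)) t"
    and bound: "\<And>t X. t \<in> {a..b} \<Longrightarrow> X \<in> cball p r \<Longrightarrow> norm (G t X) \<le> M"
    and lip: "\<And>t X Y. t \<in> {a..b} \<Longrightarrow> X \<in> cball p r \<Longrightarrow> Y \<in> cball p r \<Longrightarrow>
                norm (G t X - G t Y) \<le> L * norm (X - Y)"
    and small: "M * (b - a) \<le> r" "L * (b - a) < 1"
  obtains Y where "continuous_on {a..b} Y" "Y a = p" "\<And>t. t \<in> {a..b} \<Longrightarrow> Y t \<in> cball p r"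
    "\<And>t. t \<in> {a<..<b} - S \<Longrightarrow> (Y has_vector_derivative G t (Y t)) (at t)"
proof -
  \<comment> \<open>The complete space used consists of bounded continuous functions on the whole
    line, so the integral is frozen outside \<open>{a..b}\<close>.\<close>
  define clamp where "clamp t = min b (max a t)" for t
  have clamp_mem: "clamp t \<in> {a..b}" for t using assms(1) by (auto simp: clamp_def)
  have clamp_id: "clamp t = t" if "t \<in> {a..b}" for t using that by (auto simp: clamp_def)
  have cont_clamp: "continuous_on A clamp" for A unfolding clamp_def by (intro continuous_intros)
  define B where "B = PiC UNIV (\<lambda>_::real. cball p r)"
  have B: "g \<in> B \<longleftrightarrow> (\<forall>s. apply_bcontfun g s \<in> cball p r)" for g
    by (auto simp: B_def mem_PiC_iff)
  define I where "I g t = integral {a..t} (\<lambda>s. G s (apply_bcontfun g s))" for g t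
  have int_ab: "(\<lambda>s. G s (apply_bcontfun g s)) integrable_on {a..b}" if "g \<in> B" for g
  proof (rule integrable_on_bounded_cont_off_finite[OF assms(2)])
    have "isCont (apply_bcontfun g) t" for t
      using continuous_on_apply_bcontfun[of UNIV g] continuous_on_eq_continuous_at[OF open_UNIV] by blast
    then show "isCont (\<lambda>s. G s (apply_bcontfun g s)) t" if "t \<in> {a<..<b} - S" for t
      using that \<open>g \<in> B\<close> by (intro cont) (auto simp: B)
  qed (use bound that in \<open>auto simp: B\<close>)
  have int: "(\<lambda>s. G s (apply_bcontfun g s)) integrable_on {a..t}" if "g \<in> B" "t \<in> {a..b}" for g t
    using that by (intro integrable_subinterval_real[OF int_ab]) auto
  have contI: "continuous_on {a..b} (I g)" if "g \<in> B" for g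
    unfolding I_def by (rule indefinite_integral_continuous_1[OF int_ab[OF that]])
  have I_bound: "norm (I g t) \<le> r" if "g \<in> B" "t \<in> {a..b}" for g t
  proof -
    have "norm (I g t) \<le> M * measure lborel (cbox a t)"
      unfolding I_def using int[OF that] bound that
      by (intro has_integral_bound[OF assms(4)]) (auto simp: B has_integral_integral[symmetric])
    also have "\<dots> \<le> M * (b - a)" using that assms by (intro mult_left_mono) auto
    finally show ?thesis using small by simp
  qed
  define P where "P g = Bcontfun (\<lambda>t. p + I g (clamp t))" for g
  have P: "apply_bcontfun (P g) = (\<lambda>t. p + I g (clamp t))" if "g \<in> B" for g
    unfolding P_def
  proof (rule Bcontfun_inverse)
    have "continuous_on UNIV (\<lambda>t. I g (clamp t))"
      by (rule continuous_on_compose2[OF contI[OF that] cont_clamp]) (use clamp_mem in auto)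
    moreover have "bounded (range (\<lambda>t. p + I g (clamp t)))"
    proof (rule boundedI)
      show "norm x \<le> norm p + r" if "x \<in> range (\<lambda>t. p + I g (clamp t))" for x
        using that I_bound[OF \<open>g \<in> B\<close> clamp_mem] by (auto intro: norm_triangle_le add_left_mono)
    qed
    ultimately show "(\<lambda>t. p + I g (clamp t)) \<in> bcontfun"
      by (auto simp: bcontfun_def intro: continuous_intros)
  qed
  have PB: "P ` B \<subseteq> B"
    using P I_bound clamp_mem by (auto simp: B mem_cball dist_norm)
  have contr: "dist (P g) (P h) \<le> L * (b - a) * dist g h" if "g \<in> B" "h \<in> B" for g h
  proof (rule dist_bound)
    fix t
    let ?D = "\<lambda>s. G s (apply_bcontfun g s) - G s (apply_bcontfun h s)"
    have "norm (I g (clamp t) - I h (clamp t)) = norm (integral {a..clamp t} ?D)"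
      unfolding I_def by (simp add: integral_diff[OF int[OF that(1) clamp_mem] int[OF that(2) clamp_mem]])
    also have "\<dots> \<le> L * dist g h * measure lborel (cbox a (clamp t))"
    proof (rule has_integral_bound)
      show "(?D has_integral integral {a..clamp t} ?D) (cbox a (clamp t))"
        using integrable_diff[OF int[OF that(1) clamp_mem] int[OF that(2) clamp_mem]]
        by (simp add: integrable_integral)
      show "norm (?D s) \<le> L * dist g h" if "s \<in> cbox a (clamp t)" for s
      proof -
        have "s \<in> {a..b}" using that clamp_mem[of t] by auto
        then have "norm (?D s) \<le> L * norm (apply_bcontfun g s - apply_bcontfun h s)"
          using \<open>g \<in> B\<close> \<open>h \<in> B\<close> by (intro lip) (auto simp: B)
        also have "\<dots> \<le> L * dist g h"
          using dist_bounded[of g s h] assms(3) by (intro mult_left_mono) (auto simp: dist_norm)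
        finally show ?thesis .
      qed
    qed (use assms in auto)
    also have "\<dots> \<le> L * dist g h * (b - a)"
      using clamp_mem[of t] assms by (intro mult_left_mono) auto
    finally show "dist (apply_bcontfun (P g) t) (apply_bcontfun (P h) t) \<le> L * (b - a) * dist g h"
      by (simp add: P that dist_norm mult_ac)
  qed
  have "complete B" unfolding B_def by (intro complete_eq_closed[THEN iffD2] closed_PiC) auto
  moreover have "const_bcontfun p \<in> B" using assms(5) by (simp add: B const_bcontfun.rep_eq)
  then have "B \<noteq> {}" by blast
  ultimately have "\<exists>!g. g \<in> B \<and> P g = g"
    using assms small PB contr by (intro Banach_fix[of B "L * (b - a)"]) auto
  then obtain g where g: "g \<in> B" "P g = g" by blast
  define Y where "Y = apply_bcontfun g"
  have Y: "Y t = p + I g t" if "t \<in> {a..b}" for t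
    using P[OF g(1)] g(2) clamp_id[OF that] unfolding Y_def by metis
  show thesis
  proof
    show "continuous_on {a..b} Y" by (simp add: Y_def)
    show "Y a = p" using Y[of a] assms(1) by (simp add: I_def)
    show "Y t \<in> cball p r" for t using g(1) by (simp add: B Y_def)
    show "(Y has_vector_derivative G t (Y t)) (at t)" if t: "t \<in> {a<..<b} - S" for t
    proof -
      have "isCont Y t"
        using continuous_on_apply_bcontfun[of UNIV g] continuous_on_eq_continuous_at[OF open_UNIV] unfolding Y_def by blast
      then have "isCont (\<lambda>s. G s (Y s)) t" using g(1) t by (intro cont) (auto simp: B Y_def)
      then have "((\<lambda>u. I g u) has_vector_derivative G t (Y t)) (at t within {a..b} - {})"
        unfolding I_def Y_def[symmetric] using t int_ab[OF g(1)]
        by (intro integral_has_vector_derivative_continuous_at)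
          (auto simp: continuous_at_imp_continuous_at_within Y_def)
      then have "((\<lambda>u. p + I g u) has_vector_derivative G t (Y t)) (at t within {a..b})"
        by (auto intro!: derivative_eq_intros)
      then have "(Y has_vector_derivative G t (Y t)) (at t within {a..b})"
        by (rule has_vector_derivative_transform[rotated 2]) (use t Y in auto)
      then show ?thesis using t by (simp add: at_within_Icc_at)
    qed
  qed
qed

section \<open>Decrease of the Lyapunov function between events\<close>

lemma sup_norm_attained:
  assumes "a \<le> t" "continuous_on {a..t} w"
  obtains \<tau> where "\<tau> \<in> {a..t}" "sup_norm w a t = \<bar>w \<tau>\<bar>"
    "\<And>r. r \<in> {a..t} \<Longrightarrow> \<bar>w r\<bar> \<le> sup_norm w a t"
proof -
  have "continuous_on {a..t} (\<lambda>r. \<bar>w r\<bar>)" using assms(2) by (intro continuous_intros)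
  then obtain \<tau> where \<tau>: "\<tau> \<in> {a..t}" "\<And>r. r \<in> {a..t} \<Longrightarrow> \<bar>w r\<bar> \<le> \<bar>w \<tau>\<bar>"
    using continuous_attains_sup[of "{a..t}" "\<lambda>r. \<bar>w r\<bar>"] assms(1) by auto
  have "sup_norm w a t = \<bar>w \<tau>\<bar>" unfolding sup_norm_def
    by (rule cSup_eq_maximum) (use \<tau> in auto)
  then show thesis using that \<tau> by simp
qed

text \<open>The maximum of \<open>U\<close> is half the squared largest error, and
  \<open>\<gamma>\<close> carries the same square, so it cancels. What remains compares the elapsed
  time with \<open>1 / (4 * m s)\<close>.\<close>

lemma event_condition_iff:
  assumes "a \<le> t" "continuous_on {a..t} w"
  shows "event_condition (\<lambda>s. s\<^sup>2 * m s) w a t \<longleftrightarrow>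
    1 \<le> 4 * (t - a) * m (sup_norm w a t) \<and> sup_norm w a t \<noteq> 0"
proof -
  let ?s = "sup_norm w a t"
  obtain \<tau> where \<tau>: "\<tau> \<in> {a..t}" "?s = \<bar>w \<tau>\<bar>" "\<And>r. r \<in> {a..t} \<Longrightarrow> \<bar>w r\<bar> \<le> ?s"
    using sup_norm_attained[OF assms] by blast
  have "(SUP \<tau>\<in>{a..t}. U (w \<tau>)) = ?s\<^sup>2 / 2"
  proof (rule cSup_eq_maximum)
    show "?s\<^sup>2 / 2 \<in> (\<lambda>\<tau>. U (w \<tau>)) ` {a..t}" using \<tau>(1,2) by (auto simp: U_def)
    show "v \<le> ?s\<^sup>2 / 2" if v: "v \<in> (\<lambda>\<tau>. U (w \<tau>)) ` {a..t}" for v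
    proof -
      obtain r where "r \<in> {a..t}" "v = (w r)\<^sup>2 / 2" using v unfolding U_def by blast
      moreover from this \<tau>(3) have "\<bar>w r\<bar>\<^sup>2 \<le> ?s\<^sup>2" by (intro power_mono) auto
      ultimately show ?thesis by simp
    qed
  qed
  then have "event_condition (\<lambda>s. s\<^sup>2 * m s) w a t \<longleftrightarrow>
      ?s\<^sup>2 / 2 * 1 \<le> ?s\<^sup>2 / 2 * (4 * (t - a) * m ?s) \<and> ?s \<noteq> 0"
    by (auto simp: event_condition_def algebra_simps)
  then show ?thesis by (cases "?s = 0") (auto simp: mult_le_cancel_left)
qed

text \<open>\<open>V\<close> stands for the rescaled storage function and \<open>\<alpha>\<close>
  for its lower bound, not for the dissipation rate. In \<open>m_ge\<close>, \<open>5 * s\<close>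
  bounds the current input, hence \<open>x\<close>, when the held input is below
  \<open>4 * s\<close> and the error at most \<open>s\<close>;
  \<open>10 * \<phi> (5 * s) + 4\<close> then bounds, per unit of \<open>s\<close>, the contribution
  of \<open>x\<close> to \<open>f\<close> plus the held input, and
  \<open>2 * (k (5 * s))\<^sup>2\<close> pays for the contribution of \<open>z\<close> after Young's
  inequality. Of the dissipated \<open>2 * x\<^sup>2\<close>, one half goes to the integrated norm
  and one half to the product of \<open>x\<close> with the error.\<close>

locale event_triggered_design =
  fixes D :: "(real ^ 'l) set"
    and q :: "real ^ 'p \<Rightarrow> real \<Rightarrow> real ^ 'l \<Rightarrow> real ^ 'p"
    and f :: "real ^ 'p \<Rightarrow> real \<Rightarrow> real ^ 'l \<Rightarrow> real"
    and V :: "real ^ 'p \<Rightarrow> real" and V' :: "real ^ 'p \<Rightarrow> real ^ 'p \<Rightarrow> real"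
    and \<alpha> \<phi> \<rho> k m :: "real \<Rightarrow> real"
  assumes compact_D: "compact D"
    and C1_q: "C1 (\<lambda>(z, x, d). q z x d)"
    and C1_f: "C1 (\<lambda>(z, x, d). f z x d)"
    and V_derivative: "\<And>z. (V has_derivative V' z) (at z)"
    and V_zero: "V 0 = 0"
    and V_lower: "\<And>z. \<alpha> (norm z) \<le> V z"
    and K_alpha: "class_K_infinity \<alpha>"
    and series: "even_series \<phi>" "even_series \<rho>" "even_series k" "even_series m"
    and k_derivative: "\<And>x. ((\<lambda>x. x * \<rho> x) has_real_derivative k x) (at x)"
    and rho_ge: "\<And>x. 1 \<le> \<rho> x"
    and m_ge: "\<And>s. 1 \<le> m s" "\<And>s. k (5 * s) * (10 * \<phi> (5 * s) + 4) \<le> m s"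
      "\<And>s. 2 * (k (5 * s))\<^sup>2 \<le> m s"
    and f_bound: "\<And>z x d. d \<in> D \<Longrightarrow> \<bar>f z x d\<bar> \<le> 2 * norm z * \<phi> (norm z) + 2 * \<bar>x\<bar> * \<phi> x"
    and dissipation: "\<And>z x d. d \<in> D \<Longrightarrow> V' z (q z x d) + x * f z x d - \<rho> x * x\<^sup>2
      \<le> - 2 * (norm z * \<phi> (norm z))\<^sup>2 - (norm z)\<^sup>2 - 2 * x\<^sup>2 - \<rho> x * x\<^sup>2 / 2"
begin

section \<open>Feedback, sampling error and the Lyapunov function\<close>

definition "\<gamma> s = s\<^sup>2 * m s"

definition "W X = V (fst X) + (snd X)\<^sup>2 / 2" for X :: "(real ^ 'p) \<times> real"

lemma continuous_on_series:
  assumes "even_series h" "continuous_on S g"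
  shows "continuous_on S (\<lambda>t. h (g t) :: real)"
proof -
  have "isCont h x" for x
    using even_series_smooth[OF assms(1)] unfolding smooth_def
    by (metis differentiable_imp_continuous_within funpow_0)
  then have "continuous_on UNIV h" by (simp add: continuous_at_imp_continuous_on)
  then show ?thesis using assms(2) by (rule continuous_on_compose2) auto
qed

lemma abs_feedback: "\<bar>feedback \<rho> x\<bar> = \<bar>x\<bar> * \<rho> x"
  using rho_ge[of x] by (simp add: feedback_def abs_mult)

lemma abs_le_feedback: "\<bar>x\<bar> \<le> \<bar>feedback \<rho> x\<bar>"
  using rho_ge[of x] by (simp add: abs_feedback mult_le_cancel_left1)

lemma abs_feedback_mono: "\<bar>x\<bar> \<le> \<bar>y\<bar> \<Longrightarrow> \<bar>feedback \<rho> x\<bar> \<le> \<bar>feedback \<rho> y\<bar>"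
  unfolding abs_feedback using even_series_mono[OF series(2)] even_series_nonneg[OF series(2)]
  by (intro mult_mono) auto

lemma continuous_on_feedback:
  "continuous_on S x \<Longrightarrow> continuous_on S (\<lambda>t. feedback \<rho> (x t))"
  unfolding feedback_def by (intro continuous_intros continuous_on_series[OF series(2)])

lemma continuous_on_error:
  "continuous_on S x \<Longrightarrow> continuous_on S (sampling_error \<rho> x a)"
  unfolding sampling_error_def by (intro continuous_intros continuous_on_feedback)

lemma event_iff:
  assumes "a \<le> t" "continuous_on {a..t} x"
  shows "event_condition \<gamma> (sampling_error \<rho> x a) a t \<longleftrightarrow>
    1 \<le> 4 * (t - a) * m (sup_norm (sampling_error \<rho> x a) a t) \<and>
    sup_norm (sampling_error \<rho> x a) a t \<noteq> 0"
  using event_condition_iff[OF assms(1) continuous_on_error[OF assms(2)]]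
  unfolding \<gamma>_def by blast

lemma sup_error_bounds:
  assumes "a \<le> t" "continuous_on {a..t} x"
  shows "0 \<le> sup_norm (sampling_error \<rho> x a) a t"
    and "r \<in> {a..t} \<Longrightarrow> \<bar>sampling_error \<rho> x a r\<bar> \<le> sup_norm (sampling_error \<rho> x a) a t"
  using sup_norm_attained[OF assms(1) continuous_on_error[OF assms(2)]] by (metis abs_ge_zero)+

definition "Z z = (norm z * \<phi> (norm z))\<^sup>2" for z :: "real ^ 'p"

text \<open>One sampling interval in isolation, with the input frozen at its value at
  \<open>a\<close> and all exceptional instants collected in \<open>E\<close>. The Lyapunov
  estimates thus involve neither a horizon nor a sequence of instants.\<close>

definition held :: "(real \<Rightarrow> real ^ 'l) \<Rightarrow> real \<Rightarrow> real \<Rightarrow> (real \<Rightarrow> (real ^ 'p) \<times> real) \<Rightarrow> bool" where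
  "held d a b X \<longleftrightarrow> continuous_on {a..b} X \<and> (\<exists>E. finite E \<and> (\<forall>t\<in>{a<..<b} - E. d t \<in> D \<and>
     ((\<lambda>t. fst (X t)) has_vector_derivative q (fst (X t)) (snd (X t)) (d t)) (at t) \<and>
     ((\<lambda>t. snd (X t)) has_real_derivative
        f (fst (X t)) (snd (X t)) (d t) + feedback \<rho> (snd (X a))) (at t)))"

lemma held_subinterval: "held d a b X \<Longrightarrow> t \<le> b \<Longrightarrow> held d a t X"
  unfolding held_def by (fastforce elim: continuous_on_subset)

lemma continuous_on_Z: "continuous_on S z \<Longrightarrow> continuous_on S (\<lambda>t. Z (z t))"
  unfolding Z_def by (intro continuous_intros continuous_on_series[OF series(1)])

lemma Z_nonneg: "0 \<le> Z z"
  by (simp add: Z_def)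

text \<open>If the error exceeds a quarter of the held input, then \<open>\<bar>feedback \<rho> x\<bar> \<le> 5 * s\<close>, and hence
  \<open>\<bar>x\<bar> \<le> 5 * s\<close>, on the whole interval. The growth of the error is then bounded by gains that depend
  on \<open>s\<close> alone, which \<open>m\<close> dominates, and by the contribution of \<open>z\<close>, which does not involve \<open>\<rho>\<close>.\<close>

lemma error_bound:
  assumes "a < b" "held d a b X"
    and s: "s = sup_norm (sampling_error \<rho> (\<lambda>t. snd (X t)) a) a b"
    and large: "\<bar>feedback \<rho> (snd (X a))\<bar> < 4 * s" and short: "4 * (b - a) * m s \<le> 1"
  shows "s\<^sup>2 \<le> integral {a..b} (\<lambda>t. Z (fst (X t)))"
proof -
  let ?z = "\<lambda>t. fst (X t)" and ?x = "\<lambda>t. snd (X t)"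
  let ?w = "sampling_error \<rho> ?x a"
  let ?J = "\<lambda>t. integral {a..t} (\<lambda>t. Z (?z t))"
  obtain E where E: "finite E" and contX: "continuous_on {a..b} X"
    and D: "\<And>t. t \<in> {a<..<b} - E \<Longrightarrow> d t \<in> D"
    and derx: "\<And>t. t \<in> {a<..<b} - E \<Longrightarrow> (?x has_real_derivative
        f (?z t) (?x t) (d t) + feedback \<rho> (?x a)) (at t)"
    using assms(2) unfolding held_def by blast
  have contx: "continuous_on {a..b} ?x" and contz: "continuous_on {a..b} ?z"
    using contX by (auto intro: continuous_intros)
  have contZ: "continuous_on {a..b} (\<lambda>t. Z (?z t))" by (rule continuous_on_Z[OF contz])
  obtain \<tau> where \<tau>: "\<tau> \<in> {a..b}" "s = \<bar>?w \<tau>\<bar>" "\<And>r. r \<in> {a..b} \<Longrightarrow> \<bar>?w r\<bar> \<le> s"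
    using sup_norm_attained[of a b ?w] assms(1) continuous_on_error[OF contx] unfolding s by auto
  have spos: "0 < s" using large by linarith
  define h where "h = b - a"
  have h: "0 < h" using assms(1) by (simp add: h_def)
  define k5 where "k5 = k (5 * s)"
  define p5 where "p5 = \<phi> (5 * s)"
  have k5: "0 \<le> k5" and p5: "0 \<le> p5" unfolding k5_def p5_def
    by (rule even_series_nonneg[OF series(3)], rule even_series_nonneg[OF series(1)])
  \<comment> \<open>\<open>s / (2 * h)\<close> and \<open>B * F\<^sup>2\<close> are the two sides of
    Young's inequality for \<open>2 * (k5 * F)\<close>. The weight makes the first one contribute at
    most \<open>s / 2\<close> over an interval of length \<open>h\<close>.\<close>
  define A where "A = k5 * (10 * p5 + 4) * s + s / (2 * h)"
  define B where "B = 2 * h * k5\<^sup>2 / s"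
  have B: "0 \<le> B" using spos h by (simp add: B_def)
  have rate: "\<bar>k (?x t) * (f (?z t) (?x t) (d t) + feedback \<rho> (?x a))\<bar> \<le> A + B * Z (?z t)"
    if t: "t \<in> {a<..<b} - E" for t
  proof -
    define F where "F = norm (?z t) * \<phi> (norm (?z t))"
    have F: "0 \<le> F" using even_series_nonneg[OF series(1)] by (simp add: F_def)
    have "\<bar>feedback \<rho> (?x t)\<bar> \<le> 5 * s"
    proof -
      have "\<bar>?w t\<bar> \<le> s" using t by (intro \<tau>(3)) auto
      then show ?thesis using large unfolding sampling_error_def by linarith
    qed
    then have x5: "\<bar>?x t\<bar> \<le> 5 * s" by (rule order_trans[OF abs_le_feedback])
    then have "k (?x t) \<le> k5" "\<phi> (?x t) \<le> p5"
      unfolding k5_def p5_def using spos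
      by (intro even_series_mono[OF series(3)] even_series_mono[OF series(1)]; linarith)+
    moreover have "0 \<le> k (?x t)" "0 \<le> \<phi> (?x t)"
      by (rule even_series_nonneg[OF series(3)], rule even_series_nonneg[OF series(1)])
    moreover have "\<bar>f (?z t) (?x t) (d t) + feedback \<rho> (?x a)\<bar> \<le> 2 * F + 2 * (5 * s) * p5 + 4 * s"
    proof -
      have "\<bar>?x t\<bar> * \<phi> (?x t) \<le> 5 * s * p5"
        using x5 \<open>\<phi> (?x t) \<le> p5\<close> \<open>0 \<le> \<phi> (?x t)\<close> by (intro mult_mono) auto
      then have "\<bar>f (?z t) (?x t) (d t)\<bar> \<le> 2 * F + 2 * (5 * s * p5)"
        using f_bound[OF D[OF t], of "?z t" "?x t"] unfolding F_def by linarith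
      then show ?thesis using large by linarith
    qed
    ultimately have "\<bar>k (?x t) * (f (?z t) (?x t) (d t) + feedback \<rho> (?x a))\<bar>
        \<le> k5 * (2 * F + 2 * (5 * s) * p5 + 4 * s)"
      unfolding abs_mult by (intro mult_mono k5) auto
    also have "\<dots> = 2 * (k5 * F) + k5 * (10 * p5 + 4) * s" by (simp add: algebra_simps)
    also have "2 * (k5 * F) \<le> s / (2 * h) + B * F\<^sup>2"
    proof -
      have "0 \<le> (s - 2 * h * k5 * F)\<^sup>2 / (2 * h * s)" using spos h by simp
      also have "\<dots> = s / (2 * h) - 2 * (k5 * F) + B * F\<^sup>2"
        using spos h by (simp add: B_def field_simps power2_eq_square)
      finally show ?thesis by simp
    qed
    finally show ?thesis by (simp add: A_def Z_def F_def)
  qed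
  have hm: "h * m s \<le> 1/4" using short unfolding h_def by argo
  \<comment> \<open>\<open>c\<close> is the sign of the error at \<open>\<tau>\<close>, where its
    modulus is largest; this avoids differentiating an absolute value.\<close>
  have grow: "c * ?w \<tau> \<le> A * (\<tau> - a) + B * ?J \<tau>" if c: "\<bar>c\<bar> = 1" for c
  proof -
    let ?g = "\<lambda>t. c * ?w t - A * (t - a) - B * ?J t"
    have "?g \<tau> \<le> ?g a"
    proof (rule nonincreasing_off_finite[where g = ?g, OF E])
      show "a \<le> \<tau>" using \<tau> by simp
      show "continuous_on {a..\<tau>} ?g"
      proof -
        have sub: "{a..\<tau>} \<subseteq> {a..b}" using \<tau>(1) by auto
        have "continuous_on {a..\<tau>} ?w"
          by (rule continuous_on_error[OF continuous_on_subset[OF contx sub]])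
        moreover have "continuous_on {a..\<tau>} ?J"
          by (rule indefinite_integral_continuous_1[OF integrable_continuous_real])
            (rule continuous_on_subset[OF contZ sub])
        ultimately show ?thesis by (intro continuous_on_diff continuous_on_mult continuous_on_const continuous_on_id)
      qed
      show "\<exists>v\<le>0. (?g has_real_derivative v) (at t)" if "t \<in> {a<..<\<tau>} - E" for t
      proof -
        have t: "t \<in> {a<..<b} - E" using that \<tau>(1) by auto
        have "((\<lambda>t. ?x t * \<rho> (?x t)) has_real_derivative k (?x t) *
            (f (?z t) (?x t) (d t) + feedback \<rho> (?x a))) (at t)"
          by (rule DERIV_chain2[OF k_derivative derx[OF t]])
        from DERIV_add[OF DERIV_const[of "feedback \<rho> (?x a)"] this]
        have w: "(?w has_real_derivative k (?x t) *
            (f (?z t) (?x t) (d t) + feedback \<rho> (?x a))) (at t)"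
          by (simp add: sampling_error_def[abs_def] feedback_def mult.commute)
        have "(?J has_real_derivative Z (?z t)) (at t within {a..b})"
          by (rule integral_has_real_derivative[OF contZ]) (use t in auto)
        then have J: "(?J has_real_derivative Z (?z t)) (at t)" using t by (simp add: at_within_Icc_at)
        let ?v = "k (?x t) * (f (?z t) (?x t) (d t) + feedback \<rho> (?x a))"
        have "((\<lambda>t. t - a) has_real_derivative 1) (at t)" by (auto intro!: derivative_eq_intros)
        then have "(?g has_real_derivative c * ?v - A * 1 - B * Z (?z t)) (at t)"
          by (intro DERIV_diff DERIV_cmult w J)
        moreover have "c * ?v \<le> \<bar>?v\<bar>" using c abs_ge_self[of "c * ?v"] by (simp add: abs_mult)
        ultimately show ?thesis using rate[OF t] by (intro exI conjI) auto
      qed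
    qed
    then show ?thesis by (simp add: sampling_error_def)
  qed
  have "s \<le> A * (\<tau> - a) + B * ?J \<tau>"
    using grow[of 1] grow[of "-1"] \<tau>(2) by (cases "0 \<le> ?w \<tau>") auto
  also have "\<dots> \<le> A * h + B * ?J b"
  proof (intro add_mono mult_left_mono B)
    show "\<tau> - a \<le> h" using \<tau> by (simp add: h_def)
    show "0 \<le> A" using k5 p5 spos h by (simp add: A_def)
    show "?J \<tau> \<le> ?J b"
      using \<tau>(1)
      by (intro integral_subset_le integrable_continuous_real continuous_on_subset[OF contZ] ballI Z_nonneg) auto
  qed
  also have "A * h = (h * (k5 * (10 * p5 + 4))) * s + s / 2"
    using h by (simp add: A_def field_simps)
  also have "\<dots> \<le> (h * m s) * s + s / 2"
    using m_ge(2)[of s] h spos by (intro add_right_mono mult_right_mono mult_left_mono) (auto simp: k5_def p5_def)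
  also have "\<dots> \<le> 1/4 * s + s / 2"
    using hm spos by (intro add_right_mono mult_right_mono) auto
  \<comment> \<open>Three quarters of \<open>s\<close> have been absorbed, so
    \<open>s \<le> 4 * (B * ?J b)\<close>. Multiplying by \<open>s\<close> cancels the denominator
    of \<open>B\<close> and leaves the gain \<open>8 * h * k5\<^sup>2\<close>, which is at most
    \<open>4 * h * m s\<close> and hence at most 1.\<close>
  finally have "s * s \<le> 4 * (B * ?J b) * s" using spos by (intro mult_right_mono) auto
  also have "\<dots> = 4 * (h * (2 * k5\<^sup>2)) * ?J b" using spos by (simp add: B_def field_simps)
  also have "\<dots> \<le> 4 * (h * m s) * ?J b"
    using m_ge(3)[of s] h by (intro mult_right_mono mult_left_mono integral_nonneg integrable_continuous_real contZ)
      (auto simp: k5_def Z_nonneg)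
  also have "\<dots> \<le> 1 * ?J b"
    using hm by (intro mult_right_mono integral_nonneg integrable_continuous_real contZ)
      (auto simp: Z_nonneg)
  finally show ?thesis by (simp add: power2_eq_square)
qed

lemma continuous_on_W:
  assumes "continuous_on S X"
  shows "continuous_on S (\<lambda>t. W (X t))"
proof -
  have "continuous_on UNIV V"
    using V_derivative by (auto intro!: continuous_at_imp_continuous_on dest: has_derivative_continuous)
  then have "continuous_on S (\<lambda>t. V (fst (X t)))"
    by (rule continuous_on_compose2) (use assms in \<open>auto intro: continuous_intros\<close>)
  then show ?thesis using assms unfolding W_def by (intro continuous_intros) auto
qed

text \<open>The error is controlled by past dissipation of \<open>z\<close>, which no pointwise
  inequality can exploit. Adding \<open>(1 - (t - a)) * ?J t\<close> to the Lyapunov function turns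
  the history into a rate: its derivative supplies \<open>- ?J t\<close> at the price of at most
  \<open>Z z\<close>. The weight stays positive because \<open>1 \<le> m s\<close> keeps intervals
  with a nonzero error shorter than 1.\<close>

lemma W_decrease:
  assumes "a \<le> b" "held d a b X"
    and no_event: "\<And>t. t \<in> {a<..b} \<Longrightarrow> \<not> event_condition \<gamma> (sampling_error \<rho> (\<lambda>t. snd (X t)) a) a t"
  shows "W (X b) + integral {a..b} (\<lambda>t. (norm (X t))\<^sup>2) \<le> W (X a)"
proof (cases "a = b")
  case False
  with assms(1) have ab: "a < b" by simp
  let ?z = "\<lambda>t. fst (X t)" and ?x = "\<lambda>t. snd (X t)"
  let ?w = "sampling_error \<rho> ?x a"
  let ?J = "\<lambda>t. integral {a..t} (\<lambda>t. Z (?z t))"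
  let ?N = "\<lambda>t. integral {a..t} (\<lambda>t. (norm (X t))\<^sup>2)"
  let ?s = "\<lambda>t. sup_norm ?w a t"
  obtain E where E: "finite E" and contX: "continuous_on {a..b} X"
    and D: "\<And>t. t \<in> {a<..<b} - E \<Longrightarrow> d t \<in> D"
    and derz: "\<And>t. t \<in> {a<..<b} - E \<Longrightarrow> (?z has_vector_derivative q (?z t) (?x t) (d t)) (at t)"
    and derx: "\<And>t. t \<in> {a<..<b} - E \<Longrightarrow> (?x has_real_derivative
        f (?z t) (?x t) (d t) + feedback \<rho> (?x a)) (at t)"
    using assms(2) unfolding held_def by blast
  have contx: "continuous_on {a..b} ?x" and contz: "continuous_on {a..b} ?z"
    using contX by (auto intro: continuous_intros)
  have contZ: "continuous_on {a..b} (\<lambda>t. Z (?z t))" by (rule continuous_on_Z[OF contz])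
  have contN: "continuous_on {a..b} (\<lambda>t. (norm (X t))\<^sup>2)" using contX by (intro continuous_intros)
  have contx': "continuous_on {a..t} ?x" if "t \<in> {a..b}" for t
    using that by (intro continuous_on_subset[OF contx]) auto
  have contW: "continuous_on {a..b} (\<lambda>t. W (X t))" by (rule continuous_on_W[OF contX])
  have derJ: "(?J has_real_derivative Z (?z t)) (at t)"
    and derN: "(?N has_real_derivative (norm (?z t))\<^sup>2 + (?x t)\<^sup>2) (at t)" if "t \<in> {a<..<b}" for t
    using integral_has_real_derivative[OF contZ, of t] integral_has_real_derivative[OF contN, of t] that
    by (auto simp: at_within_Icc_at norm_prod_def)
  have Jpos: "0 \<le> ?J t" if "t \<in> {a..b}" for t
    using that by (intro integral_nonneg integrable_continuous_real continuous_on_subset[OF contZ])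
      (auto simp: Z_nonneg)
  let ?W' = "\<lambda>t. V' (?z t) (q (?z t) (?x t) (d t)) + ?x t * (f (?z t) (?x t) (d t) + feedback \<rho> (?x a))"
  have derW: "((\<lambda>t. W (X t)) has_real_derivative ?W' t) (at t)" if t: "t \<in> {a<..<b} - E" for t
  proof -
    have "(V has_derivative V' (?z t)) (at (?z t) within range ?z)"
      by (rule has_derivative_at_withinI[OF V_derivative])
    from vector_derivative_diff_chain_within[OF derz[OF t] this]
    have "((\<lambda>t. V (?z t)) has_real_derivative V' (?z t) (q (?z t) (?x t) (d t))) (at t)"
      by (simp add: o_def has_real_derivative_iff_has_vector_derivative)
    then show ?thesis unfolding W_def
      by (auto intro!: derivative_eq_intros derx[OF t] simp: field_simps)
  qed
  have rate: "?W' t + 2 * Z (?z t) + (norm (?z t))\<^sup>2 + 2 * (?x t)\<^sup>2 + \<rho> (?x t) * (?x t)\<^sup>2 / 2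
      \<le> ?x t * ?w t" if t: "t \<in> {a<..<b} - E" for t
  proof -
    have "?x t * feedback \<rho> (?x a) = ?x t * ?w t - \<rho> (?x t) * (?x t)\<^sup>2"
      by (simp add: sampling_error_def feedback_def algebra_simps power2_eq_square)
    then show ?thesis
      using dissipation[OF D[OF t], of "?z t" "?x t"] by (simp add: Z_def distrib_left)
  qed
  have rho_pos: "0 \<le> \<rho> x * x\<^sup>2" for x using rho_ge[of x] by simp
  show ?thesis
  proof (cases "?s b = 0")
    \<comment> \<open>A vanishing error never triggers, so the interval may be arbitrarily long and
      the weight above could become negative. The input then equals the unsampled feedback and no
      correction is required.\<close>
    case True
    then have w0: "?w t = 0" if "t \<in> {a..b}" for t
      using sup_error_bounds(2)[OF assms(1) contx that] by simp
    have "W (X b) + ?N b \<le> W (X a) + ?N a"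
    proof (rule nonincreasing_off_finite[where g = "\<lambda>t. W (X t) + ?N t", OF E assms(1)])
      show "continuous_on {a..b} (\<lambda>t. W (X t) + ?N t)"
        by (intro continuous_on_add contW indefinite_integral_continuous_1 integrable_continuous_real contN)
      show "\<exists>v\<le>0. ((\<lambda>t. W (X t) + ?N t) has_real_derivative v) (at t)" if t: "t \<in> {a<..<b} - E" for t
      proof (intro exI conjI)
        show "((\<lambda>t. W (X t) + ?N t) has_real_derivative ?W' t + ((norm (?z t))\<^sup>2 + (?x t)\<^sup>2)) (at t)"
          using t by (intro DERIV_add derW derN) auto
        have "0 \<le> Z (?z t)" by (rule Z_nonneg)
        moreover have "?x t * ?w t = 0" using w0[of t] t by simp
        ultimately show "?W' t + ((norm (?z t))\<^sup>2 + (?x t)\<^sup>2) \<le> 0"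
          using rate[OF t] rho_pos[of "?x t"] zero_le_power2[of "?x t"] by linarith
      qed
    qed
    then show ?thesis by simp
  next
    case False
    have ev: "4 * (t - a) * m (?s t) < 1" if "t \<in> {a<..b}" "?s t \<noteq> 0" for t
      using no_event[OF that(1)] event_iff[of a t ?x] contx'[of t] that by auto
    have "4 * (b - a) * 1 \<le> 4 * (b - a) * m (?s b)" using ab m_ge(1) by (intro mult_left_mono) auto
    also have "\<dots> < 1" using ab False by (intro ev) auto
    finally have short: "b - a < 1" using ab by simp
    \<comment> \<open>The spare dissipation \<open>2 * Z z\<close> pays for the square of the error, which is at most \<open>?J t\<close>.\<close>
    let ?g = "\<lambda>t. W (X t) + ?N t + (1 - (t - a)) * ?J t"
    have "?g b \<le> ?g a"
    proof (rule nonincreasing_off_finite[where g = ?g, OF E assms(1)])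
      show "continuous_on {a..b} ?g"
        by (intro continuous_on_add continuous_on_mult continuous_on_diff continuous_on_const continuous_on_id
            contW indefinite_integral_continuous_1 integrable_continuous_real contN contZ)
      show "\<exists>v\<le>0. (?g has_real_derivative v) (at t)" if t: "t \<in> {a<..<b} - E" for t
      proof (intro exI conjI)
        let ?v = "?W' t + ((norm (?z t))\<^sup>2 + (?x t)\<^sup>2) + ((1 - (t - a)) * Z (?z t) + - 1 * ?J t)"
        have t': "t \<in> {a<..<b}" "t \<in> {a..b}" using t by auto
        have "((\<lambda>t. 1 - (t - a)) has_real_derivative - 1) (at t)" by (auto intro!: derivative_eq_intros)
        from DERIV_add[OF DERIV_add[OF derW[OF t] derN[OF t'(1)]] DERIV_mult'[OF this derJ[OF t'(1)]]]
        show "(?g has_real_derivative ?v) (at t)" .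
        have wt: "\<bar>?w t\<bar> \<le> ?s t" using sup_error_bounds(2)[OF _ contx'[OF t'(2)], of t] t by auto
        \<comment> \<open>The threshold 4 leaves
          \<open>3 * \<bar>?w t\<bar> \<le> \<bar>?x t\<bar> * \<rho> (?x t)\<close> in the first
          case, so the product is at most a third of \<open>\<rho> (?x t) * (?x t)\<^sup>2\<close>,
          while half of it is available.\<close>
        have "?x t * ?w t \<le> (?x t)\<^sup>2 + \<rho> (?x t) * (?x t)\<^sup>2 / 2 + ?J t"
        proof (cases "4 * ?s t \<le> \<bar>feedback \<rho> (?x a)\<bar>")
          case True
          moreover have "\<bar>feedback \<rho> (?x a)\<bar> \<le> \<bar>feedback \<rho> (?x t)\<bar> + \<bar>?w t\<bar>"
            unfolding sampling_error_def by linarith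
          ultimately have "3 * \<bar>?w t\<bar> \<le> \<bar>?x t\<bar> * \<rho> (?x t)"
            using wt unfolding abs_feedback[symmetric] by linarith
          then have "\<bar>?x t\<bar> * (3 * \<bar>?w t\<bar>) \<le> \<bar>?x t\<bar> * (\<bar>?x t\<bar> * \<rho> (?x t))"
            by (intro mult_left_mono) auto
          also have "\<dots> = (\<bar>?x t\<bar> * \<bar>?x t\<bar>) * \<rho> (?x t)" by (simp only: mult.assoc)
          also have "\<dots> = \<rho> (?x t) * (?x t)\<^sup>2"
            by (simp only: abs_mult_self_eq power2_eq_square mult.commute)
          also have "\<bar>?x t\<bar> * (3 * \<bar>?w t\<bar>) = 3 * \<bar>?x t * ?w t\<bar>" by (simp add: abs_mult)
          finally have "3 * \<bar>?x t * ?w t\<bar> \<le> \<rho> (?x t) * (?x t)\<^sup>2" .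
          then show ?thesis using abs_ge_self[of "?x t * ?w t"] rho_pos[of "?x t"] Jpos[OF t'(2)]
            zero_le_power2[of "?x t"] by linarith
        next
          case large: False
          have "?s t \<noteq> 0" using large by auto
          then have "(?s t)\<^sup>2 \<le> ?J t"
            using large t ev[of t] by (intro error_bound[OF _ held_subinterval[OF assms(2)] refl]) auto
          moreover have "\<bar>?w t\<bar>\<^sup>2 \<le> (?s t)\<^sup>2" using wt by (intro power_mono) auto
          ultimately have "(?w t)\<^sup>2 \<le> ?J t" by simp
          moreover have "2 * (?x t * ?w t) \<le> (?x t)\<^sup>2 + (?w t)\<^sup>2"
            using sum_squares_bound[of "?x t" "?w t"] by simp
          ultimately show ?thesis
            using rho_pos[of "?x t"] zero_le_power2[of "?x t"] Jpos[OF t'(2)] by linarith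
        qed
        moreover have "(1 - (t - a)) * Z (?z t) \<le> 1 * Z (?z t)" "0 \<le> Z (?z t)"
          using t by (intro mult_right_mono Z_nonneg; simp)+
        ultimately show "?v \<le> 0" using rate[OF t] by linarith
      qed
    qed
    moreover have "0 \<le> (1 - (b - a)) * ?J b" using short Jpos[of b] ab by simp
    ultimately show ?thesis by simp
  qed
qed simp

end

section \<open>Trajectories\<close>

lemma C1_isCont: "C1 g \<Longrightarrow> isCont g w"
  unfolding C1_def by (meson has_derivative_continuous)

lemma C1_continuous_on: "C1 g \<Longrightarrow> continuous_on S g"
  using C1_isCont by (blast intro: continuous_at_imp_continuous_on)

text \<open>Compactness of \<open>D\<close> makes the constant independent of the uncertainty. The
  mean value inequality is applied on a ball of states with \<open>d\<close> fixed, since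
  \<open>D\<close> is not assumed convex.\<close>

lemma C1_uniform_bounds:
  fixes g :: "'a::euclidean_space \<times> real \<times> 'b::euclidean_space \<Rightarrow> 'c::real_normed_vector"
  assumes "C1 g" "compact D"
  obtains B where "0 \<le> B"
    "\<And>X d. d \<in> D \<Longrightarrow> norm X \<le> R \<Longrightarrow> norm (g (fst X, snd X, d)) \<le> B"
    "\<And>X Y d. d \<in> D \<Longrightarrow> norm X \<le> R \<Longrightarrow> norm Y \<le> R \<Longrightarrow>
       norm (g (fst X, snd X, d) - g (fst Y, snd Y, d)) \<le> B * norm (X - Y)"
proof -
  obtain g' where g': "continuous_on UNIV g'"
    "\<And>w. (g has_derivative blinfun_apply (g' w)) (at w)"
    using assms(1) unfolding C1_def by blast
  define K where "K = (\<lambda>(X, d). (fst X, snd X, d)) ` (cball (0 :: 'a \<times> real) R \<times> D)"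
  have "compact K" unfolding K_def split_def
    by (intro compact_continuous_image continuous_intros compact_Times compact_cball assms)
  then have "bounded (g ` K)" "bounded (g' ` K)"
    by (auto intro!: compact_imp_bounded compact_continuous_image C1_continuous_on[OF assms(1)]
        continuous_on_subset[OF g'(1)])
  then obtain B1 B2 where B1: "\<And>w. w \<in> K \<Longrightarrow> norm (g w) \<le> B1" and B2: "\<And>w. w \<in> K \<Longrightarrow> norm (g' w) \<le> B2"
    unfolding bounded_iff by blast
  define B where "B = max 0 (max B1 B2)"
  have K: "(fst X, snd X, d) \<in> K" if "d \<in> D" "norm X \<le> R" for X d
    using that by (force simp: K_def image_iff)
  show thesis
  proof
    show "0 \<le> B" by (simp add: B_def)
    show "norm (g (fst X, snd X, d)) \<le> B" if "d \<in> D" "norm X \<le> R" for X d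
      using B1[OF K[OF that]] by (simp add: B_def)
    show "norm (g (fst X, snd X, d) - g (fst Y, snd Y, d)) \<le> B * norm (X - Y)"
      if "d \<in> D" "norm X \<le> R" "norm Y \<le> R" for X Y d
    proof (rule differentiable_bound[where S = "cball 0 R" and f = "\<lambda>X. g (fst X, snd X, d)"])
      let ?A = "\<lambda>v::'a \<times> real. (fst v, snd v, 0::'b)"
      fix x :: "'a \<times> real" assume x: "x \<in> cball 0 R"
      have "((\<lambda>X. (fst X, snd X, d)) has_derivative ?A) (at x within cball 0 R)"
        by (auto intro!: derivative_eq_intros)
      from has_derivative_compose[OF this g'(2)]
      show "((\<lambda>X. g (fst X, snd X, d)) has_derivative (\<lambda>v. g' (fst x, snd x, d) (?A v))) (at x within cball 0 R)" .
      show "onorm (\<lambda>v. g' (fst x, snd x, d) (?A v)) \<le> B"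
      proof (rule onorm_le)
        fix v :: "'a \<times> real"
        have "norm (g' (fst x, snd x, d) (?A v)) \<le> norm (g' (fst x, snd x, d)) * norm (?A v)"
          by (rule norm_blinfun)
        also have "norm (?A v) = norm v" by (simp add: norm_prod_def)
        also have "norm (g' (fst x, snd x, d)) \<le> B"
          using B2[OF K[OF that(1), of x]] x by (simp add: B_def)
        finally show "norm (g' (fst x, snd x, d) (?A v)) \<le> B * norm v" by (simp add: mult_right_mono)
      qed
    qed (use that in auto)
  qed
qed

lemma class_K_infinity_mono: "class_K_infinity a \<Longrightarrow> 0 \<le> r \<Longrightarrow> r \<le> s \<Longrightarrow> a r \<le> a s"
  unfolding class_K_infinity_def by (intro strict_mono_on_leD[of "{0..}" a]) auto

lemma class_K_infinity_nonneg: "class_K_infinity a \<Longrightarrow> 0 \<le> r \<Longrightarrow> 0 \<le> a r"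
  using class_K_infinity_mono[of a 0 r] by (simp add: class_K_infinity_def)

lemma class_K_infinity_pos: "class_K_infinity a \<Longrightarrow> 0 < r \<Longrightarrow> 0 < a r"
  unfolding class_K_infinity_def strict_mono_on_def by (metis atLeast_iff less_imp_le order_refl)

lemma class_K_infinity_proper:
  assumes "class_K_infinity a"
  obtains R where "0 \<le> R" "\<And>r. a r \<le> N \<Longrightarrow> r \<le> R"
proof -
  have "eventually (\<lambda>r. N < a r) at_top"
    using assms unfolding class_K_infinity_def filterlim_at_top_dense by blast
  then obtain R where R: "\<And>r. R \<le> r \<Longrightarrow> N < a r" unfolding eventually_at_top_linorder by blast
  show thesis
  proof
    show "r \<le> max 0 R" if "a r \<le> N" for r using R[of r] that by (cases "R \<le> r") auto
  qed simp
qed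

lemma ereal_le_less_trans: "r \<le> t \<Longrightarrow> ereal t < T \<Longrightarrow> ereal r < T"
  by (meson ereal_less_eq(3) le_less_trans)

text \<open>The signal is fixed only after \<open>\<rho>\<close> and \<open>m\<close>, so one design
  serves every uncertainty signal.\<close>

locale uncertain_design = event_triggered_design D q f V V' \<alpha> \<phi> \<rho> k m
  for D :: "(real ^ 'l) set"
    and q :: "real ^ 'p \<Rightarrow> real \<Rightarrow> real ^ 'l \<Rightarrow> real ^ 'p"
    and f V V' \<alpha> \<phi> \<rho> k m +
  fixes d :: "real \<Rightarrow> real ^ 'l"
  assumes d: "uncertainty D d"
begin

abbreviation "traj \<equiv> closed_loop_trajectory q f \<rho> \<gamma> d"

abbreviation event :: "(real \<Rightarrow> (real ^ 'p) \<times> real) \<Rightarrow> real \<Rightarrow> real \<Rightarrow> bool" where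
  "event X a t \<equiv> event_condition \<gamma> (sampling_error \<rho> (\<lambda>t. snd (X t)) a) a t"

definition "field u t X = (q (fst X) (snd X) (d t), f (fst X) (snd X) (d t) + u)"

definition jumps :: "real \<Rightarrow> real set" where "jumps b = {t \<in> {0..b}. \<not> isCont d t}"

lemma finite_jumps: "finite (jumps b)"
  using d by (simp add: uncertainty_def jumps_def)

lemma d_mem: "0 \<le> t \<Longrightarrow> d t \<in> D"
  using d by (simp add: uncertainty_def)

lemma has_field_derivative_iff_components:
  "(X has_vector_derivative field u t (X t)) (at t) \<longleftrightarrow>
     ((\<lambda>t. fst (X t)) has_vector_derivative q (fst (X t)) (snd (X t)) (d t)) (at t) \<and>
     ((\<lambda>t. snd (X t)) has_real_derivative f (fst (X t)) (snd (X t)) (d t) + u) (at t)"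
proof (intro iffI conjI)
  assume X: "(X has_vector_derivative field u t (X t)) (at t)"
  show "((\<lambda>t. fst (X t)) has_vector_derivative q (fst (X t)) (snd (X t)) (d t)) (at t)"
    using bounded_linear.has_vector_derivative[OF bounded_linear_fst X] by (simp add: field_def)
  show "((\<lambda>t. snd (X t)) has_real_derivative f (fst (X t)) (snd (X t)) (d t) + u) (at t)"
    using bounded_linear.has_vector_derivative[OF bounded_linear_snd X]
    by (simp add: field_def has_real_derivative_iff_has_vector_derivative)
next
  assume "((\<lambda>t. fst (X t)) has_vector_derivative q (fst (X t)) (snd (X t)) (d t)) (at t) \<and>
     ((\<lambda>t. snd (X t)) has_real_derivative f (fst (X t)) (snd (X t)) (d t) + u) (at t)"
  then have "((\<lambda>t. (fst (X t), snd (X t))) has_vector_derivative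
      (q (fst (X t)) (snd (X t)) (d t), f (fst (X t)) (snd (X t)) (d t) + u)) (at t)"
    by (intro has_vector_derivative_Pair) (auto simp: has_real_derivative_iff_has_vector_derivative)
  then show "(X has_vector_derivative field u t (X t)) (at t)" by (simp add: field_def)
qed

lemma traj_iff:
  "traj T ts X \<longleftrightarrow> 0 < T \<and> continuous_on {t. 0 \<le> t \<and> ereal t < T} X \<and> ts 0 = 0 \<and>
    (\<forall>k. ts (Suc k) = Inf (ereal ` {t. ts k < ereal t \<and> ereal t < T \<and> event X (real_of_ereal (ts k)) t})) \<and>
    (\<forall>t. 0 \<le> t \<and> ereal t < T \<longrightarrow> (\<exists>k. ts k \<le> ereal t \<and> ereal t < ts (Suc k))) \<and>
    (\<forall>k t. ts k < ereal t \<and> ereal t < ts (Suc k) \<and> ereal t < T \<and> isCont d t \<longrightarrow>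
      (X has_vector_derivative field (feedback \<rho> (snd (X (real_of_ereal (ts k))))) t (X t)) (at t))"
  unfolding has_field_derivative_iff_components by (simp add: closed_loop_trajectory_def Let_def)

section \<open>Dwell time and boundedness\<close>

definition "bound R = \<bar>R\<bar> * \<rho> R" for R

lemma feedback_le_bound: "norm X \<le> R \<Longrightarrow> \<bar>feedback \<rho> (snd X)\<bar> \<le> bound R"
  using abs_feedback_mono[of "snd X" R] norm_snd_le[of "snd X" "fst X"]
  unfolding bound_def abs_feedback by auto

text \<open>On the ball of radius \<open>R\<close> the error, a difference of two inputs, is at most
  \<open>2 * bound R\<close>, and an event at \<open>t\<close> needs
  \<open>1 \<le> 4 * (t - a) * m s\<close>.\<close>

definition "dwell R = 1 / (4 * m (2 * bound R))" for R

lemma dwell_pos: "0 < dwell R"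
  using m_ge(1)[of "2 * bound R"] by (simp add: dwell_def)

lemma no_event_before_dwell:
  assumes "continuous_on {a..t} X" "a \<le> t" "t < a + dwell R" "\<And>r. r \<in> {a..t} \<Longrightarrow> norm (X r) \<le> R"
  shows "\<not> event X a t"
proof
  let ?x = "\<lambda>t. snd (X t)"
  let ?s = "sup_norm (sampling_error \<rho> ?x a) a t"
  assume "event X a t"
  moreover have x: "continuous_on {a..t} ?x" using assms(1) by (intro continuous_intros)
  ultimately have ev: "1 \<le> 4 * (t - a) * m ?s" using event_iff[OF assms(2)] by blast
  obtain \<tau> where "\<tau> \<in> {a..t}" "?s = \<bar>sampling_error \<rho> ?x a \<tau>\<bar>"
    using sup_norm_attained[OF assms(2) continuous_on_error[OF x]] by metis
  then have s: "0 \<le> ?s" "?s \<le> 2 * bound R"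
    using feedback_le_bound[OF assms(4), of a] feedback_le_bound[OF assms(4), of \<tau>] assms(2)
    by (auto simp: sampling_error_def)
  then have "m ?s \<le> m (2 * bound R)" by (intro even_series_mono[OF series(4)]) auto
  then have "4 * (t - a) * m ?s \<le> 4 * (t - a) * m (2 * bound R)"
    using assms(2) by (intro mult_left_mono) auto
  also have "\<dots> < 1"
    using assms(3) m_ge(1)[of "2 * bound R"] unfolding dwell_def by (simp add: field_simps)
  finally show False using ev by simp
qed

lemma W_ge: "\<alpha> (norm (fst X)) \<le> W X" "(snd X)\<^sup>2 / 2 \<le> W X" "0 \<le> W X"
proof -
  have "0 \<le> \<alpha> (norm (fst X))" "\<alpha> (norm (fst X)) \<le> V (fst X)" by (auto simp: class_K_infinity_nonneg[OF K_alpha] V_lower)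
  then show "\<alpha> (norm (fst X)) \<le> W X" "(snd X)\<^sup>2 / 2 \<le> W X" "0 \<le> W X" by (auto simp: W_def intro: add_increasing2)
qed

lemma W_proper:
  obtains R where "\<And>X. W X \<le> w \<Longrightarrow> norm X \<le> R"
proof -
  obtain r where r: "0 \<le> r" "\<And>s. \<alpha> s \<le> w \<Longrightarrow> s \<le> r" by (rule class_K_infinity_proper[OF K_alpha]) (rule that)
  have "norm X \<le> r + (1 + 2 * w)" if "W X \<le> w" for X
  proof -
    have "norm (fst X) \<le> r" using W_ge(1)[of X] that by (intro r(2)) simp
    moreover have "2 * \<bar>snd X\<bar> \<le> 1 + (snd X)\<^sup>2"
      using zero_le_power2[of "\<bar>snd X\<bar> - 1"] by (simp add: power2_diff)
    ultimately show ?thesis using norm_Pair_le[of "fst X" "snd X"] W_ge(2)[of X] W_ge(3)[of X] that by simp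
  qed
  then show thesis using that by blast
qed

lemma traj_facts:
  assumes "traj T ts X"
  shows "ts 0 = 0" "0 < T" "continuous_on {t. 0 \<le> t \<and> ereal t < T} X"
    and traj_covered: "\<And>t. 0 \<le> t \<Longrightarrow> ereal t < T \<Longrightarrow> \<exists>k. ts k \<le> ereal t \<and> ereal t < ts (Suc k)"
    and traj_mono: "\<And>k. ts k \<le> ts (Suc k)"
    and traj_no_event: "\<And>k a t. ts k = ereal a \<Longrightarrow> a < t \<Longrightarrow> ereal t < ts (Suc k) \<Longrightarrow> ereal t < T \<Longrightarrow> \<not> event X a t"
    and traj_ode: "\<And>k a t. ts k = ereal a \<Longrightarrow> a < t \<Longrightarrow> ereal t < ts (Suc k) \<Longrightarrow> ereal t < T \<Longrightarrow> isCont d t \<Longrightarrow>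
      (X has_vector_derivative field (feedback \<rho> (snd (X a))) t (X t)) (at t)"
proof -
  note T = assms[unfolded traj_iff]
  show "ts 0 = 0" "0 < T" "continuous_on {t. 0 \<le> t \<and> ereal t < T} X" using T by auto
  show "\<exists>k. ts k \<le> ereal t \<and> ereal t < ts (Suc k)" if "0 \<le> t" "ereal t < T" for t using T that by blast
  have Suc: "ts (Suc k) = Inf (ereal ` {t. ts k < ereal t \<and> ereal t < T \<and> event X (real_of_ereal (ts k)) t})" for k
    using T by blast
  show "ts k \<le> ts (Suc k)" for k unfolding Suc by (rule Inf_greatest) auto
  show "\<not> event X a t" if "ts k = ereal a" "a < t" "ereal t < ts (Suc k)" "ereal t < T" for k a t
  proof
    assume "event X a t"
    then have "ts (Suc k) \<le> ereal t" unfolding Suc using that by (intro Inf_lower) auto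
    then show False using that(3) by simp
  qed
  show "(X has_vector_derivative field (feedback \<rho> (snd (X a))) t (X t)) (at t)"
    if "ts k = ereal a" "a < t" "ereal t < ts (Suc k)" "ereal t < T" "isCont d t" for k a t
  proof -
    have "ts k < ereal t" "real_of_ereal (ts k) = a" using that by auto
    then show ?thesis using T that(3-5) by blast
  qed
qed

lemma traj_continuous_on:
  assumes "traj T ts X" "0 \<le> a" "ereal b < T"
  shows "continuous_on {a..b} X"
proof (rule continuous_on_subset[OF traj_facts(3)[OF assms(1)]])
  show "{a..b} \<subseteq> {t. 0 \<le> t \<and> ereal t < T}"
    using assms(2) ereal_le_less_trans[OF _ assms(3)] by auto
qed

lemma traj_mono_le: "traj T ts X \<Longrightarrow> i \<le> j \<Longrightarrow> ts i \<le> ts j"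
  by (rule lift_Suc_mono_le[of ts]) (rule traj_mono)

lemma traj_nonneg: "traj T ts X \<Longrightarrow> 0 \<le> ts i"
  using traj_mono_le[of T ts X 0 i] traj_facts(1)[of T ts X] by simp

lemma traj_instant_less:
  assumes "traj T ts X" "ts i \<noteq> \<infinity>"
  shows "ts i < T"
proof (cases i)
  case 0
  then show ?thesis using traj_facts(1,2)[OF assms(1)] by simp
next
  case (Suc j)
  let ?S = "{t. ts j < ereal t \<and> ereal t < T \<and> event X (real_of_ereal (ts j)) t}"
  have ts: "ts i = Inf (ereal ` ?S)" using assms(1) Suc unfolding traj_iff by blast
  have "?S \<noteq> {}"
  proof
    assume "?S = {}"
    then have "ts i = Inf {}" unfolding ts by (simp only: image_empty)
    then show False using assms(2) by (simp add: top_ereal_def)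
  qed
  then obtain t where t: "t \<in> ?S" by blast
  then have "ts i \<le> ereal t" unfolding ts by (intro Inf_lower) auto
  also have "ereal t < T" using t by simp
  finally show ?thesis .
qed

lemma traj_instant_real:
  assumes "traj T ts X" "ts i \<noteq> \<infinity>"
  obtains a where "ts i = ereal a" "0 \<le> a" "ereal a < T"
  using traj_nonneg[OF assms(1), of i] traj_instant_less[OF assms] assms(2) by (cases "ts i") auto

lemma traj_held:
  assumes "traj T ts X" "ts i = ereal a" "ereal b \<le> ts (Suc i)" "ereal b < T"
  shows "held d a b X"
proof -
  have a: "0 \<le> a" using traj_nonneg[OF assms(1), of i] assms(2) by simp
  have "continuous_on {a..b} X"
    by (rule traj_continuous_on[OF assms(1) a assms(4)])
  moreover have "(X has_vector_derivative field (feedback \<rho> (snd (X a))) t (X t)) (at t) \<and> d t \<in> D"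
    if "t \<in> {a<..<b} - jumps b" for t
  proof (intro conjI traj_ode[OF assms(1,2)])
    have "ereal t < ereal b" using that by simp
    then show "ereal t < ts (Suc i)" "ereal t < T" using assms(3,4) by (metis less_le_trans, metis less_trans)
    show "a < t" "isCont d t" "d t \<in> D" using that a by (auto simp: jumps_def d_mem)
  qed
  ultimately show ?thesis
    unfolding held_def has_field_derivative_iff_components
    by (intro conjI exI[of _ "jumps b"] finite_jumps ballI) auto
qed

text \<open>The decrease is chained by induction over the index of the sampling interval containing
  \<open>t\<close>. Such an index exists by definition even if the instants accumulate at
  \<open>T\<close>, so the resulting bound may be used to exclude accumulation.\<close>

lemma traj_W_decrease:
  assumes tr: "traj T ts X" and "0 \<le> t" "ereal t < T"
  shows "W (X t) + integral {0..t} (\<lambda>t. (norm (X t))\<^sup>2) \<le> W (X 0)"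
proof -
  define L where "L t = W (X t) + integral {0..t} (\<lambda>t. (norm (X t))\<^sup>2)" for t
  note cont = traj_continuous_on[OF tr]
  have contN: "continuous_on {a..t} (\<lambda>t. (norm (X t))\<^sup>2)" if "0 \<le> a" "ereal t < T" for a t
    using cont[OF that] by (intro continuous_intros)
  have step: "L t \<le> L a" if "ts i = ereal a" "a \<le> t" "ereal t < ts (Suc i)" "ereal t < T" for i a t
  proof -
    have a: "0 \<le> a" using traj_nonneg[OF tr, of i] that(1) by simp
    have "W (X t) + integral {a..t} (\<lambda>t. (norm (X t))\<^sup>2) \<le> W (X a)"
    proof (rule W_decrease[OF that(2)])
      show "held d a t X" by (rule traj_held[OF tr that(1)]) (use that in auto)
      fix r assume r: "r \<in> {a<..t}"
      then show "\<not> event X a r" using that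
        by (intro traj_no_event[OF tr that(1)] ereal_le_less_trans[of r t]) auto
    qed
    moreover have "integral {0..a} (\<lambda>t. (norm (X t))\<^sup>2) + integral {a..t} (\<lambda>t. (norm (X t))\<^sup>2)
        = integral {0..t} (\<lambda>t. (norm (X t))\<^sup>2)"
      using a that by (intro Henstock_Kurzweil_Integration.integral_combine integrable_continuous_real contN) auto
    ultimately show ?thesis by (simp add: L_def)
  qed
  have inst: "L a \<le> L 0" if "ts i = ereal a" for i a
    using that
  proof (induction i arbitrary: a)
    case 0
    then show ?case using traj_facts(1)[OF tr] by (simp add: zero_ereal_def)
  next
    case (Suc i b)
    have "ts i \<noteq> \<infinity>" using traj_mono[OF tr, of i] Suc.prems by auto
    then obtain a where a: "ts i = ereal a" "0 \<le> a" "ereal a < T" by (rule traj_instant_real[OF tr])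
    have b: "ereal b < T" using traj_instant_less[OF tr, of "Suc i"] Suc.prems by simp
    have ab: "a \<le> b" using traj_mono[OF tr, of i] Suc.prems a by simp
    \<comment> \<open>At \<open>b\<close> the event condition may hold, so \<open>step\<close>
      covers only times before \<open>b\<close>; the inequality passes to \<open>b\<close> by
      continuity of \<open>L\<close>.\<close>
    have "L b \<le> L a"
    proof (cases "a = b")
      case False
      have "continuous_on {0..b} L" unfolding L_def
        by (intro continuous_on_add continuous_on_W cont indefinite_integral_continuous_1
            integrable_continuous_real contN b order_refl)
      moreover have "closure {a<..<b} \<subseteq> {0..b}" using False ab a(2) by (simp add: closure_greaterThanLessThan)
      ultimately have c: "continuous_on (closure {a<..<b}) L" by (rule continuous_on_subset)
      show ?thesis
      proof (rule continuous_le_on_closure[OF c])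
        show "b \<in> closure {a<..<b}" using False ab by (simp add: closure_greaterThanLessThan)
        fix r assume r: "r \<in> {a<..<b}"
        then have "ereal r < T" by (intro ereal_le_less_trans[OF _ b]) simp
        then show "L r \<le> L a" using r Suc.prems by (intro step[OF a(1)]) simp_all
      qed
    qed simp
    then show ?case using Suc.IH[OF a(1)] by simp
  qed
  obtain i where i: "ts i \<le> ereal t" "ereal t < ts (Suc i)" using traj_covered[OF tr assms(2,3)] by blast
  then have "ts i \<noteq> \<infinity>" by auto
  then obtain a where a: "ts i = ereal a" "0 \<le> a" "ereal a < T" by (rule traj_instant_real[OF tr])
  have "L t \<le> L a" using i a assms by (intro step[OF a(1)]) auto
  also have "\<dots> \<le> L 0" by (rule inst[OF a(1)])
  finally show ?thesis by (simp add: L_def)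
qed

lemma traj_W_le:
  assumes "traj T ts X" "0 \<le> t" "ereal t < T"
  shows "W (X t) \<le> W (X 0)"
proof -
  have "continuous_on {0..t} (\<lambda>t. (norm (X t))\<^sup>2)"
    using traj_continuous_on[OF assms(1) order_refl assms(3)] by (intro continuous_intros)
  then have "0 \<le> integral {0..t} (\<lambda>t. (norm (X t))\<^sup>2)"
    by (intro integral_nonneg integrable_continuous_real) auto
  then show ?thesis using traj_W_decrease[OF assms] by simp
qed

lemma traj_dwell:
  assumes "traj T ts X" "\<And>t. 0 \<le> t \<Longrightarrow> ereal t < T \<Longrightarrow> norm (X t) \<le> R" "ts i = ereal a"
  shows "ereal (a + dwell R) \<le> ts (Suc i)"
proof -
  have a: "0 \<le> a" using traj_nonneg[OF assms(1), of i] assms(3) by simp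
  have "ereal (a + dwell R) \<le> ereal t" if t: "a < t" "ereal t < T" "event X a t" for t
  proof (rule ccontr)
    assume "\<not> ereal (a + dwell R) \<le> ereal t"
    moreover have "norm (X r) \<le> R" if "r \<in> {a..t}" for r
      using that a ereal_le_less_trans[OF _ t(2), of r] by (intro assms(2)) auto
    ultimately have "\<not> event X a t"
      using t by (intro no_event_before_dwell[of a t X R] traj_continuous_on[OF assms(1) a]) auto
    then show False using t(3) by simp
  qed
  moreover have "ts (Suc i) = Inf (ereal ` {t. ts i < ereal t \<and> ereal t < T \<and> event X (real_of_ereal (ts i)) t})"
    using assms(1) unfolding traj_iff by blast
  ultimately show ?thesis using assms(3) by (auto intro!: Inf_greatest)
qed

text \<open>The sublevel set of \<open>W\<close> at its initial value provides one radius, hence one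
  dwell time, for all intervals. Thus the instant of index \<open>i\<close> is at least
  \<open>i\<close> dwell times.\<close>

lemma traj_Zeno_free:
  assumes "traj T ts X"
  shows "Zeno_free ts"
proof -
  obtain R where R: "\<And>Y. W Y \<le> W (X 0) \<Longrightarrow> norm Y \<le> R" using W_proper by blast
  have ge: "ereal (real i * dwell R) \<le> ts i" for i
  proof (induction i)
    case 0
    then show ?case using traj_facts(1)[OF assms] by simp
  next
    case (Suc i)
    show ?case
    proof (cases "ts i = \<infinity>")
      case True
      then show ?thesis using traj_mono[OF assms, of i] by simp
    next
      case False
      then obtain a where a: "ts i = ereal a" "0 \<le> a" "ereal a < T" by (rule traj_instant_real[OF assms])
      have "real i * dwell R \<le> a" using Suc a by simp
      then have "real (Suc i) * dwell R \<le> a + dwell R" by (simp add: distrib_right)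
      then have "ereal (real (Suc i) * dwell R) \<le> ereal (a + dwell R)" by simp
      also have "\<dots> \<le> ts (Suc i)"
        using traj_W_le[OF assms] R by (intro traj_dwell[OF assms _ a(1)]) auto
      finally show ?thesis .
    qed
  qed
  show ?thesis unfolding Zeno_free_def
  proof
    fix b
    have "{i. ts i \<le> ereal b} \<subseteq> {..nat \<lceil>b / dwell R\<rceil>}"
    proof
      fix i assume "i \<in> {i. ts i \<le> ereal b}"
      then have "ereal (real i * dwell R) \<le> ereal b" using ge[of i] order_trans by blast
      then have "real i \<le> b / dwell R" using dwell_pos[of R] by (simp add: field_simps)
      then show "i \<in> {..nat \<lceil>b / dwell R\<rceil>}" by (simp add: le_nat_iff) linarith
    qed
    then show "finite {i. ts i \<le> ereal b}" by (rule finite_subset) simp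
  qed
qed

section \<open>Existence and extension of trajectories\<close>

lemma field_bounds:
  obtains M where "0 < M"
    "\<And>X u t. 0 \<le> t \<Longrightarrow> norm X \<le> R \<Longrightarrow> \<bar>u\<bar> \<le> c \<Longrightarrow> norm (field u t X) \<le> M"
    "\<And>X Y u t. 0 \<le> t \<Longrightarrow> norm X \<le> R \<Longrightarrow> norm Y \<le> R \<Longrightarrow> norm (field u t X - field u t Y) \<le> M * norm (X - Y)"
proof -
  obtain A where A: "0 \<le> A" "\<And>X d. d \<in> D \<Longrightarrow> norm X \<le> R \<Longrightarrow> norm (q (fst X) (snd X) d) \<le> A"
    "\<And>X Y d. d \<in> D \<Longrightarrow> norm X \<le> R \<Longrightarrow> norm Y \<le> R \<Longrightarrow>
       norm (q (fst X) (snd X) d - q (fst Y) (snd Y) d) \<le> A * norm (X - Y)"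
    by (rule C1_uniform_bounds[OF C1_q compact_D, where R = R]) (simp only: prod.case)
  obtain B where B: "0 \<le> B" "\<And>X d. d \<in> D \<Longrightarrow> norm X \<le> R \<Longrightarrow> norm (f (fst X) (snd X) d) \<le> B"
    "\<And>X Y d. d \<in> D \<Longrightarrow> norm X \<le> R \<Longrightarrow> norm Y \<le> R \<Longrightarrow>
       norm (f (fst X) (snd X) d - f (fst Y) (snd Y) d) \<le> B * norm (X - Y)"
    by (rule C1_uniform_bounds[OF C1_f compact_D, where R = R]) (simp only: prod.case)
  show thesis
  proof
    show "0 < A + B + \<bar>c\<bar> + 1" using A(1) B(1) by linarith
    show "norm (field u t X) \<le> A + B + \<bar>c\<bar> + 1" if "0 \<le> t" "norm X \<le> R" "\<bar>u\<bar> \<le> c" for X u t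
      using norm_Pair_le[of "q (fst X) (snd X) (d t)" "f (fst X) (snd X) (d t) + u"]
        A(2)[OF d_mem[OF that(1)] that(2)] B(2)[OF d_mem[OF that(1)] that(2)] that(3)
      unfolding field_def real_norm_def by linarith
    show "norm (field u t X - field u t Y) \<le> (A + B + \<bar>c\<bar> + 1) * norm (X - Y)"
      if "0 \<le> t" "norm X \<le> R" "norm Y \<le> R" for X Y u t
    proof -
      have eq: "field u t X - field u t Y = (q (fst X) (snd X) (d t) - q (fst Y) (snd Y) (d t),
          f (fst X) (snd X) (d t) - f (fst Y) (snd Y) (d t))" by (simp add: field_def)
      have "norm (field u t X - field u t Y) \<le> A * norm (X - Y) + B * norm (X - Y)"
        unfolding eq using norm_Pair_le[of "q (fst X) (snd X) (d t) - q (fst Y) (snd Y) (d t)"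
            "f (fst X) (snd X) (d t) - f (fst Y) (snd Y) (d t)"]
          A(3)[OF d_mem[OF that(1)] that(2,3)] B(3)[OF d_mem[OF that(1)] that(2,3)]
        unfolding real_norm_def by linarith
      also have "\<dots> \<le> (A + B + \<bar>c\<bar> + 1) * norm (X - Y)" by (simp add: algebra_simps)
      finally show ?thesis .
    qed
  qed
qed

lemma isCont_field:
  assumes "isCont X t" "isCont d t"
  shows "isCont (\<lambda>s. field u s (X s)) t"
proof -
  have p: "isCont (\<lambda>s. (fst (X s), snd (X s), d s)) t" using assms by (intro continuous_intros)
  have "isCont (\<lambda>s. q (fst (X s)) (snd (X s)) (d s)) t" "isCont (\<lambda>s. f (fst (X s)) (snd (X s)) (d s)) t"
    using isCont_o2[OF p C1_isCont[OF C1_q]] isCont_o2[OF p C1_isCont[OF C1_f]] by simp_all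
  then show ?thesis unfolding field_def by (intro continuous_intros)
qed

definition solves :: "real \<Rightarrow> real \<Rightarrow> real \<Rightarrow> (real \<Rightarrow> (real ^ 'p) \<times> real) \<Rightarrow> bool" where
  "solves u a b X \<longleftrightarrow> (\<forall>t\<in>{a<..<b}. isCont d t \<longrightarrow> (X has_vector_derivative field u t (X t)) (at t))"

lemma solves_cong:
  assumes "\<And>t. t \<in> {a<..<b} \<Longrightarrow> X t = Y t" "solves u a b X"
  shows "solves u a b Y"
  unfolding solves_def
proof (intro ballI impI)
  fix t assume t: "t \<in> {a<..<b}" "isCont d t"
  then have "(X has_vector_derivative field u t (Y t)) (at t)" using assms by (auto simp: solves_def)
  then show "(Y has_vector_derivative field u t (Y t)) (at t)"
    by (rule has_vector_derivative_transform_within_open[where S = "{a<..<b}"]) (use t assms(1) in auto)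
qed

text \<open>No sampling takes place at the seam \<open>b\<close>, so the equation has to hold there
  too whenever \<open>d\<close> is continuous. It does because the field along the continuous curve
  \<open>X\<close> is then continuous at \<open>b\<close>.\<close>

lemma solves_join:
  assumes "0 \<le> a" "continuous_on {a..c} X" "solves u a b X" "solves u b c X"
  shows "solves u a c X"
  unfolding solves_def
proof (intro ballI impI)
  fix t assume t: "t \<in> {a<..<c}" "isCont d t"
  have "isCont X t" using t(1) assms(2) by (simp add: continuous_on_interior)
  show "(X has_vector_derivative field u t (X t)) (at t)"
  proof (rule has_vector_derivative_at_continuity_point[where S = "insert b (jumps c)" and a = a and b = c
        and g = X and g' = "\<lambda>r. field u r (X r)"])
    show "isCont (\<lambda>r. field u r (X r)) t" by (rule isCont_field[OF \<open>isCont X t\<close> t(2)])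
    fix r assume r: "r \<in> {a<..<c} - insert b (jumps c)"
    then have "isCont d r" using assms(1) by (auto simp: jumps_def)
    then show "(X has_vector_derivative field u r (X r)) (at r)"
      using r assms(3,4) unfolding solves_def by (cases "r < b") auto
  qed (use t assms finite_jumps in auto)
qed

text \<open>The length \<open>\<delta>\<close> depends only on the radius and the input bound, not
  on the initial time or state. With \<open>\<delta> = 1 / (2 * M)\<close> the solution stays within
  distance 1 of its start and the contraction factor is one half.\<close>

lemma local_solution:
  obtains \<delta> where "0 < \<delta>"
    "\<And>a X0 u. 0 \<le> a \<Longrightarrow> norm X0 \<le> R \<Longrightarrow> \<bar>u\<bar> \<le> c \<Longrightarrow>
      \<exists>Y. continuous_on {a..a + \<delta>} Y \<and> Y a = X0 \<and> (\<forall>t\<in>{a..a + \<delta>}. norm (Y t) \<le> R + 1) \<and> solves u a (a + \<delta>) Y"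
proof -
  obtain M where M: "0 < M"
    "\<And>X u t. 0 \<le> t \<Longrightarrow> norm X \<le> R + 1 \<Longrightarrow> \<bar>u\<bar> \<le> c \<Longrightarrow> norm (field u t X) \<le> M"
    "\<And>X Y u t. 0 \<le> t \<Longrightarrow> norm X \<le> R + 1 \<Longrightarrow> norm Y \<le> R + 1 \<Longrightarrow>
       norm (field u t X - field u t Y) \<le> M * norm (X - Y)"
    by (rule field_bounds[where R = "R + 1" and c = c]) (rule that)
  define \<delta> where "\<delta> = 1 / (2 * M)"
  have \<delta>: "0 < \<delta>" "M * \<delta> < 1" using M(1) by (auto simp: \<delta>_def)
  show thesis
  proof
    show "0 < \<delta>" by (rule \<delta>)
    fix a u :: real and X0 :: "(real ^ 'p) \<times> real"
    assume a: "0 \<le> a" and X0: "norm X0 \<le> R" and u: "\<bar>u\<bar> \<le> c"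
    have ball: "norm X \<le> R + 1" if "X \<in> cball X0 1" for X
      using that X0 norm_triangle_ineq2[of X X0] by (simp add: dist_norm norm_minus_commute)
    obtain Y where Y: "continuous_on {a..a + \<delta>} Y" "Y a = X0" "\<And>t. t \<in> {a..a + \<delta>} \<Longrightarrow> Y t \<in> cball X0 1"
      "\<And>t. t \<in> {a<..<a + \<delta>} - jumps (a + \<delta>) \<Longrightarrow> (Y has_vector_derivative field u t (Y t)) (at t)"
    proof (rule picard_local_solution[where a = a and b = "a + \<delta>" and S = "jumps (a + \<delta>)" and L = M and M = M
          and r = 1 and p = X0 and G = "field u"])
      show "isCont (\<lambda>s. field u s (g s)) t" if "t \<in> {a<..<a + \<delta>} - jumps (a + \<delta>)" "isCont g t" for g t
        using that a by (intro isCont_field) (auto simp: jumps_def)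
      show "norm (field u t X) \<le> M" if "t \<in> {a..a + \<delta>}" "X \<in> cball X0 1" for t X
        using that a u ball by (intro M(2)) auto
      show "norm (field u t X - field u t Y) \<le> M * norm (X - Y)"
        if "t \<in> {a..a + \<delta>}" "X \<in> cball X0 1" "Y \<in> cball X0 1" for t X Y
        using that a ball by (intro M(3)) auto
    qed (use \<delta> M(1) finite_jumps in auto)
    have "solves u a (a + \<delta>) Y" unfolding solves_def using Y(4) by (auto simp: jumps_def)
    then show "\<exists>Y. continuous_on {a..a + \<delta>} Y \<and> Y a = X0 \<and> (\<forall>t\<in>{a..a + \<delta>}. norm (Y t) \<le> R + 1) \<and>
        solves u a (a + \<delta>) Y" using Y(1-3) ball by blast
  qed
qed

text \<open>Absence of Zeno behavior makes the exceptional set finite. The estimate yields both the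
  limit of the state at a finite horizon and the uniform continuity behind convergence.\<close>

lemma traj_lipschitz:
  assumes tr: "traj T ts X" and R: "\<And>t. 0 \<le> t \<Longrightarrow> ereal t < T \<Longrightarrow> norm (X t) \<le> R"
    and M: "0 \<le> M" "\<And>X u t. 0 \<le> t \<Longrightarrow> norm X \<le> R \<Longrightarrow> \<bar>u\<bar> \<le> bound R \<Longrightarrow> norm (field u t X) \<le> M"
    and st: "0 \<le> s" "s \<le> t" "ereal t < T"
  shows "norm (X t - X s) \<le> M * (t - s)"
proof (rule lipschitz_off_finite)
  let ?E = "(\<lambda>i. real_of_ereal (ts i)) ` {i. ts i \<le> ereal t} \<union> jumps t"
  show "finite ?E" using traj_Zeno_free[OF tr] finite_jumps by (simp add: Zeno_free_def)
  show "continuous_on {s..t} X" by (rule traj_continuous_on[OF tr st(1,3)])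
  fix r assume r: "r \<in> {s<..<t} - ?E"
  have rT: "ereal r < T" by (rule ereal_le_less_trans[OF _ st(3)]) (use r in simp)
  obtain i where i: "ts i \<le> ereal r" "ereal r < ts (Suc i)"
    using traj_covered[OF tr _ rT] r st by auto
  then have "ts i \<noteq> \<infinity>" by auto
  then obtain a where a: "ts i = ereal a" "0 \<le> a" "ereal a < T" by (rule traj_instant_real[OF tr])
  have "a \<in> ?E" if "a = r" using r a that by (auto intro!: image_eqI[of _ _ i])
  then have "a < r" using i(1) a(1) r by force
  moreover have "isCont d r" using r st by (auto simp: jumps_def)
  ultimately have "(X has_vector_derivative field (feedback \<rho> (snd (X a))) r (X r)) (at r)"
    by (rule traj_ode[OF tr a(1) _ i(2) rT])
  moreover have "norm (field (feedback \<rho> (snd (X a))) r (X r)) \<le> M"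
    using r st rT a by (intro M(2) R feedback_le_bound) auto
  ultimately show "\<exists>v. norm v \<le> M \<and> (X has_vector_derivative v) (at r)" by blast
qed (use st M in auto)

section \<open>Sampling instants as a function of state and horizon\<close>

lemma event_cong:
  assumes "a \<le> t" "\<And>r. r \<in> {a..t} \<Longrightarrow> X r = Y r"
  shows "event X a t \<longleftrightarrow> event Y a t"
proof -
  have "sampling_error \<rho> (\<lambda>t. snd (X t)) a r = sampling_error \<rho> (\<lambda>t. snd (Y t)) a r" if "r \<in> {a..t}" for r
    using assms that by (simp add: sampling_error_def)
  then have "(\<lambda>r. g (sampling_error \<rho> (\<lambda>t. snd (X t)) a r)) ` {a..t} =
      (\<lambda>r. g (sampling_error \<rho> (\<lambda>t. snd (Y t)) a r)) ` {a..t}" for g :: "real \<Rightarrow> real"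
    by (intro image_cong) auto
  then show ?thesis unfolding event_condition_def sup_norm_def by simp
qed

text \<open>The law determines the instants from \<open>X\<close> and the horizon, so gluing
  trajectories amounts to constructing \<open>X\<close>.\<close>

primrec instants :: "ereal \<Rightarrow> (real \<Rightarrow> (real ^ 'p) \<times> real) \<Rightarrow> nat \<Rightarrow> ereal" where
  "instants T X 0 = 0"
| "instants T X (Suc i) = Inf (ereal ` {t. instants T X i < ereal t \<and> ereal t < T \<and>
     event X (real_of_ereal (instants T X i)) t})"

lemma traj_eq_instants:
  assumes "traj T ts X"
  shows "ts i = instants T X i"
proof (induction i)
  case 0
  then show ?case using traj_facts(1)[OF assms] by simp
next
  case (Suc i)
  have "ts (Suc i) = Inf (ereal ` {t. ts i < ereal t \<and> ereal t < T \<and> event X (real_of_ereal (ts i)) t})"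
    using assms unfolding traj_iff by blast
  then show ?case using Suc by simp
qed

lemma instants_mono: "i \<le> j \<Longrightarrow> instants T X i \<le> instants T X j"
  by (rule lift_Suc_mono_le[of "instants T X"]) (auto intro!: Inf_greatest)

lemma instants_nonneg: "0 \<le> instants T X i"
  using instants_mono[of 0 i T X] by simp

lemma instants_Suc_infinity: "instants T X i = \<infinity> \<Longrightarrow> instants T X (Suc i) = \<infinity>"
  by (simp add: top_ereal_def)

text \<open>An infimum below \<open>T\<close> is approached by events below \<open>T\<close> and
  survives the shorter horizon. An infimum at or beyond \<open>T\<close> has no events below
  \<open>T\<close> and becomes the infimum of the empty set.\<close>

lemma instants_restrict:
  assumes "T \<le> T'" "0 < T" and eq: "\<And>t. 0 \<le> t \<Longrightarrow> ereal t < T \<Longrightarrow> X t = Y t"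
  shows "instants T X i = (if instants T' Y i < T then instants T' Y i else \<infinity>)"
proof (induction i)
  case 0
  then show ?case using assms(2) by simp
next
  case (Suc i)
  let ?S = "\<lambda>T X. {t. instants T X i < ereal t \<and> ereal t < T \<and> event X (real_of_ereal (instants T X i)) t}"
  show ?case
  proof (cases "instants T' Y i < T")
    case True
    with Suc have I: "instants T X i = instants T' Y i" by simp
    have "instants T' Y i \<noteq> \<infinity>" using True by auto
    then obtain a where a: "instants T' Y i = ereal a" "0 \<le> a"
      using instants_nonneg[of T' Y i] by (cases "instants T' Y i") auto
    have S: "?S T X = {t \<in> ?S T' Y. ereal t < T}"
    proof (rule Collect_cong, unfold mem_Collect_eq I a(1) real_of_ereal.simps)
      fix t
      have "event X a t = event Y a t" if "a < t" "ereal t < T"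
        using that a(2) ereal_le_less_trans[OF _ that(2)] by (intro event_cong eq) auto
      then show "(ereal a < ereal t \<and> ereal t < T \<and> event X a t) =
          ((ereal a < ereal t \<and> ereal t < T' \<and> event Y a t) \<and> ereal t < T)"
        using assms(1) by auto
    qed
    show ?thesis
    proof (cases "instants T' Y (Suc i) < T")
      case less: True
      then obtain t where t: "t \<in> ?S T' Y" "ereal t < T" by (auto simp: Inf_less_iff)
      have "instants T X (Suc i) = instants T' Y (Suc i)"
        unfolding instants.simps
      proof (rule antisym)
        show "Inf (ereal ` ?S T' Y) \<le> Inf (ereal ` ?S T X)"
          by (rule Inf_superset_mono) (use S in blast)
        show "Inf (ereal ` ?S T X) \<le> Inf (ereal ` ?S T' Y)"
        proof (rule Inf_greatest)
          fix e assume "e \<in> ereal ` ?S T' Y"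
          then obtain r where r: "e = ereal r" "r \<in> ?S T' Y" by blast
          show "Inf (ereal ` ?S T X) \<le> e"
          proof (cases "ereal r < T")
            case True
            then have "r \<in> ?S T X" using r S by blast
            then show ?thesis unfolding r(1) by (intro Inf_lower imageI)
          next
            case False
            have "t \<in> ?S T X" using t S by blast
            then have "Inf (ereal ` ?S T X) \<le> ereal t" by (intro Inf_lower imageI)
            also have "\<dots> \<le> e" using t(2) False unfolding r(1) by (meson less_imp_le not_le order_trans)
            finally show ?thesis .
          qed
        qed
      qed
      then show ?thesis using less by simp
    next
      case False
      have "r \<notin> ?S T X" for r
      proof
        assume "r \<in> ?S T X"
        then have "r \<in> ?S T' Y" "ereal r < T" using S by blast+
        then have "instants T' Y (Suc i) \<le> ereal r" unfolding instants.simps by (intro Inf_lower imageI)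
        then show False using \<open>ereal r < T\<close> False by simp
      qed
      then have "?S T X = {}" by blast
      then have "instants T X (Suc i) = \<infinity>" unfolding instants.simps by (simp only: image_empty) (simp add: top_ereal_def)
      then show ?thesis using False by simp
    qed
  next
    case False
    then have "instants T X i = \<infinity>" using Suc by simp
    then have "instants T X (Suc i) = \<infinity>" by (rule instants_Suc_infinity)
    moreover have "\<not> instants T' Y (Suc i) < T"
      using False instants_mono[of i "Suc i" T' Y] by (simp del: instants.simps)
    ultimately show ?thesis by (simp del: instants.simps)
  qed
qed

section \<open>Assembling and extending trajectories\<close>

lemma trajI:
  assumes "0 < T" "continuous_on {t. 0 \<le> t \<and> ereal t < T} X"
    and "\<And>t. 0 \<le> t \<Longrightarrow> ereal t < T \<Longrightarrow> \<exists>i. instants T X i \<le> ereal t \<and> ereal t < instants T X (Suc i)"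
    and "\<And>i a t. instants T X i = ereal a \<Longrightarrow> 0 \<le> a \<Longrightarrow> a < t \<Longrightarrow> ereal t < instants T X (Suc i) \<Longrightarrow> ereal t < T \<Longrightarrow> isCont d t \<Longrightarrow>
      (X has_vector_derivative field (feedback \<rho> (snd (X a))) t (X t)) (at t)"
  shows "traj T (instants T X) X"
  unfolding traj_iff
proof (intro conjI allI impI)
  fix i t assume t: "instants T X i < ereal t \<and> ereal t < instants T X (Suc i) \<and> ereal t < T \<and> isCont d t"
  obtain a where a: "instants T X i = ereal a" "0 \<le> a" "a < t"
    using instants_nonneg[of T X i] t by (cases "instants T X i") auto
  then show "(X has_vector_derivative field (feedback \<rho> (snd (X (real_of_ereal (instants T X i))))) t (X t)) (at t)"
    using assms(4)[OF a] t by (simp del: instants.simps)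
next
  fix t assume "0 \<le> t \<and> ereal t < T"
  then show "\<exists>i. instants T X i \<le> ereal t \<and> ereal t < instants T X (Suc i)" by (intro assms(3)) auto
qed (rule assms(1) assms(2) instants.simps)+

text \<open>Finite instants lie before \<open>T\<close> and there are finitely many of them, so a
  single held input is in force up to the end of the trajectory.\<close>

lemma traj_last_instant:
  assumes tr: "traj (ereal T) ts X"
  obtains n a where "ts n = ereal a" "0 \<le> a" "a < T" "ts (Suc n) = \<infinity>"
proof -
  let ?K = "{i. ts i \<le> ereal T}"
  have fin: "finite ?K" using traj_Zeno_free[OF tr] by (simp add: Zeno_free_def)
  have "0 \<in> ?K" using traj_facts(1,2)[OF tr] by simp
  then have ne: "?K \<noteq> {}" by blast
  define n where "n = Max ?K"
  have "n \<in> ?K" unfolding n_def by (rule Max_in[OF fin ne])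
  then have "ts n \<noteq> \<infinity>" by auto
  then obtain a where a: "ts n = ereal a" "0 \<le> a" "ereal a < ereal T" by (rule traj_instant_real[OF tr])
  have "Suc n \<notin> ?K" using Max_ge[OF fin, of "Suc n"] by (auto simp: n_def)
  then have "ts (Suc n) = \<infinity>" using traj_instant_less[OF tr, of "Suc n"] by (metis mem_Collect_eq less_imp_le)
  then show thesis using that a by simp
qed

text \<open>Of the two parts of the event condition only the nonzero error can be lost at the
  infimum. The threshold inequality persists: elapsed time and largest error vary continuously, so
  strict failure at \<open>b\<close> would exclude events shortly after \<open>b\<close>.\<close>

lemma event_threshold_at_Inf:
  assumes ab: "a \<le> b" "b < c" and cont: "continuous_on {a..c} X"
    and S: "S = {t. a < t \<and> t < c \<and> event X a t}" "S \<noteq> {}" "b = Inf S"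
  shows "1 \<le> 4 * (b - a) * m (sup_norm (sampling_error \<rho> (\<lambda>t. snd (X t)) a) a b)"
proof (rule ccontr)
  let ?x = "\<lambda>t. snd (X t)"
  let ?w = "sampling_error \<rho> ?x a"
  let ?s = "sup_norm ?w a"
  \<comment> \<open>An upper bound for the left-hand side of the threshold at any
    \<open>t \<le> b + \<eta>\<close> at which the largest error has grown by at most
    \<open>\<eta>\<close>.\<close>
  let ?h = "\<lambda>\<eta>. 4 * (b + \<eta> - a) * m (?s b + \<eta>)"
  assume "\<not> 1 \<le> 4 * (b - a) * m (?s b)"
  then have h0: "?h 0 < 1" by simp
  have "continuous_on UNIV ?h" by (intro continuous_intros continuous_on_series[OF series(4)])
  then have "isCont ?h 0" by (simp add: continuous_on_eq_continuous_at)
  then have "(?h \<longlongrightarrow> ?h 0) (at 0)" by (simp only: isCont_def)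
  from order_tendstoD(2)[OF this h0] obtain e where e: "0 < e" "\<And>\<eta>. \<eta> \<noteq> 0 \<Longrightarrow> dist \<eta> 0 < e \<Longrightarrow> ?h \<eta> < 1"
    unfolding eventually_at by blast
  define \<eta> where "\<eta> = e / 2"
  have \<eta>: "0 < \<eta>" "?h \<eta> < 1" using e(1) e(2)[of \<eta>] by (auto simp: \<eta>_def)
  have x: "continuous_on {a..t} ?x" if "t \<le> c" for t
    using that by (intro continuous_intros continuous_on_subset[OF cont]) auto
  have "continuous_on {a..c} ?w" by (rule continuous_on_error[OF x]) simp
  then obtain e2 where e2: "0 < e2" "\<And>t. t \<in> {a..c} \<Longrightarrow> dist t b < e2 \<Longrightarrow> dist (?w t) (?w b) < \<eta>"
    using ab \<eta>(1) unfolding continuous_on_iff by (metis atLeastAtMost_iff less_imp_le)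
  have wb: "\<bar>?w r\<bar> \<le> ?s b" if "r \<in> {a..b}" for r
    using sup_error_bounds(2)[OF ab(1) x that] ab(2) by simp
  have none: "\<not> event X a t" if t: "a < t" "t < c" "t < b + min \<eta> e2" for t
  proof
    assume "event X a t"
    then have ev: "1 \<le> 4 * (t - a) * m (?s t)" using event_iff[of a t ?x] x[of t] t by auto
    obtain \<tau> where \<tau>: "\<tau> \<in> {a..t}" "?s t = \<bar>?w \<tau>\<bar>"
      using sup_norm_attained[OF _ continuous_on_error[OF x], of t] t by (metis less_imp_le)
    have "\<bar>?w \<tau>\<bar> \<le> ?s b + \<eta>"
    proof (cases "\<tau> \<le> b")
      case True
      then show ?thesis using wb[of \<tau>] \<tau>(1) \<eta>(1) by auto
    next
      case False
      then have "dist (?w \<tau>) (?w b) < \<eta>" using \<tau>(1) t by (intro e2(2)) (auto simp: dist_real_def)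
      then show ?thesis using wb[of b] ab by (auto simp: dist_real_def)
    qed
    then have "m (?s t) \<le> m (?s b + \<eta>)" using \<tau>(2) by (intro even_series_mono[OF series(4)]) auto
    then have "4 * (t - a) * m (?s t) \<le> ?h \<eta>"
      using t m_ge(1)[of "?s t"] by (intro mult_mono) auto
    then show False using ev \<eta>(2) by simp
  qed
  have "b + min \<eta> e2 \<le> Inf S"
  proof (rule cInf_greatest[OF S(2)])
    fix t assume "t \<in> S"
    then show "b + min \<eta> e2 \<le> t" using none[of t] unfolding S(1) by (cases "t < b + min \<eta> e2") auto
  qed
  then show False using S(3) \<eta>(1) e2(1) by simp
qed

text \<open>The extension contains at most one new instant \<open>b\<close>, possibly
  \<open>T\<close> itself; \<open>b = \<infinity>\<close> means that the old input is held up to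
  \<open>T'\<close>. All earlier instants are those of \<open>X\<close> by
  \<open>instants_restrict\<close>.\<close>

lemma traj_append:
  assumes tr: "traj (ereal T) ts X" and n: "ts n = ereal a" "ts (Suc n) = \<infinity>"
    and T: "T \<le> T'" and eq: "\<And>t. 0 \<le> t \<Longrightarrow> t < T \<Longrightarrow> X t = Y t"
    and cont: "continuous_on {0..<T'} Y"
    and b: "Inf (ereal ` {t. a < t \<and> t < T' \<and> event Y a t}) = b"
    and ode_a: "\<And>t. a < t \<Longrightarrow> t < T' \<Longrightarrow> ereal t < b \<Longrightarrow> isCont d t \<Longrightarrow>
      (Y has_vector_derivative field (feedback \<rho> (snd (Y a))) t (Y t)) (at t)"
    and no_event: "\<And>c t. b = ereal c \<Longrightarrow> c < t \<Longrightarrow> t < T' \<Longrightarrow> \<not> event Y c t"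
    and ode_b: "\<And>c t. b = ereal c \<Longrightarrow> c < t \<Longrightarrow> t < T' \<Longrightarrow> isCont d t \<Longrightarrow>
      (Y has_vector_derivative field (feedback \<rho> (snd (Y c))) t (Y t)) (at t)"
  shows "traj (ereal T') (instants (ereal T') Y) Y"
proof -
  let ?I = "instants (ereal T') Y"
  have T0: "0 < T" using traj_facts(2)[OF tr] by simp
  have restrict: "ts i = (if ?I i < ereal T then ?I i else \<infinity>)" for i
    unfolding traj_eq_instants[OF tr] using T T0 eq by (intro instants_restrict) auto
  have less: "?I n < ereal T" using restrict[of n] n(1) by (cases "?I n < ereal T") auto
  then have Ik: "?I n = ereal a" using restrict[of n] n(1) by simp
  have aT: "a < T" using less unfolding Ik by simp
  have ISk: "?I (Suc n) = b" using b by (simp add: Ik)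
  have Tb: "ereal T \<le> b" using restrict[of "Suc n"] n(2) unfolding ISk by (cases "b < ereal T") auto
  have ISSk: "?I (Suc (Suc n)) = \<infinity>"
  proof (cases b)
    case (real c)
    then have "{t. b < ereal t \<and> ereal t < ereal T' \<and> event Y (real_of_ereal b) t} = {}"
      using no_event by auto
    then show ?thesis unfolding instants.simps(2)[of _ _ "Suc n"] ISk
      by (simp only: image_empty) (simp add: top_ereal_def)
  next
    case PInf
    then have "?I (Suc n) = \<infinity>" using ISk by (simp del: instants.simps)
    then show ?thesis by (rule instants_Suc_infinity)
  qed (use Tb in auto)
  show ?thesis
  proof (rule trajI)
    show "0 < ereal T'" using T T0 by simp
    have "{t. 0 \<le> t \<and> ereal t < ereal T'} = {0..<T'}" by auto
    then show "continuous_on {t. 0 \<le> t \<and> ereal t < ereal T'} Y" using cont by simp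
  next
    fix t assume t: "0 \<le> t" "ereal t < ereal T'"
    show "\<exists>i. ?I i \<le> ereal t \<and> ereal t < ?I (Suc i)"
    proof (cases "t < T")
      case True
      then obtain i where i: "ts i \<le> ereal t" "ereal t < ts (Suc i)"
        using traj_covered[OF tr t(1)] by auto
      have "?I i \<le> ereal t" using i(1) restrict[of i] by (auto split: if_splits)
      moreover have "ereal t < ?I (Suc i)"
      proof (cases "?I (Suc i) < ereal T")
        case True
        then show ?thesis using i(2) restrict[of "Suc i"] by (simp del: instants.simps)
      next
        case False
        have "ereal t < ereal T" using \<open>t < T\<close> by simp
        then show ?thesis using False by (meson less_le_trans not_le)
      qed
      ultimately show ?thesis by blast
    next
      case False
      show ?thesis
      proof (cases "ereal t < b")
        case True
        then show ?thesis using Ik ISk aT False by (intro exI[of _ n]) (simp del: instants.simps)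
      next
        case False
        then show ?thesis using ISk ISSk by (intro exI[of _ "Suc n"]) (simp del: instants.simps)
      qed
    qed
  next
    fix i c t assume i: "?I i = ereal c" "0 \<le> c" "c < t" "ereal t < ?I (Suc i)" "ereal t < ereal T'" "isCont d t"
    show "(Y has_vector_derivative field (feedback \<rho> (snd (Y c))) t (Y t)) (at t)"
    proof (cases "t < T")
      case True
      then have tsi: "ts i = ereal c" using restrict[of i] i(1,3) by simp
      have "ereal t < ts (Suc i)" using restrict[of "Suc i"] i(4) by (simp del: instants.simps)
      then have "(X has_vector_derivative field (feedback \<rho> (snd (X c))) t (X t)) (at t)"
        using True i by (intro traj_ode[OF tr tsi]) auto
      then have "(X has_vector_derivative field (feedback \<rho> (snd (Y c))) t (Y t)) (at t)"
        using eq[of c] eq[of t] i True by simp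
      then show ?thesis
        by (rule has_vector_derivative_transform_within_open[where S = "{0<..<T}"]) (use i True eq in auto)
    next
      case False
      consider "i < n" | "i = n" | "i = Suc n" | "Suc (Suc n) \<le> i" by linarith
      then show ?thesis
      proof cases
        case 1
        then have "?I (Suc i) \<le> ereal a" using instants_mono[of "Suc i" n "ereal T'" Y] Ik by (simp del: instants.simps)
        with i(4) have "ereal t < ereal a" by (rule less_le_trans)
        then show ?thesis using False aT by simp
      next
        case 2
        then have "c = a" "ereal t < b" using i(1,4) Ik ISk by (auto simp del: instants.simps)
        then show ?thesis using ode_a i by simp
      next
        case 3
        then show ?thesis using ode_b i ISk by (simp del: instants.simps)
      next
        case 4
        then show ?thesis using instants_mono[OF 4, of "ereal T'" Y] ISSk i(1) by (simp del: instants.simps)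
      qed
    qed
  qed
qed

text \<open>No event can occur within the dwell time of the ball containing the local solution, so
  one interval with the initial input already is a trajectory.\<close>

lemma traj_exists:
  "\<exists>T ts X. traj (ereal T) ts X \<and> X 0 = \<xi>"
proof -
  obtain \<delta> where \<delta>: "0 < \<delta>" "\<And>a X0 u. 0 \<le> a \<Longrightarrow> norm X0 \<le> norm \<xi> \<Longrightarrow> \<bar>u\<bar> \<le> bound (norm \<xi>) \<Longrightarrow>
      \<exists>Y. continuous_on {a..a + \<delta>} Y \<and> Y a = X0 \<and> (\<forall>t\<in>{a..a + \<delta>}. norm (Y t) \<le> norm \<xi> + 1) \<and> solves u a (a + \<delta>) Y"
    by (rule local_solution[where R = "norm \<xi>" and c = "bound (norm \<xi>)"]) (rule that)
  obtain Y where Y: "continuous_on {0..\<delta>} Y" "Y 0 = \<xi>" "\<And>t. t \<in> {0..\<delta>} \<Longrightarrow> norm (Y t) \<le> norm \<xi> + 1"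
    "solves (feedback \<rho> (snd \<xi>)) 0 \<delta> Y"
    using \<delta>(2)[of 0 \<xi> "feedback \<rho> (snd \<xi>)"] feedback_le_bound[of \<xi> "norm \<xi>"] by auto
  define T where "T = min \<delta> (dwell (norm \<xi> + 1))"
  have T: "0 < T" "T \<le> \<delta>" "T \<le> dwell (norm \<xi> + 1)" using \<delta>(1) dwell_pos by (auto simp: T_def)
  let ?I = "instants (ereal T) Y"
  have "\<not> event Y 0 t" if "0 < t" "t < T" for t
    using that T by (intro no_event_before_dwell[where R = "norm \<xi> + 1"] Y(3) continuous_on_subset[OF Y(1)]) auto
  then have "{t. ?I 0 < ereal t \<and> ereal t < ereal T \<and> event Y (real_of_ereal (?I 0)) t} = {}" by auto
  then have I1: "?I (Suc 0) = \<infinity>"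
    unfolding instants.simps(2)[of _ _ 0] by (simp only: image_empty) (simp add: top_ereal_def)
  have "traj (ereal T) ?I Y"
  proof (rule trajI)
    show "0 < ereal T" using T by simp
    show "continuous_on {t. 0 \<le> t \<and> ereal t < ereal T} Y"
      by (rule continuous_on_subset[OF Y(1)]) (use T in auto)
    show "\<exists>i. ?I i \<le> ereal t \<and> ereal t < ?I (Suc i)" if "0 \<le> t" for t
      using I1 that by (intro exI[of _ 0]) (simp del: instants.simps(2))
    fix i a t assume i: "?I i = ereal a" "0 \<le> a" "a < t" "ereal t < ereal T" "isCont d t"
    have "i = 0"
    proof (rule ccontr)
      assume "i \<noteq> 0"
      then have "?I (Suc 0) \<le> ?I i" by (intro instants_mono) simp
      then show False using I1 i(1) by (simp del: instants.simps)
    qed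
    then have "a = 0" using i(1) by (simp add: zero_ereal_def)
    then show "(Y has_vector_derivative field (feedback \<rho> (snd (Y a))) t (Y t)) (at t)"
      using Y(2,4) i T unfolding solves_def by auto
  qed
  then show ?thesis using Y(2) by blast
qed

lemma solves_subinterval: "solves u a b X \<Longrightarrow> a \<le> a' \<Longrightarrow> b' \<le> b \<Longrightarrow> solves u a' b' X"
  by (auto simp: solves_def)

text \<open>The gain \<open>\<delta>\<close> depends on the level \<open>w\<close> alone, not on
  \<open>T\<close> or the trajectory, so repeated extension cannot stall at a finite time.\<close>

lemma traj_extend_step:
  obtains \<delta> where "0 < \<delta>"
    "\<And>T ts X. traj (ereal T) ts X \<Longrightarrow> W (X 0) \<le> w \<Longrightarrow>
      \<exists>T' ts' Y. T + \<delta> \<le> T' \<and> traj (ereal T') ts' Y \<and> (\<forall>t. 0 \<le> t \<and> t < T \<longrightarrow> X t = Y t)"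
proof -
  obtain R where R: "\<And>X. W X \<le> w \<Longrightarrow> norm X \<le> R" using W_proper by blast
  obtain \<delta>1 where \<delta>1: "0 < \<delta>1" "\<And>a X0 u. 0 \<le> a \<Longrightarrow> norm X0 \<le> R \<Longrightarrow> \<bar>u\<bar> \<le> bound R \<Longrightarrow>
      \<exists>Y. continuous_on {a..a + \<delta>1} Y \<and> Y a = X0 \<and> (\<forall>t\<in>{a..a + \<delta>1}. norm (Y t) \<le> R + 1) \<and> solves u a (a + \<delta>1) Y"
    by (rule local_solution[where R = R and c = "bound R"]) (rule that)
  obtain \<delta>2 where \<delta>2: "0 < \<delta>2" "\<And>a X0 u. 0 \<le> a \<Longrightarrow> norm X0 \<le> R + 1 \<Longrightarrow> \<bar>u\<bar> \<le> bound (R + 1) \<Longrightarrow>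
      \<exists>Y. continuous_on {a..a + \<delta>2} Y \<and> Y a = X0 \<and> (\<forall>t\<in>{a..a + \<delta>2}. norm (Y t) \<le> R + 1 + 1) \<and> solves u a (a + \<delta>2) Y"
    by (rule local_solution[where R = "R + 1" and c = "bound (R + 1)"]) (rule that)
  obtain M where M: "0 < M" "\<And>X u t. 0 \<le> t \<Longrightarrow> norm X \<le> R \<Longrightarrow> \<bar>u\<bar> \<le> bound R \<Longrightarrow> norm (field u t X) \<le> M"
    by (rule field_bounds[where R = R and c = "bound R"]) (rule that)
  \<comment> \<open>The state is in radius \<open>R\<close> before \<open>T\<close>, in
    \<open>R + 1\<close> on the continuation with the old input (\<open>\<delta>1\<close>), and in
    \<open>R + 2\<close> after one resampling (\<open>\<delta>2\<close>); the dwell time for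
    \<open>R + 2\<close> excludes a second new event.\<close>
  define \<delta> where "\<delta> = min (min \<delta>1 \<delta>2) (dwell (R + 2))"
  have \<delta>: "0 < \<delta>" "\<delta> \<le> \<delta>1" "\<delta> \<le> \<delta>2" "\<delta> \<le> dwell (R + 2)"
    using \<delta>1(1) \<delta>2(1) dwell_pos by (auto simp: \<delta>_def)
  show thesis
  proof (rule that[OF \<delta>(1)])
    fix T ts X assume tr: "traj (ereal T) ts X" and w: "W (X 0) \<le> w"
    have T: "0 < T" using traj_facts(2)[OF tr] by simp
    have XR: "norm (X t) \<le> R" if "0 \<le> t" "t < T" for t
      using traj_W_le[OF tr that(1)] that w by (intro R) auto
    have lip: "norm (X t - X s) \<le> M * (t - s)" if "0 \<le> s" "s \<le> t" "t < T" for s t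
      using that XR M by (intro traj_lipschitz[OF tr]) auto
    \<comment> \<open>A Lipschitz state has a limit at \<open>T\<close>, from which the continuation
      starts.\<close>
    have "uniformly_continuous_on {0..<T} X"
    proof (rule lipschitz_on_uniformly_continuous[of M], rule lipschitz_onI)
      fix s t assume "s \<in> {0..<T}" "t \<in> {0..<T}"
      then show "dist (X s) (X t) \<le> M * dist s t"
        using lip[of s t] lip[of t s] by (cases "s \<le> t") (auto simp: dist_norm norm_minus_commute)
    qed (use M in simp)
    then obtain g where g: "uniformly_continuous_on (closure {0..<T}) g" "\<And>t. t \<in> {0..<T} \<Longrightarrow> X t = g t"
      by (rule uniformly_continuous_on_extension_on_closure) (rule that)
    have cl: "closure {0..<T} = {0..T}" using T by (rule closure_atLeastLessThan)
    have contg: "continuous_on {0..T} g" using g(1) unfolding cl by (rule uniformly_continuous_imp_continuous)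
    have gR: "norm (g t) \<le> R" if "t \<in> {0..T}" for t
      by (rule continuous_on_closure_norm_le[of "{0..<T}"]) (use contg XR g(2) that in \<open>auto simp: cl\<close>)
    obtain n a where n: "ts n = ereal a" "0 \<le> a" "a < T" "ts (Suc n) = \<infinity>" by (rule traj_last_instant[OF tr])
    let ?u = "feedback \<rho> (snd (X a))"
    obtain Y0 where Y0: "continuous_on {T..T + \<delta>1} Y0" "Y0 T = g T"
      "\<And>t. t \<in> {T..T + \<delta>1} \<Longrightarrow> norm (Y0 t) \<le> R + 1" "solves ?u T (T + \<delta>1) Y0"
      using \<delta>1(2)[of T "g T" ?u] gR[of T] T feedback_le_bound[OF XR[OF n(2,3)]] by fastforce
    define Y where "Y t = (if t \<le> T then g t else Y0 t)" for t
    have YX: "Y t = X t" if "0 \<le> t" "t < T" for t using g(2)[of t] that by (simp add: Y_def)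
    have contY: "continuous_on {0..T + \<delta>} Y"
      unfolding Y_def
    proof (rule continuous_on_cases_le)
      show "continuous_on {t \<in> {0..T + \<delta>}. t \<le> T} g" by (rule continuous_on_subset[OF contg]) auto
      show "continuous_on {t \<in> {0..T + \<delta>}. T \<le> t} Y0"
        by (rule continuous_on_subset[OF Y0(1)]) (use \<delta> in auto)
    qed (use Y0(2) in \<open>auto intro: continuous_intros\<close>)
    have YR: "norm (Y t) \<le> R + 1" if "t \<in> {0..T + \<delta>}" for t
    proof (cases "t \<le> T")
      case True
      then show ?thesis using gR[of t] that by (simp add: Y_def)
    next
      case False
      then show ?thesis using Y0(3)[of t] that \<delta> by (simp add: Y_def)
    qed
    have Ya: "Y a = X a" using YX n by simp
    have solY: "solves ?u a (T + \<delta>) Y"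
    proof (rule solves_join[where b = T])
      show "continuous_on {a..T + \<delta>} Y" by (rule continuous_on_subset[OF contY]) (use n in auto)
      have "solves ?u a T X" unfolding solves_def using n by (auto intro: traj_ode[OF tr n(1)])
      then show "solves ?u a T Y" by (rule solves_cong[rotated]) (use n YX in auto)
      show "solves ?u T (T + \<delta>) Y"
        by (rule solves_cong[OF _ solves_subinterval[OF Y0(4)]]) (use \<delta> in \<open>auto simp: Y_def\<close>)
    qed (rule n)
    \<comment> \<open>\<open>Y\<close> keeps the old input and may run past an event.
      \<open>S\<close> collects the events it would raise; none precedes \<open>T\<close>, where
      \<open>Y\<close> agrees with \<open>X\<close>.\<close>
    define S where "S = {t. a < t \<and> t < T + \<delta> \<and> event Y a t}"
    have ST: "T \<le> t" if "t \<in> S" for t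
    proof (rule ccontr)
      assume "\<not> T \<le> t"
      then have "event X a t" "t < T" "a < t" using that n YX event_cong[of a t X Y] by (auto simp: S_def)
      then show False using traj_no_event[OF tr n(1), of t] n by simp
    qed
    show "\<exists>T' ts' Y. T + \<delta> \<le> T' \<and> traj (ereal T') ts' Y \<and> (\<forall>t. 0 \<le> t \<and> t < T \<longrightarrow> X t = Y t)"
    proof (cases "S = {}")
      case True
      have "traj (ereal (T + \<delta>)) (instants (ereal (T + \<delta>)) Y) Y"
      proof (rule traj_append[OF tr n(1,4)])
        show "Inf (ereal ` {t. a < t \<and> t < T + \<delta> \<and> event Y a t}) = \<infinity>"
          unfolding S_def[symmetric] True by (simp add: top_ereal_def)
        show "continuous_on {0..<T + \<delta>} Y" by (rule continuous_on_subset[OF contY]) auto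
        show "(Y has_vector_derivative field (feedback \<rho> (snd (Y a))) t (Y t)) (at t)"
          if "a < t" "t < T + \<delta>" "isCont d t" for t
          using solY that unfolding solves_def Ya by auto
      qed (use \<delta> YX in auto)
      moreover have "\<forall>t. 0 \<le> t \<and> t < T \<longrightarrow> X t = Y t" using YX by simp
      ultimately show ?thesis by (intro exI[of _ "T + \<delta>"] exI conjI order_refl)
    next
      case False
      define b where "b = Inf S"
      have bdd: "bdd_below S" using ST by (auto simp: bdd_below_def)
      have bT: "T \<le> b" unfolding b_def using False ST by (rule cInf_greatest)
      have b_le: "b \<le> t" if "t \<in> S" for t unfolding b_def using that bdd by (rule cInf_lower)
      have b_less: "b < T + \<delta>" using False b_le by (auto simp: S_def intro: le_less_trans)
      have ab: "a < b" using n bT by simp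
      have Inf_S: "Inf (ereal ` S) = ereal b"
        unfolding b_def using False bdd by (rule ereal_Inf'[symmetric, rotated])
      \<comment> \<open>If the condition holds at \<open>b\<close>, then \<open>Z\<close> resamples
        there and runs to \<open>b + \<delta>\<close>; otherwise it is \<open>Y\<close> up to
        \<open>T + \<delta>\<close>. In both cases \<open>T' \<le> b + \<delta>\<close> stays within
        one dwell time after \<open>b\<close>.\<close>
      obtain T' Z where Z: "T + \<delta> \<le> T'" "T' \<le> b + \<delta>" "continuous_on {0..T'} Z"
          "\<And>t. t \<in> {0..T'} \<Longrightarrow> norm (Z t) \<le> R + 2" "\<And>t. t \<in> {0..b} \<Longrightarrow> Z t = Y t"
          "Inf (ereal ` {t. a < t \<and> t < T' \<and> event Z a t}) = ereal b" "solves (feedback \<rho> (snd (Z b))) b T' Z"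
      proof (cases "event Y a b")
        case True
        obtain Y1 where Y1: "continuous_on {b..b + \<delta>2} Y1" "Y1 b = Y b"
            "\<And>t. t \<in> {b..b + \<delta>2} \<Longrightarrow> norm (Y1 t) \<le> R + 1 + 1" "solves (feedback \<rho> (snd (Y b))) b (b + \<delta>2) Y1"
          using \<delta>2(2)[of b "Y b" "feedback \<rho> (snd (Y b))"] YR[of b] feedback_le_bound[of "Y b" "R + 1"]
            bT T b_less by fastforce
        define Z where "Z t = (if t \<le> b then Y t else Y1 t)" for t
        have ZY: "Z t = Y t" if "t \<le> b" for t using that by (simp add: Z_def)
        have evZ: "event Z a t \<longleftrightarrow> event Y a t" if "a < t" "t \<le> b" for t
          using that ZY by (intro event_cong) auto
        show thesis
        proof (rule that)
          show "T + \<delta> \<le> b + \<delta>" using bT by simp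
          show "continuous_on {0..b + \<delta>} Z"
            unfolding Z_def
          proof (rule continuous_on_cases_le)
            show "continuous_on {t \<in> {0..b + \<delta>}. t \<le> b} Y"
              by (rule continuous_on_subset[OF contY]) (use b_less in auto)
            show "continuous_on {t \<in> {0..b + \<delta>}. b \<le> t} Y1"
              by (rule continuous_on_subset[OF Y1(1)]) (use \<delta> in auto)
          qed (use Y1(2) in \<open>auto intro: continuous_intros\<close>)
          show "norm (Z t) \<le> R + 2" if "t \<in> {0..b + \<delta>}" for t
          proof (cases "t \<le> b")
            case True
            then show ?thesis using YR[of t] that b_less by (simp add: Z_def)
          next
            case False
            then show ?thesis using Y1(3)[of t] that \<delta> by (simp add: Z_def)
          qed
          show "Z t = Y t" if "t \<in> {0..b}" for t using that by (simp add: Z_def)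
          show "Inf (ereal ` {t. a < t \<and> t < b + \<delta> \<and> event Z a t}) = ereal b"
          proof (rule antisym)
            show "Inf (ereal ` {t. a < t \<and> t < b + \<delta> \<and> event Z a t}) \<le> ereal b"
              using True ab \<delta>(1) evZ[of b] by (intro Inf_lower) auto
            show "ereal b \<le> Inf (ereal ` {t. a < t \<and> t < b + \<delta> \<and> event Z a t})"
            proof (rule Inf_greatest, clarify)
              fix t assume t: "a < t" "t < b + \<delta>" "event Z a t"
              show "ereal b \<le> ereal t"
              proof (cases "t \<le> b")
                case True
                then have "t \<in> S" using t evZ[of t] b_less by (simp add: S_def)
                then show ?thesis using b_le by simp
              qed simp
            qed
          qed
          show "solves (feedback \<rho> (snd (Z b))) b (b + \<delta>) Z"
            unfolding ZY[OF order_refl]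
            by (rule solves_cong[OF _ solves_subinterval[OF Y1(4)]]) (use \<delta> in \<open>auto simp: Z_def\<close>)
        qed simp
      next
        case no: False
        \<comment> \<open>Events accumulate at \<open>b\<close> from the right. This forces a vanishing error on \<open>{a..b}\<close>, so
          resampling leaves the input unchanged and \<open>Y\<close> itself must be kept beyond \<open>b\<close>.\<close>
        let ?s = "sup_norm (sampling_error \<rho> (\<lambda>t. snd (Y t)) a) a b"
        have "continuous_on {a..T + \<delta>} Y" by (rule continuous_on_subset[OF contY]) (use n in auto)
        then have "1 \<le> 4 * (b - a) * m ?s"
          using ab b_less False by (intro event_threshold_at_Inf[OF _ _ _ S_def]) (auto simp: b_def)
        moreover have Yb: "continuous_on {a..b} (\<lambda>t. snd (Y t))"
          by (intro continuous_intros continuous_on_subset[OF contY]) (use n b_less in auto)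
        ultimately have "?s = 0" using no event_iff[of a b "\<lambda>t. snd (Y t)"] ab by auto
        then have "feedback \<rho> (snd (Y b)) = ?u"
          using sup_error_bounds(2)[OF _ Yb, of b] ab by (simp add: sampling_error_def Ya)
        then have "solves (feedback \<rho> (snd (Y b))) b (T + \<delta>) Y"
          using solves_subinterval[OF solY, of b "T + \<delta>"] ab by simp
        then show thesis
          using that[of "T + \<delta>" Y] bT contY YR Inf_S unfolding S_def by force
      qed
      have bT': "b < T'" using b_less Z(1) by simp
      have ZX: "X t = Z t" if "0 \<le> t" "t < T" for t using Z(5)[of t] YX[of t] that bT by simp
      have Za: "Z a = X a" using ZX n by simp
      have "traj (ereal T') (instants (ereal T') Z) Z"
      proof (rule traj_append[OF tr n(1,4) _ ZX _ Z(6)])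
        show "T \<le> T'" using Z(1) \<delta> by simp
        show "continuous_on {0..<T'} Z" by (rule continuous_on_subset[OF Z(3)]) auto
        have "solves ?u a b Y" by (rule solves_subinterval[OF solY]) (use b_less in auto)
        then have "solves ?u a b Z" by (rule solves_cong[rotated]) (use Z(5) n in auto)
        then show "(Z has_vector_derivative field (feedback \<rho> (snd (Z a))) t (Z t)) (at t)"
          if "a < t" "ereal t < ereal b" "isCont d t" for t
          using that unfolding solves_def Za by auto
        show "\<not> event Z c t" if "ereal b = ereal c" "c < t" "t < T'" for c t
        proof (rule no_event_before_dwell[where R = "R + 2"])
          show "continuous_on {c..t} Z" by (rule continuous_on_subset[OF Z(3)]) (use that bT T in auto)
          show "t < c + dwell (R + 2)" using that Z(2) \<delta>(4) by simp
          show "norm (Z r) \<le> R + 2" if "r \<in> {c..t}" for r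
            using that \<open>t < T'\<close> \<open>ereal b = ereal c\<close> bT T by (intro Z(4)) auto
        qed (use that in simp)
        show "(Z has_vector_derivative field (feedback \<rho> (snd (Z c))) t (Z t)) (at t)"
          if "ereal b = ereal c" "c < t" "t < T'" "isCont d t" for c t
          using Z(7) that unfolding solves_def by auto
      qed auto
      then show ?thesis using ZX Z(1) by blast
    qed
  qed
qed

text \<open>Extension leaves the initial state unchanged, so the same \<open>\<delta>\<close>
  applies at every stage and the horizons grow at least linearly. The limit curve has the right
  instants because each stage sees exactly those of its instants that precede the stage's
  horizon.\<close>

lemma traj_extend_to_infinity:
  assumes tr: "traj (ereal T) ts X"
  shows "\<exists>ts' Y. traj \<infinity> ts' Y \<and> (\<forall>t. 0 \<le> t \<and> t < T \<longrightarrow> Y t = X t)"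
proof -
  define w where "w = W (X 0)"
  obtain \<delta> where \<delta>: "0 < \<delta>" "\<And>T ts X. traj (ereal T) ts X \<Longrightarrow> W (X 0) \<le> w \<Longrightarrow>
      \<exists>T' ts' Y. T + \<delta> \<le> T' \<and> traj (ereal T') ts' Y \<and> (\<forall>t. 0 \<le> t \<and> t < T \<longrightarrow> X t = Y t)"
    by (rule traj_extend_step[where w = w]) (rule that)
  define P where "P n p \<longleftrightarrow> (\<exists>ts. traj (ereal (fst p)) ts (snd p)) \<and> W (snd p 0) \<le> w \<and> (n = 0 \<longrightarrow> p = (T, X))"
    for n :: nat and p
  define Q where "Q p p' \<longleftrightarrow> fst p + \<delta> \<le> fst p' \<and> (\<forall>t. 0 \<le> t \<and> t < fst p \<longrightarrow> snd p t = snd p' t)"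
    for p p' :: "real \<times> (real \<Rightarrow> (real ^ 'p) \<times> real)"
  have "\<exists>F. \<forall>n. P n (F n) \<and> Q (F n) (F (Suc n))"
  proof (rule dependent_nat_choice)
    show "\<exists>p. P 0 p" using tr by (auto simp: P_def w_def)
    fix p n assume "P n p"
    then obtain ts where p: "traj (ereal (fst p)) ts (snd p)" "W (snd p 0) \<le> w" by (auto simp: P_def)
    from \<delta>(2)[OF this] obtain T' ts' Y where Y: "fst p + \<delta> \<le> T'" "traj (ereal T') ts' Y"
      "\<forall>t. 0 \<le> t \<and> t < fst p \<longrightarrow> snd p t = Y t" by blast
    have "0 < fst p" using traj_facts(2)[OF p(1)] by simp
    then have "snd p 0 = Y 0" using Y(3) by simp
    then have "P (Suc n) (T', Y) \<and> Q p (T', Y)" using Y p(2) by (auto simp: P_def Q_def)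
    then show "\<exists>p'. P (Suc n) p' \<and> Q p p'" by blast
  qed
  then obtain F where F: "\<And>n. P n (F n)" "\<And>n. Q (F n) (F (Suc n))" by blast
  define Tn where "Tn n = fst (F n)" for n
  define Xn where "Xn n = snd (F n)" for n
  have F0: "Tn 0 = T" "Xn 0 = X" using F(1)[of 0] by (auto simp: P_def Tn_def Xn_def)
  have trn: "\<exists>ts. traj (ereal (Tn n)) ts (Xn n)" for n using F(1)[of n] by (simp add: P_def Tn_def Xn_def)
  have Tpos: "0 < Tn n" for n using trn[of n] traj_facts(2) by (metis ereal_less(2))
  have Tn_Suc: "Tn n + \<delta> \<le> Tn (Suc n)"
    and Xn_Suc: "0 \<le> t \<Longrightarrow> t < Tn n \<Longrightarrow> Xn n t = Xn (Suc n) t" for n t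
    using F(2)[of n] by (auto simp: Q_def Tn_def Xn_def)
  have mono: "Tn n \<le> Tn n'" if "n \<le> n'" for n n'
  proof (rule lift_Suc_mono_le[OF _ that])
    show "Tn i \<le> Tn (Suc i)" for i using Tn_Suc[of i] \<delta>(1) by linarith
  qed
  have agree: "Xn n t = Xn n' t" if "0 \<le> t" "t < Tn n" "n \<le> n'" for n n' t
    using that(3)
  proof (induction n' rule: dec_induct)
    case (step n')
    then show ?case using mono[of n n'] that(1,2) Xn_Suc[of t n'] by simp
  qed simp
  have unb: "real n * \<delta> < Tn n" for n
  proof (induction n)
    case (Suc n)
    then show ?case using Tn_Suc[of n] by (simp add: algebra_simps)
  qed (use Tpos in simp)
  \<comment> \<open>Stage \<open>n\<close> reaches beyond \<open>n * \<delta>\<close>, so stage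
    \<open>N t\<close> has \<open>t\<close> inside its horizon.\<close>
  define N where "N t = nat \<lceil>t / \<delta>\<rceil>" for t
  have N: "t < Tn (N t)" for t
  proof -
    have "t / \<delta> \<le> real (N t)" unfolding N_def by linarith
    then have "t \<le> real (N t) * \<delta>" using \<delta>(1) by (simp add: field_simps)
    then show ?thesis using unb[of "N t"] by simp
  qed
  define Y where "Y t = Xn (N t) t" for t
  have Y: "Xn n t = Y t" if "0 \<le> t" "t < Tn n" for n t
  proof (cases "n \<le> N t")
    case True
    show ?thesis unfolding Y_def by (rule agree[OF that True])
  next
    case False
    then show ?thesis unfolding Y_def using agree[OF that(1) N[of t], of n] by simp
  qed
  let ?I = "instants \<infinity> Y"
  have I: "ts i = (if ?I i < ereal (Tn n) then ?I i else \<infinity>)" if "traj (ereal (Tn n)) ts (Xn n)" for ts n i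
    unfolding traj_eq_instants[OF that]
  proof (rule instants_restrict)
    show "0 < ereal (Tn n)" using Tpos by simp
    show "Xn n t = Y t" if "0 \<le> t" "ereal t < ereal (Tn n)" for t using that by (intro Y) auto
  qed simp
  have "traj \<infinity> ?I Y"
  proof (rule trajI)
    have "continuous (at t within {0..}) Y" if t: "0 \<le> t" for t
    proof -
      obtain ts where tr: "traj (ereal (Tn (N t))) ts (Xn (N t))" using trn by blast
      have "continuous_on {0..<Tn (N t)} (Xn (N t))"
        by (rule continuous_on_subset[OF traj_facts(3)[OF tr]]) auto
      then have "continuous_on {0..<Tn (N t)} Y" by (rule continuous_on_eq) (use Y in auto)
      then have "continuous (at t within {0..<Tn (N t)}) Y" using t N by (simp add: continuous_on_eq_continuous_within)
      moreover have "at t within {0..} = at t within {0..<Tn (N t)}"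
        by (rule at_within_nhd[of t "{..<Tn (N t)}"]) (use t N in auto)
      ultimately show ?thesis by (simp add: continuous_within)
    qed
    then show "continuous_on {t. 0 \<le> t \<and> ereal t < \<infinity>} Y"
      by (simp add: continuous_on_eq_continuous_within atLeast_def)
  next
    fix t :: real assume t: "0 \<le> t"
    obtain ts where tr: "traj (ereal (Tn (N t))) ts (Xn (N t))" using trn by blast
    obtain i where i: "ts i \<le> ereal t" "ereal t < ts (Suc i)" using traj_covered[OF tr t] N by auto
    have "?I i \<le> ereal t" using i(1) I[OF tr, of i] by (cases "?I i < ereal (Tn (N t))") auto
    moreover have "ereal t < ?I (Suc i)"
    proof (cases "?I (Suc i) < ereal (Tn (N t))")
      case True
      then show ?thesis using i(2) I[OF tr, of "Suc i"] by (simp del: instants.simps)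
    next
      case False
      have "ereal t < ereal (Tn (N t))" using N by simp
      then show ?thesis using False by (meson less_le_trans not_le)
    qed
    ultimately show "\<exists>i. ?I i \<le> ereal t \<and> ereal t < ?I (Suc i)" by blast
  next
    fix i a t assume i: "?I i = ereal a" "0 \<le> a" "a < t" "ereal t < ?I (Suc i)" "isCont d t"
    obtain ts where tr: "traj (ereal (Tn (N t))) ts (Xn (N t))" using trn by blast
    have aN: "a < Tn (N t)" using i(3) N[of t] by simp
    have tsi: "ts i = ereal a" using I[OF tr, of i] i(1) aN by simp
    have "ereal t < ts (Suc i)" using I[OF tr, of "Suc i"] i(4) by (simp del: instants.simps)
    then have "(Xn (N t) has_vector_derivative field (feedback \<rho> (snd (Xn (N t) a))) t (Xn (N t) t)) (at t)"
      using i N by (intro traj_ode[OF tr tsi]) auto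
    then have "(Xn (N t) has_vector_derivative field (feedback \<rho> (snd (Y a))) t (Y t)) (at t)"
      using Y[OF i(2) aN] Y[of t "N t"] N[of t] i(2,3) by simp
    then show "(Y has_vector_derivative field (feedback \<rho> (snd (Y a))) t (Y t)) (at t)"
      by (rule has_vector_derivative_transform_within_open[where S = "{0<..<Tn (N t)}"]) (use i N Y in auto)
  qed simp
  moreover have "\<forall>t. 0 \<le> t \<and> t < T \<longrightarrow> Y t = X t" using Y[of _ 0] F0 by simp
  ultimately show ?thesis by blast
qed

section \<open>Global asymptotic stability\<close>

lemma W_zero: "W 0 = 0"
  by (simp add: W_def V_zero)

text \<open>Each component is kept below \<open>\<epsilon> / 2\<close>; the value
  \<open>\<epsilon>\<^sup>2 / 8\<close> is \<open>x\<^sup>2 / 2\<close> at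
  \<open>x = \<epsilon> / 2\<close>.\<close>

lemma norm_less_if_W_small:
  assumes "0 < \<epsilon>" "W X < min (\<alpha> (\<epsilon> / 2)) (\<epsilon>\<^sup>2 / 8)"
  shows "norm X < \<epsilon>"
proof -
  have "norm (fst X) < \<epsilon> / 2"
  proof (rule ccontr)
    assume "\<not> norm (fst X) < \<epsilon> / 2"
    then have "\<alpha> (\<epsilon> / 2) \<le> \<alpha> (norm (fst X))"
      using assms(1) by (intro class_K_infinity_mono[OF K_alpha]) auto
    then show False using W_ge(1)[of X] assms(2) by simp
  qed
  moreover have "\<bar>snd X\<bar> < \<epsilon> / 2"
  proof (rule power2_less_imp_less)
    show "\<bar>snd X\<bar>\<^sup>2 < (\<epsilon> / 2)\<^sup>2" using W_ge(2)[of X] assms(2) by (simp add: power_divide)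
  qed (use assms in simp)
  ultimately show ?thesis using norm_Pair_le[of "fst X" "snd X"] by simp
qed

text \<open>Whenever the norm reaches \<open>\<epsilon>\<close>, the Lipschitz bound keeps it above
  \<open>\<epsilon> / 2\<close> for the time \<open>\<epsilon> / (2 * M)\<close>, which adds the
  fixed amount \<open>\<eta>\<close> to \<open>J\<close>. Infinitely many such times would make the
  bounded \<open>J\<close> unbounded.\<close>

lemma traj_tendsto_zero:
  assumes tr: "traj \<infinity> ts X"
  shows "(X \<longlongrightarrow> 0) at_top"
proof -
  obtain R where R: "\<And>Y. W Y \<le> W (X 0) \<Longrightarrow> norm Y \<le> R" using W_proper by blast
  have XR: "norm (X t) \<le> R" if "0 \<le> t" for t using traj_W_le[OF tr that] R by simp
  obtain M where M: "0 < M" "\<And>X u t. 0 \<le> t \<Longrightarrow> norm X \<le> R \<Longrightarrow> \<bar>u\<bar> \<le> bound R \<Longrightarrow> norm (field u t X) \<le> M"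
    by (rule field_bounds[where R = R and c = "bound R"]) (rule that)
  have lip: "norm (X t - X s) \<le> M * (t - s)" if "0 \<le> s" "s \<le> t" for s t
    using that XR M by (intro traj_lipschitz[OF tr]) auto
  have cont: "continuous_on {a..b} (\<lambda>t. (norm (X t))\<^sup>2)" if "0 \<le> a" for a b
    using that by (intro continuous_intros traj_continuous_on[OF tr]) auto
  define J where "J t = integral {0..t} (\<lambda>t. (norm (X t))\<^sup>2)" for t
  have J_le: "J t \<le> W (X 0)" if "0 \<le> t" for t
    using traj_W_decrease[OF tr that] W_ge(3)[of "X t"] by (simp add: J_def)
  have J_add: "J t = J s + integral {s..t} (\<lambda>t. (norm (X t))\<^sup>2)" if "0 \<le> s" "s \<le> t" for s t
    unfolding J_def using that
    by (intro Henstock_Kurzweil_Integration.integral_combine[symmetric] integrable_continuous_real cont) auto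
  have J_mono: "J s \<le> J t" if "0 \<le> s" "s \<le> t" for s t
    using J_add[OF that] integral_nonneg[OF integrable_continuous_real[OF cont[OF that(1), of t]]] by simp
  show ?thesis
  proof (rule tendstoI)
    fix \<epsilon> :: real assume \<epsilon>: "0 < \<epsilon>"
    show "\<forall>\<^sub>F t in at_top. dist (X t) 0 < \<epsilon>"
    proof (rule ccontr)
      assume "\<not> ?thesis"
      then have often: "\<exists>t\<ge>b. \<epsilon> \<le> norm (X t)" for b
        unfolding eventually_at_top_linorder by (auto simp: not_less)
      define h where "h = \<epsilon> / (2 * M)"
      have h: "0 < h" using \<epsilon> M by (simp add: h_def)
      define \<eta> where "\<eta> = (\<epsilon> / 2)\<^sup>2 * h"
      have \<eta>: "0 < \<eta>" using \<epsilon> h by (simp add: \<eta>_def)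
      have gain: "J t + \<eta> \<le> J (t + h)" if t: "0 \<le> t" "\<epsilon> \<le> norm (X t)" for t
      proof -
        have "(\<epsilon> / 2)\<^sup>2 \<le> (norm (X r))\<^sup>2" if r: "r \<in> {t..t + h}" for r
        proof -
          have "norm (X r - X t) \<le> M * h"
            using lip[of t r] r t M(1) by (auto intro: order_trans mult_left_mono)
          also have "M * h = \<epsilon> / 2" using M by (simp add: h_def)
          finally have "\<epsilon> / 2 \<le> norm (X r)" using t(2) norm_triangle_ineq2[of "X t" "X r"] by (simp add: norm_minus_commute)
          then show ?thesis using \<epsilon> by (intro power_mono) auto
        qed
        then have "integral {t..t + h} (\<lambda>_. (\<epsilon> / 2)\<^sup>2) \<le> integral {t..t + h} (\<lambda>t. (norm (X t))\<^sup>2)"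
          using t by (intro integral_le integrable_continuous_real cont continuous_on_const) auto
        then show ?thesis using J_add[of t "t + h"] t h by (simp add: \<eta>_def mult.commute)
      qed
      have "\<exists>t\<ge>0. real i * \<eta> \<le> J t" for i
      proof (induction i)
        case 0
        then show ?case by (intro exI[of _ 0]) (simp add: J_def)
      next
        case (Suc i)
        then obtain t where t: "0 \<le> t" "real i * \<eta> \<le> J t" by blast
        obtain r where r: "t \<le> r" "\<epsilon> \<le> norm (X r)" using often by blast
        have "real (Suc i) * \<eta> \<le> J (r + h)"
          using t r gain[of r] J_mono[of t r] by (simp add: distrib_right)
        then show ?case using t(1) r(1) h by (intro exI[of _ "r + h"]) auto
      qed
      moreover obtain i where "W (X 0) < real i * \<eta>" using reals_Archimedean3[OF \<eta>] by blast
      ultimately show False using J_le by (meson leD le_less_trans)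
    qed
  qed
qed

theorem closed_loop_stable:
  "globally_asymptotically_stable (\<lambda>T X. \<exists>ts. traj T ts X)"
  unfolding globally_asymptotically_stable_def
proof (intro conjI allI impI)
  fix \<xi>
  obtain T ts X where X: "traj (ereal T) ts X" "X 0 = \<xi>" using traj_exists by blast
  moreover have "0 < T" using traj_facts(2)[OF X(1)] by simp
  ultimately show "\<exists>X. (\<exists>ts. traj \<infinity> ts X) \<and> X 0 = \<xi>"
    using traj_extend_to_infinity[OF X(1)] by (metis order_refl)
next
  fix T X assume "\<exists>ts. traj T ts X"
  then obtain ts where tr: "traj T ts X" by blast
  show "\<exists>Y. (\<exists>ts. traj \<infinity> ts Y) \<and> (\<forall>t. 0 \<le> t \<and> ereal t < T \<longrightarrow> Y t = X t)"
  proof (cases T)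
    case (real r)
    then show ?thesis using traj_extend_to_infinity[of r ts X] tr by (metis less_ereal.simps(1))
  next
    case PInf
    then show ?thesis using tr by blast
  next
    case MInf
    then show ?thesis using traj_facts(2)[OF tr] by simp
  qed
next
  fix \<epsilon> :: real assume \<epsilon>: "0 < \<epsilon>"
  define w where "w = min (\<alpha> (\<epsilon> / 2)) (\<epsilon>\<^sup>2 / 8)"
  have w: "0 < w" using \<epsilon> class_K_infinity_pos[OF K_alpha, of "\<epsilon> / 2"] by (simp add: w_def)
  have "continuous_on UNIV W" using continuous_on_W[of UNIV "\<lambda>X. X"] by (simp add: continuous_on_id)
  from continuous_on_iff[THEN iffD1, OF this, rule_format, OF UNIV_I w, of 0]
  obtain \<delta> where \<delta>: "0 < \<delta>" "\<And>X. dist X 0 < \<delta> \<Longrightarrow> dist (W X) (W 0) < w" by blast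
  have W_less: "W X < w" if "norm X < \<delta>" for X
    using \<delta>(2)[of X] that W_ge(3)[of X] by (simp add: W_zero dist_real_def)
  show "\<exists>\<delta>>0. \<forall>X. (\<exists>ts. traj \<infinity> ts X) \<and> norm (X 0) < \<delta> \<longrightarrow> (\<forall>t\<ge>0. norm (X t) < \<epsilon>)"
  proof (intro exI[of _ \<delta>] conjI allI impI)
    fix X t assume "(\<exists>ts. traj \<infinity> ts X) \<and> norm (X 0) < \<delta>" "0 \<le> (t :: real)"
    then have "W (X t) \<le> W (X 0)" "W (X 0) < w" using traj_W_le[of \<infinity> _ X t] W_less by auto
    then have "W (X t) < w" by (rule le_less_trans)
    then show "norm (X t) < \<epsilon>" unfolding w_def by (rule norm_less_if_W_small[OF \<epsilon>])
  qed (rule \<delta>)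
next
  fix X assume "\<exists>ts. traj \<infinity> ts X"
  then show "(X \<longlongrightarrow> 0) at_top" using traj_tendsto_zero by blast
qed

end

section \<open>Design of the feedback and of the triggering function\<close>

lemma Limsup_at_right_finite_bound:
  fixes h :: "real \<Rightarrow> real"
  assumes "Limsup (at_right 0) (\<lambda>s. ereal (h s)) < \<infinity>"
  obtains C e where "0 < e" "\<And>s. 0 < s \<Longrightarrow> s < e \<Longrightarrow> h s \<le> C"
proof -
  obtain n :: nat where "Limsup (at_right 0) (\<lambda>s. ereal (h s)) < ereal (real n)"
    using assms less_PInf_Ex_of_nat by auto
  then have "eventually (\<lambda>s. ereal (h s) < ereal (real n)) (at_right 0)" by (rule Limsup_lessD)
  then obtain e where "0 < e" "\<And>s. 0 < s \<Longrightarrow> s < e \<Longrightarrow> h s < real n"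
    unfolding eventually_at_right_field by auto
  then show thesis using that[of e "real n"] by (meson less_imp_le)
qed

text \<open>The limit superior bounds the quotient below some \<open>e\<close>, monotonicity of
  \<open>\<alpha>\<close> bounds it from \<open>e\<close> on, and at 0 it vanishes by the convention
  for division by zero.\<close>

lemma square_over_K_bounded:
  assumes "class_K_infinity \<alpha>" "Limsup (at_right 0) (\<lambda>s. ereal (s\<^sup>2 / \<alpha> s)) < \<infinity>"
  obtains B where "0 \<le> B" "\<And>s. 0 \<le> s \<Longrightarrow> s \<le> N \<Longrightarrow> s\<^sup>2 / \<alpha> s \<le> B"
proof -
  obtain C e where e: "0 < e" "\<And>s. 0 < s \<Longrightarrow> s < e \<Longrightarrow> s\<^sup>2 / \<alpha> s \<le> C"
    by (rule Limsup_at_right_finite_bound[OF assms(2)]) (rule that)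
  show thesis
  proof
    show "0 \<le> max 0 (max C (N\<^sup>2 / \<alpha> e))" by simp
    show "s\<^sup>2 / \<alpha> s \<le> max 0 (max C (N\<^sup>2 / \<alpha> e))" if s: "0 \<le> s" "s \<le> N" for s
    proof -
      consider "s = 0" | "0 < s" "s < e" | "e \<le> s" using s by linarith
      then show ?thesis
      proof cases
        case 3
        then have "s\<^sup>2 / \<alpha> s \<le> N\<^sup>2 / \<alpha> e"
          using s e(1) class_K_infinity_pos[OF assms(1)] class_K_infinity_mono[OF assms(1), of e s]
          by (intro frac_le power_mono) auto
        then show ?thesis by simp
      qed (use e(2)[of s] in auto)
    qed
  qed
qed

lemma K_over_square_bounded:
  assumes "class_K_infinity \<sigma>" "Limsup (at_right 0) (\<lambda>s. ereal (\<sigma> s / s\<^sup>2)) < \<infinity>"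
  obtains B where "0 \<le> B" "\<And>s. 0 \<le> s \<Longrightarrow> s \<le> N \<Longrightarrow> \<sigma> s / s\<^sup>2 \<le> B"
proof -
  obtain C e where e: "0 < e" "\<And>s. 0 < s \<Longrightarrow> s < e \<Longrightarrow> \<sigma> s / s\<^sup>2 \<le> C"
    by (rule Limsup_at_right_finite_bound[OF assms(2)]) (rule that)
  show thesis
  proof
    show "0 \<le> max 0 (max C (\<sigma> N / e\<^sup>2))" by simp
    show "\<sigma> s / s\<^sup>2 \<le> max 0 (max C (\<sigma> N / e\<^sup>2))" if s: "0 \<le> s" "s \<le> N" for s
    proof -
      consider "s = 0" | "0 < s" "s < e" | "e \<le> s" using s by linarith
      then show ?thesis
      proof cases
        case 3
        then have "\<sigma> s / s\<^sup>2 \<le> \<sigma> N / e\<^sup>2"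
          using s e(1) class_K_infinity_nonneg[OF assms(1)] class_K_infinity_mono[OF assms(1), of s N]
          by (intro frac_le power_mono) auto
        then show ?thesis by simp
      qed (use e(2)[of s] in auto)
    qed
  qed
qed

text \<open>As \<open>f\<close> vanishes at the origin and is Lipschitz on bounded sets, its
  quotient by \<open>norm z + \<bar>x\<bar>\<close> is locally bounded. The majorant is a function
  of the larger of the two norms, and twice that norm bounds their sum; distinguishing which one is
  larger separates \<open>z\<close> from \<open>x\<close>.\<close>

lemma vector_field_majorant:
  fixes f :: "'a::euclidean_space \<Rightarrow> real \<Rightarrow> 'b::euclidean_space \<Rightarrow> real"
  assumes "compact D" "C1 (\<lambda>(z, x, d). f z x d)" and f0: "\<And>d. d \<in> D \<Longrightarrow> f 0 0 d = 0"
  obtains \<phi> where "even_series \<phi>"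
    "\<And>z x d. d \<in> D \<Longrightarrow> \<bar>f z x d\<bar> \<le> 2 * norm z * \<phi> (norm z) + 2 * \<bar>x\<bar> * \<phi> x"
proof -
  let ?r = "\<lambda>(z :: 'a, x :: real, d :: 'b). max (norm z) \<bar>x\<bar>"
  let ?g = "\<lambda>(z, x, d). \<bar>f z x d\<bar> / (norm z + \<bar>x\<bar>)"
  obtain \<phi> where \<phi>: "even_series \<phi>" "\<And>i. i \<in> {(z, x, d). d \<in> D} \<Longrightarrow> 0 \<le> ?r i \<Longrightarrow> ?g i \<le> \<phi> (?r i)"
  proof (rule even_series_majorant[where S = "{(z, x, d). d \<in> D}" and r = ?r and g = ?g])
    fix N :: real
    obtain B where B: "0 \<le> B" "\<And>X Y d. d \<in> D \<Longrightarrow> norm X \<le> 2 * N \<Longrightarrow> norm Y \<le> 2 * N \<Longrightarrow>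
        norm (f (fst X) (snd X) d - f (fst Y) (snd Y) d) \<le> B * norm (X - Y)"
      by (rule C1_uniform_bounds[OF assms(2,1), where R = "2 * N"]) (simp only: prod.case)
    have "\<bar>f z x d\<bar> / (norm z + \<bar>x\<bar>) \<le> B" if d: "d \<in> D" and "norm z \<le> N" "\<bar>x\<bar> \<le> N" for z x d
    proof -
      have n: "norm (z, x) \<le> norm z + \<bar>x\<bar>" using norm_Pair_le[of z x] by simp
      have "0 \<le> N" using that(2) norm_ge_zero order_trans by blast
      then have "\<bar>f z x d\<bar> \<le> B * norm (z, x)"
        using B(2)[OF d, of "(z, x)" 0] n that f0[OF d] by simp
      also have "\<dots> \<le> B * (norm z + \<bar>x\<bar>)" using n B(1) by (intro mult_left_mono)
      finally have "\<bar>f z x d\<bar> \<le> B * (norm z + \<bar>x\<bar>)" .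
      moreover have "norm z + \<bar>x\<bar> = 0 \<or> 0 < norm z + \<bar>x\<bar>"
        using norm_ge_zero[of z] abs_ge_zero[of x] by linarith
      ultimately show ?thesis using B(1) by (elim disjE) (simp_all add: pos_divide_le_eq)
    qed
    then show "\<exists>B. \<forall>i\<in>{(z, x, d). d \<in> D}. ?r i \<le> N \<longrightarrow> ?g i \<le> B" by auto
  qed (rule that)
  have "\<bar>f z x d\<bar> \<le> 2 * norm z * \<phi> (norm z) + 2 * \<bar>x\<bar> * \<phi> x" if d: "d \<in> D" for z x d
  proof (cases "z = 0 \<and> x = 0")
    case True
    then show ?thesis using f0[OF d] by simp
  next
    case False
    have nonneg: "0 \<le> \<phi> s" for s by (rule even_series_nonneg[OF \<phi>(1)])
    have pos: "0 < norm z + \<bar>x\<bar>" using False by (auto simp: add_pos_nonneg add_nonneg_pos)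
    have le: "\<bar>f z x d\<bar> \<le> \<phi> (max (norm z) \<bar>x\<bar>) * (norm z + \<bar>x\<bar>)"
      using \<phi>(2)[of "(z, x, d)"] d pos by (simp add: pos_divide_le_eq)
    show ?thesis
    proof (cases "\<bar>x\<bar> \<le> norm z")
      case True
      have "\<phi> (norm z) * (norm z + \<bar>x\<bar>) \<le> \<phi> (norm z) * (2 * norm z)"
        using True nonneg by (intro mult_left_mono) auto
      moreover have "0 \<le> 2 * \<bar>x\<bar> * \<phi> x" using nonneg by simp
      ultimately show ?thesis using le True by (simp add: max_def mult_ac)
    next
      case False
      have "\<phi> x * (norm z + \<bar>x\<bar>) \<le> \<phi> x * (2 * \<bar>x\<bar>)"
        using False nonneg by (intro mult_left_mono) auto
      moreover have "0 \<le> 2 * norm z * \<phi> (norm z)" using nonneg by simp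
      ultimately show ?thesis using le False even_series_abs[OF \<phi>(1), of x] by (simp add: max_def mult_ac)
    qed
  qed
  then show thesis using that \<phi>(1) by blast
qed

lemma triggering_majorant:
  assumes "even_series k" "even_series \<phi>"
  obtains m where "even_series m" "\<And>s. 1 \<le> m s" "\<And>s. k (5 * s) * (10 * \<phi> (5 * s) + 4) \<le> m s"
    "\<And>s. 2 * (k (5 * s))\<^sup>2 \<le> m s"
proof -
  let ?g = "\<lambda>s. 1 + k (5 * s) * (10 * \<phi> (5 * s) + 4) + 2 * (k (5 * s))\<^sup>2"
  have nonneg: "0 \<le> k s" "0 \<le> \<phi> s" for s by (rule even_series_nonneg, rule assms)+
  obtain m where m: "even_series m" "\<And>s. s \<in> UNIV \<Longrightarrow> 0 \<le> \<bar>s\<bar> \<Longrightarrow> ?g s \<le> m \<bar>s\<bar>"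
  proof (rule even_series_majorant[where S = UNIV and r = abs and g = ?g])
    fix N :: real
    have "?g s \<le> ?g N" if "\<bar>s\<bar> \<le> N" for s
    proof -
      have "k (5 * s) \<le> k (5 * N)" "\<phi> (5 * s) \<le> \<phi> (5 * N)"
        by (rule even_series_mono[OF assms(1)] even_series_mono[OF assms(2)], use that in simp)+
      then have "k (5 * s) * (10 * \<phi> (5 * s) + 4) \<le> k (5 * N) * (10 * \<phi> (5 * N) + 4)"
        "(k (5 * s))\<^sup>2 \<le> (k (5 * N))\<^sup>2"
        using nonneg by (intro mult_mono power_mono; simp)+
      then show ?thesis by linarith
    qed
    then show "\<exists>B. \<forall>s\<in>UNIV. \<bar>s\<bar> \<le> N \<longrightarrow> ?g s \<le> B" by blast
  qed (rule that)
  have "?g s \<le> m s" for s using m(2)[of s] even_series_abs[OF m(1), of s] by simp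
  moreover have "0 \<le> k (5 * s) * (10 * \<phi> (5 * s) + 4)" "0 \<le> (k (5 * s))\<^sup>2" for s
    using nonneg by auto
  ultimately have "1 \<le> m s \<and> k (5 * s) * (10 * \<phi> (5 * s) + 4) \<le> m s \<and> 2 * (k (5 * s))\<^sup>2 \<le> m s" for s
    by (smt (verit))
  then show thesis using that m(1) by blast
qed

text \<open>The scaling factor must be a function of \<open>V z\<close> for the chain rule to apply;
  \<open>norm z\<close> is bounded on sublevel sets of \<open>V\<close>. Half of the scaled
  dissipation yields three copies of the squared growth in \<open>z\<close>, one for Young's
  inequality with \<open>x\<close> and two to remain, and one copy of the squared norm.\<close>

lemma storage_majorant:
  fixes V :: "'a::real_normed_vector \<Rightarrow> real"
  assumes "class_K_infinity \<alpha>\<^sub>l" "class_K_infinity \<alpha>" and V: "\<And>z. \<alpha>\<^sub>l (norm z) \<le> V z"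
    and lim: "Limsup (at_right 0) (\<lambda>s. ereal (s\<^sup>2 / \<alpha> s)) < \<infinity>" and "even_series \<phi>"
  obtains \<psi> where "even_series \<psi>" "\<And>z. 1 \<le> \<psi> (V z)"
    "\<And>z. (3 * (\<phi> (norm z))\<^sup>2 + 1) * (norm z)\<^sup>2 \<le> \<psi> (V z) * \<alpha> (norm z) / 2"
proof -
  have V0: "0 \<le> V z" for z using V[of z] class_K_infinity_nonneg[OF assms(1), of "norm z"] by simp
  let ?g = "\<lambda>z. 1 + 2 * (3 * (\<phi> (norm z))\<^sup>2 + 1) * ((norm z)\<^sup>2 / \<alpha> (norm z))"
  obtain \<psi> where \<psi>: "even_series \<psi>" "\<And>z. z \<in> UNIV \<Longrightarrow> 0 \<le> V z \<Longrightarrow> ?g z \<le> \<psi> (V z)"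
  proof (rule even_series_majorant[where S = UNIV and r = V and g = ?g])
    fix N :: real
    obtain R where R: "0 \<le> R" "\<And>r. \<alpha>\<^sub>l r \<le> N \<Longrightarrow> r \<le> R" by (rule class_K_infinity_proper[OF assms(1)]) (rule that)
    obtain B where B: "0 \<le> B" "\<And>s. 0 \<le> s \<Longrightarrow> s \<le> R \<Longrightarrow> s\<^sup>2 / \<alpha> s \<le> B"
      by (rule square_over_K_bounded[OF assms(2) lim]) (rule that)
    have "?g z \<le> 1 + 2 * (3 * (\<phi> R)\<^sup>2 + 1) * B" if "V z \<le> N" for z
    proof -
      have z: "norm z \<le> R" using R(2) V[of z] that order_trans by blast
      then have "\<phi> (norm z) \<le> \<phi> R" by (intro even_series_mono[OF assms(5)]) auto
      then show ?thesis using B(2)[OF norm_ge_zero z] even_series_nonneg[OF assms(5)]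
          class_K_infinity_nonneg[OF assms(2), of "norm z"]
        by (intro add_mono mult_mono power_mono order_refl) auto
    qed
    then show "\<exists>B. \<forall>z\<in>UNIV. V z \<le> N \<longrightarrow> ?g z \<le> B" by blast
  qed (rule that)
  have g: "?g z \<le> \<psi> (V z)" for z using \<psi>(2) V0 by blast
  have \<alpha>0: "0 \<le> \<alpha> (norm z)" for z :: 'a by (rule class_K_infinity_nonneg[OF assms(2)]) simp
  have "1 \<le> \<psi> (V z)" for z
  proof -
    have "0 \<le> 2 * (3 * (\<phi> (norm z))\<^sup>2 + 1) * ((norm z)\<^sup>2 / \<alpha> (norm z))" using \<alpha>0 by simp
    then show ?thesis using g[of z] by linarith
  qed
  moreover have "(3 * (\<phi> (norm z))\<^sup>2 + 1) * (norm z)\<^sup>2 \<le> \<psi> (V z) * \<alpha> (norm z) / 2" for z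
  proof (cases "z = 0")
    case True
    then show ?thesis using \<alpha>0[of z] even_series_nonneg[OF \<psi>(1)] by simp
  next
    case False
    then have pos: "0 < \<alpha> (norm z)" using class_K_infinity_pos[OF assms(2)] by simp
    have "2 * (3 * (\<phi> (norm z))\<^sup>2 + 1) * ((norm z)\<^sup>2 / \<alpha> (norm z)) \<le> \<psi> (V z)" using g[of z] by simp
    then have "2 * (3 * (\<phi> (norm z))\<^sup>2 + 1) * ((norm z)\<^sup>2 / \<alpha> (norm z)) * \<alpha> (norm z) \<le> \<psi> (V z) * \<alpha> (norm z)"
      using pos by (intro mult_right_mono) auto
    then show ?thesis using pos by (simp add: algebra_simps)
  qed
  ultimately show thesis using that \<psi>(1) by blast
qed

text \<open>The term \<open>l (V z) * \<sigma> \<bar>x\<bar>\<close> has to be absorbed by a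
  function of \<open>x\<close> alone. This is possible where
  \<open>\<alpha> (norm z) \<le> 2 * \<sigma> \<bar>x\<bar>\<close>, since \<open>z\<close> is
  bounded in terms of \<open>x\<close> there; elsewhere half of the dissipation in \<open>z\<close>
  outweighs \<open>\<sigma>\<close>. In \<open>2 * \<phi> x + 3\<close>, the first summand and one
  unit come from \<open>x * f\<close>, and two units remain as dissipation.\<close>

lemma gain_majorant:
  fixes V :: "'a::real_normed_vector \<Rightarrow> real"
  assumes "class_K_infinity \<alpha>\<^sub>u" "class_K_infinity \<alpha>" "class_K_infinity \<sigma>"
    and V: "\<And>z. V z \<le> \<alpha>\<^sub>u (norm z)" "\<And>z. 0 \<le> V z"
    and lim: "Limsup (at_right 0) (\<lambda>s. ereal (\<sigma> s / s\<^sup>2)) < \<infinity>"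
    and series: "even_series \<phi>" "even_series l"
  obtains \<rho> where "even_series \<rho>" "\<And>x. 1 \<le> \<rho> x" "\<And>x. 2 * (2 * \<phi> x + 3) \<le> \<rho> x"
    "\<And>z x. \<alpha> (norm z) \<le> 2 * \<sigma> \<bar>x\<bar> \<Longrightarrow> l (V z) * \<sigma> \<bar>x\<bar> + (2 * \<phi> x + 3) * x\<^sup>2 \<le> \<rho> x * x\<^sup>2 / 2"
proof -
  let ?S = "{(z :: 'a, x :: real). \<alpha> (norm z) \<le> 2 * \<sigma> \<bar>x\<bar>}"
  let ?g = "\<lambda>(z, x). 2 * (l (V z) * (\<sigma> \<bar>x\<bar> / \<bar>x\<bar>\<^sup>2) + (2 * \<phi> x + 3))"
  have nonneg: "0 \<le> \<phi> s" "0 \<le> l s" for s by (rule even_series_nonneg, rule series)+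
  have \<sigma>0: "0 \<le> \<sigma> \<bar>x\<bar>" for x by (rule class_K_infinity_nonneg[OF assms(3)]) simp
  obtain \<rho> where \<rho>: "even_series \<rho>" "\<And>i. i \<in> ?S \<Longrightarrow> 0 \<le> \<bar>snd i\<bar> \<Longrightarrow> ?g i \<le> \<rho> \<bar>snd i\<bar>"
  proof (rule even_series_majorant[where S = ?S and r = "\<lambda>i. \<bar>snd i\<bar>" and g = ?g])
    fix N :: real
    obtain R where R: "0 \<le> R" "\<And>r. \<alpha> r \<le> 2 * \<sigma> N \<Longrightarrow> r \<le> R" by (rule class_K_infinity_proper[OF assms(2)]) (rule that)
    obtain B where B: "0 \<le> B" "\<And>s. 0 \<le> s \<Longrightarrow> s \<le> N \<Longrightarrow> \<sigma> s / s\<^sup>2 \<le> B"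
      by (rule K_over_square_bounded[OF assms(3) lim]) (rule that)
    have "?g (z, x) \<le> 2 * (l (\<alpha>\<^sub>u R) * B + (2 * \<phi> N + 3))" if zx: "\<alpha> (norm z) \<le> 2 * \<sigma> \<bar>x\<bar>" and x: "\<bar>x\<bar> \<le> N" for z x
    proof -
      have "\<sigma> \<bar>x\<bar> \<le> \<sigma> N" using x by (intro class_K_infinity_mono[OF assms(3)]) auto
      then have "norm z \<le> R" using R(2)[of "norm z"] zx by simp
      then have "V z \<le> \<alpha>\<^sub>u R" using V(1)[of z] class_K_infinity_mono[OF assms(1), of "norm z" R] by simp
      then have "l (V z) \<le> l (\<alpha>\<^sub>u R)" using V(2)[of z] by (intro even_series_mono[OF series(2)]) auto
      moreover have "\<phi> x \<le> \<phi> N" using x by (intro even_series_mono[OF series(1)]) auto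
      moreover have "\<sigma> \<bar>x\<bar> / \<bar>x\<bar>\<^sup>2 \<le> B" using x by (intro B(2)) auto
      ultimately show ?thesis using nonneg \<sigma>0[of x] unfolding prod.case
        by (intro mult_left_mono add_mono mult_mono order_refl divide_nonneg_nonneg zero_le_power2) auto
    qed
    then show "\<exists>B. \<forall>i\<in>?S. \<bar>snd i\<bar> \<le> N \<longrightarrow> ?g i \<le> B"
      by (intro exI[of _ "2 * (l (\<alpha>\<^sub>u R) * B + (2 * \<phi> N + 3))"]) auto
  qed (rule that)
  have g: "2 * (l (V z) * (\<sigma> \<bar>x\<bar> / \<bar>x\<bar>\<^sup>2) + (2 * \<phi> x + 3)) \<le> \<rho> x" if "\<alpha> (norm z) \<le> 2 * \<sigma> \<bar>x\<bar>" for z x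
    using \<rho>(2)[of "(z, x)"] that even_series_abs[OF \<rho>(1), of x] by simp
  \<comment> \<open>\<open>z = 0\<close> satisfies the constraint for every \<open>x\<close>, so
    \<open>g\<close> yields a bound free of \<open>z\<close>.\<close>
  have base: "2 * (2 * \<phi> x + 3) \<le> \<rho> x" for x
  proof -
    have "\<alpha> (norm (0 :: 'a)) \<le> 2 * \<sigma> \<bar>x\<bar>" using \<sigma>0[of x] assms(2) by (simp add: class_K_infinity_def)
    moreover have "0 \<le> l (V 0) * (\<sigma> \<bar>x\<bar> / \<bar>x\<bar>\<^sup>2)" using nonneg \<sigma>0 by simp
    ultimately show ?thesis using g[of 0 x] by simp
  qed
  moreover have "1 \<le> \<rho> x" for x using base[of x] nonneg(1)[of x] by simp
  moreover have "l (V z) * \<sigma> \<bar>x\<bar> + (2 * \<phi> x + 3) * x\<^sup>2 \<le> \<rho> x * x\<^sup>2 / 2" if zx: "\<alpha> (norm z) \<le> 2 * \<sigma> \<bar>x\<bar>" for z x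
  proof (cases "x = 0")
    case True
    then show ?thesis using assms(3) by (simp add: class_K_infinity_def)
  next
    case False
    have "2 * (l (V z) * (\<sigma> \<bar>x\<bar> / \<bar>x\<bar>\<^sup>2) + (2 * \<phi> x + 3)) * x\<^sup>2 \<le> \<rho> x * x\<^sup>2"
      by (intro mult_right_mono g zx) simp
    also have "2 * (l (V z) * (\<sigma> \<bar>x\<bar> / \<bar>x\<bar>\<^sup>2) + (2 * \<phi> x + 3)) * x\<^sup>2
        = 2 * (l (V z) * (\<sigma> \<bar>x\<bar> / \<bar>x\<bar>\<^sup>2 * x\<^sup>2) + (2 * \<phi> x + 3) * x\<^sup>2)"
      by (simp only: distrib_right distrib_left mult.assoc)
    also have "\<sigma> \<bar>x\<bar> / \<bar>x\<bar>\<^sup>2 * x\<^sup>2 = \<sigma> \<bar>x\<bar>" using False by simp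
    finally show ?thesis by simp
  qed
  ultimately show thesis using that \<rho>(1) by blast
qed

text \<open>The dissipation inequality at one point, in scalars: \<open>n\<close>, \<open>p\<close>,
  \<open>h\<close>, \<open>r\<close> stand for \<open>norm z\<close>,
  \<open>\<phi> (norm z)\<close>, \<open>\<phi> x\<close>, \<open>\<rho> x\<close>, while
  \<open>A\<close>, \<open>s\<close>, \<open>v\<close>, \<open>y\<close> stand for
  \<open>\<alpha> (norm z)\<close>, \<open>\<sigma> \<bar>x\<bar>\<close>, the derivative of the
  original storage function, and \<open>f\<close>. The supply \<open>l * s\<close> is charged to
  \<open>r\<close> if \<open>A \<le> 2 * s\<close>, and to half of \<open>l * A\<close>
  otherwise.\<close>

lemma design_dissipation:
  fixes A v s z\<^sub>2 :: real
  assumes "0 \<le> l" "\<psi> \<le> l" "0 \<le> A" "v \<le> - A + s"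
    and storage: "(3 * p\<^sup>2 + 1) * n\<^sup>2 \<le> \<psi> * A / 2"
    and base: "2 * (2 * h + 3) \<le> r"
    and gain: "A \<le> 2 * s \<Longrightarrow> l * s + (2 * h + 3) * x\<^sup>2 \<le> r * x\<^sup>2 / 2"
    and f: "\<bar>y\<bar> \<le> 2 * n * p + 2 * \<bar>x\<bar> * h"
  shows "l * v + x * y - r * x\<^sup>2 \<le> - 2 * (n * p)\<^sup>2 - n\<^sup>2 - 2 * x\<^sup>2 - r * x\<^sup>2 / 2"
proof -
  have "x * y \<le> \<bar>x\<bar> * \<bar>y\<bar>" using abs_ge_self[of "x * y"] by (simp add: abs_mult)
  also have "\<dots> \<le> \<bar>x\<bar> * (2 * n * p + 2 * \<bar>x\<bar> * h)" using f by (intro mult_left_mono) auto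
  also have "\<dots> = 2 * \<bar>x\<bar> * (n * p) + 2 * h * \<bar>x\<bar>\<^sup>2" by (simp add: algebra_simps power2_eq_square)
  also have "2 * \<bar>x\<bar> * (n * p) \<le> \<bar>x\<bar>\<^sup>2 + (n * p)\<^sup>2" by (rule sum_squares_bound)
  finally have xy: "x * y \<le> x\<^sup>2 + (n * p)\<^sup>2 + 2 * h * x\<^sup>2" by simp
  have "(3 * p\<^sup>2 + 1) * n\<^sup>2 = 3 * (n * p)\<^sup>2 + n\<^sup>2" by (simp add: algebra_simps power_mult_distrib)
  moreover have "\<psi> * A \<le> l * A" using assms by (intro mult_right_mono)
  ultimately have lA: "3 * (n * p)\<^sup>2 + n\<^sup>2 \<le> l * A / 2" using storage by simp
  have "l * v \<le> l * (- A + s)" using assms by (intro mult_left_mono)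
  then have lv: "l * v \<le> l * s - l * A" by (simp add: algebra_simps)
  have squares: "0 \<le> (n * p)\<^sup>2" "0 \<le> n\<^sup>2" by simp_all
  show ?thesis
  proof (cases "A \<le> 2 * s")
    case True
    have "l * s + 2 * h * x\<^sup>2 + 3 * x\<^sup>2 \<le> r * x\<^sup>2 / 2" using gain[OF True] by (simp add: distrib_right)
    then show ?thesis using lv lA xy squares by linarith
  next
    case False
    then have "l * s \<le> l * (A / 2)" using assms(1) by (intro mult_left_mono) auto
    moreover have "2 * (2 * h + 3) * x\<^sup>2 \<le> r * x\<^sup>2" by (intro mult_right_mono base) simp
    then have "4 * h * x\<^sup>2 + 6 * x\<^sup>2 \<le> r * x\<^sup>2" by (simp add: distrib_right)
    ultimately show ?thesis using lv lA xy squares by (simp add: mult.assoc)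
  qed
qed

theorem mainTheorem4:
  fixes D :: "(real ^ 'l) set"
    and q :: "real ^ 'p \<Rightarrow> real \<Rightarrow> real ^ 'l \<Rightarrow> real ^ 'p"
    and f :: "real ^ 'p \<Rightarrow> real \<Rightarrow> real ^ 'l \<Rightarrow> real"
    and V :: "real ^ 'p \<Rightarrow> real"
    and \<alpha>\<^sub>l \<alpha>\<^sub>u \<alpha> \<sigma> :: "real \<Rightarrow> real"
  assumes "compact D"
    and "C1 (\<lambda>(z, x, d). q z x d)"
    and "C1 (\<lambda>(z, x, d). f z x d)"
    and "\<And>d. d \<in> D \<Longrightarrow> q 0 0 d = 0"
    and "\<And>d. d \<in> D \<Longrightarrow> f 0 0 d = 0"
    and "ISS_Lyapunov D q V \<alpha>\<^sub>l \<alpha>\<^sub>u \<alpha> \<sigma>"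
    and "Limsup (at_right 0) (\<lambda>s. ereal (s\<^sup>2 / \<alpha> s)) < \<infinity>"
    and "Limsup (at_right 0) (\<lambda>s. ereal (\<sigma> s / s\<^sup>2)) < \<infinity>"
  shows "\<exists>\<rho> \<gamma>. smooth \<rho> \<and> (\<forall>x. 0 < \<rho> x) \<and>
           smooth \<gamma> \<and> (\<forall>s\<ge>0. 0 \<le> \<gamma> s) \<and> (\<forall>s>0. 0 < \<gamma> s) \<and>
           (\<forall>d. uncertainty D d \<longrightarrow>
              globally_asymptotically_stable
                (\<lambda>T X. \<exists>ts. closed_loop_trajectory q f \<rho> \<gamma> d T ts X) \<and>
              (\<forall>T ts X. closed_loop_trajectory q f \<rho> \<gamma> d T ts X \<longrightarrow> Zeno_free ts))"
proof -
  note V = assms(6)[unfolded ISS_Lyapunov_def]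
  have K: "class_K_infinity \<alpha>\<^sub>l" "class_K_infinity \<alpha>\<^sub>u" "class_K_infinity \<alpha>" "class_K_infinity \<sigma>"
    and V0: "\<And>z. 0 \<le> V z" using V by auto
  have witness: ?thesis
    if "even_series \<rho>" "even_series m" "\<And>x. 1 \<le> \<rho> x" "\<And>s. 1 \<le> m s"
      and "\<And>d. uncertainty D d \<Longrightarrow> globally_asymptotically_stable
                (\<lambda>T X. \<exists>ts. closed_loop_trajectory q f \<rho> (\<lambda>s. s\<^sup>2 * m s) d T ts X) \<and>
              (\<forall>T ts X. closed_loop_trajectory q f \<rho> (\<lambda>s. s\<^sup>2 * m s) d T ts X \<longrightarrow> Zeno_free ts)" for \<rho> m
  proof (intro exI conjI)
    show "smooth \<rho>" "smooth (\<lambda>s. s\<^sup>2 * m s)"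
      using that(1,2) even_series_smooth even_series_power2_mult by blast+
    have "0 < \<rho> x" "0 < m x" for x using that(3,4)[of x] by linarith+
    then show "\<forall>x. 0 < \<rho> x" "\<forall>s\<ge>0. 0 \<le> s\<^sup>2 * m s" "\<forall>s>0. 0 < s\<^sup>2 * m s" by (simp_all add: less_imp_le)
  qed (use that(5) in blast)
  show ?thesis
  proof (cases "D = {}")
    \<comment> \<open>The bounds on \<open>V\<close> are quantified over \<open>D\<close> and give
      nothing when \<open>D\<close> is empty. No uncertainty signal exists then, so any positive
      smooth functions serve as witnesses.\<close>
    case True
    obtain h where h: "even_series h" "\<And>n x. real n \<le> x \<Longrightarrow> x \<le> real n + 1 \<Longrightarrow> 1 \<le> h x"
      using even_series_majorant_nat[of "\<lambda>_. 1"] by auto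
    have "1 \<le> h x" for x using h(2)[of 0 0] even_series_mono[OF h(1), of 0 x] by simp
    moreover have "\<not> uncertainty D d" for d using True by (auto simp: uncertainty_def)
    ultimately show ?thesis using h(1) by (intro witness[of h h]) auto
  next
    case False
    then have lower: "\<alpha>\<^sub>l (norm z) \<le> V z" and upper: "V z \<le> \<alpha>\<^sub>u (norm z)" for z using V by blast+
    have Vq: "frechet_derivative V (at z) (q z x d) \<le> - \<alpha> (norm z) + \<sigma> \<bar>x\<bar>" if "d \<in> D" for z x d
      using V that by blast
    have dV: "(V has_derivative frechet_derivative V (at z)) (at z)" for z
      using V unfolding C1_def by (metis frechet_derivative_at)
    obtain \<phi> where \<phi>: "even_series \<phi>"
        "\<And>z x d. d \<in> D \<Longrightarrow> \<bar>f z x d\<bar> \<le> 2 * norm z * \<phi> (norm z) + 2 * \<bar>x\<bar> * \<phi> x"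
      by (rule vector_field_majorant[OF assms(1,3,5)]) (assumption, rule that)
    obtain \<psi> where \<psi>: "even_series \<psi>" "\<And>z. 1 \<le> \<psi> (V z)"
        "\<And>z. (3 * (\<phi> (norm z))\<^sup>2 + 1) * (norm z)\<^sup>2 \<le> \<psi> (V z) * \<alpha> (norm z) / 2"
      by (rule storage_majorant[OF K(1,3) lower assms(7) \<phi>(1)]) (rule that)
    obtain l where l: "even_series l" "\<And>v. ((\<lambda>v. v * \<psi> v) has_real_derivative l v) (at v)" "\<And>v. \<psi> v \<le> l v"
      by (rule even_series_mult_id_deriv[OF \<psi>(1)]) (rule that)
    obtain \<rho> where \<rho>: "even_series \<rho>" "\<And>x. 1 \<le> \<rho> x" "\<And>x. 2 * (2 * \<phi> x + 3) \<le> \<rho> x"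
        "\<And>z x. \<alpha> (norm z) \<le> 2 * \<sigma> \<bar>x\<bar> \<Longrightarrow> l (V z) * \<sigma> \<bar>x\<bar> + (2 * \<phi> x + 3) * x\<^sup>2 \<le> \<rho> x * x\<^sup>2 / 2"
      by (rule gain_majorant[OF K(2,3,4) upper V0 assms(8) \<phi>(1) l(1)]) (rule that)
    obtain k where k: "even_series k" "\<And>x. ((\<lambda>x. x * \<rho> x) has_real_derivative k x) (at x)" "\<And>x. \<rho> x \<le> k x"
      by (rule even_series_mult_id_deriv[OF \<rho>(1)]) (rule that)
    obtain m where m: "even_series m" "\<And>s. 1 \<le> m s" "\<And>s. k (5 * s) * (10 * \<phi> (5 * s) + 4) \<le> m s"
        "\<And>s. 2 * (k (5 * s))\<^sup>2 \<le> m s"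
      by (rule triggering_majorant[OF k(1) \<phi>(1)]) (rule that)
    let ?V = "\<lambda>z. V z * \<psi> (V z)" and ?V' = "\<lambda>z v. l (V z) * frechet_derivative V (at z) v"
    \<comment> \<open>Since \<open>1 \<le> \<psi> (V z)\<close>, the original lower bound
      \<open>\<alpha>\<^sub>l\<close> also holds for the rescaled storage function, which stays
      proper and positive definite.\<close>
    interpret event_triggered_design D q f ?V ?V' \<alpha>\<^sub>l \<phi> \<rho> k m
    proof
      show "(?V has_derivative ?V' z) (at z)" for z
        using has_derivative_compose[OF dV l(2)[unfolded has_field_derivative_def]] by simp
      have "V 0 = 0" using upper[of 0] V0[of 0] K(2) by (simp add: class_K_infinity_def)
      then show "?V 0 = 0" by simp
      show "\<alpha>\<^sub>l (norm z) \<le> ?V z" for z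
        using lower[of z] mult_left_mono[OF \<psi>(2) V0, of z z] by simp
      show "?V' z (q z x d) + x * f z x d - \<rho> x * x\<^sup>2
          \<le> - 2 * (norm z * \<phi> (norm z))\<^sup>2 - (norm z)\<^sup>2 - 2 * x\<^sup>2 - \<rho> x * x\<^sup>2 / 2" if "d \<in> D" for z x d
        by (rule design_dissipation[OF even_series_nonneg[OF l(1)] l(3) _ Vq[OF that] \<psi>(3) \<rho>(3,4) \<phi>(2)[OF that]])
          (auto intro: class_K_infinity_nonneg[OF K(3)])
    qed (fact assms(1-3) K(1) \<phi> \<rho>(1,2) k(1,2) m)+
    have \<gamma>: "\<gamma> = (\<lambda>s. s\<^sup>2 * m s)" by (simp add: \<gamma>_def fun_eq_iff)
    show ?thesis
    proof (rule witness[OF \<rho>(1) m(1) \<rho>(2) m(2)])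
      fix d assume "uncertainty D d"
      then interpret uncertain_design D q f ?V ?V' \<alpha>\<^sub>l \<phi> \<rho> k m d by unfold_locales
      show "globally_asymptotically_stable (\<lambda>T X. \<exists>ts. closed_loop_trajectory q f \<rho> (\<lambda>s. s\<^sup>2 * m s) d T ts X) \<and>
          (\<forall>T ts X. closed_loop_trajectory q f \<rho> (\<lambda>s. s\<^sup>2 * m s) d T ts X \<longrightarrow> Zeno_free ts)"
        using closed_loop_stable traj_Zeno_free unfolding \<gamma> by blast
    qed
  qed
qed

end
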